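(* Let $G\in C(Q)$ be such that $m=0$ in the factorization $\det G=\gamma_-(\lambda_-/\lambda_+)^m\gamma_+$, and let $g$ be its $\Sigma$-symbol. Then $G$ admits a canonical bounded factorization unless $g$ admits a factorization $g=g_-r_0g_+$ with $g_\pm\in\mathcal GC_\mu^\pm(\Gamma)$ and $r_0=\frac{\tau}{(\xi+i)(\xi-ik_0)}$; in that case $G$ admits a non-canonical bounded factorization with partial indices $\pm1$.
   Context: Fix $k_0>1$, $\mu\in(0,1)$. $\Sigma$ is the compact Riemann surface of genus $1$ obtained from the curve $\tau^2=\mathfrak p(\xi)=(1+\xi^2)(k_0^2+\xi^2)$ in $\mathbb C^2$ by adding two points at infinity; $\Pi(\xi,\tau)=\xi$; functions of $\xi$ are regarded as functions on $\Sigma$ via $\Pi$. $\dot{\mathbb R}=\mathbb R\cup\{\infty\}$, $\Sigma^\pm=\Pi^{-1}(\mathbb C^\pm)$, $\Gamma=\Pi^{-1}(\dot{\mathbb R})$, the disjoint union of two closed curves $\Gamma_1$ ($\tau>0$ over $\mathbb R$) and $\Gamma_2$ ($\tau<0$ over $\mathbb R$). $C_\mu(\dot{\mathbb R})$: continuous functions on $\dot{\mathbb R}$ satisfying a Hölder condition of exponent $\mu$ (Hölder after transplanting to the unit circle by $\xi\mapsto(\xi-i)/(\xi+i)$); $C_\mu^\pm(\dot{\mathbb R})=C_\mu(\dot{\mathbb R})\cap H^\infty(\mathbb C^\pm)$. $C_\mu(\Gamma)$: functions on $\Gamma$ whose restrictions to $\Gamma_1,\Gamma_2$, viewed via $\Pi$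 on $\dot{\mathbb R}$, are in $C_\mu(\dot{\mathbb R})$. $C_\mu^\pm(\Gamma)$: elements of $C_\mu(\Gamma)$ extending continuously to $\Sigma^\pm\cup\Gamma$ and analytically to $\Sigma^\pm$. $\lambda_\pm(\xi)=\xi\pm i$. $\mathcal G\mathcal A$: invertible elements of $\mathcal A$. $\mathfrak p_1(\xi)=(\xi+i)(\xi+ik_0)$, $\mathfrak p_2(\xi)=(\xi-i)(\xi-ik_0)$, $q=\mathfrak p_1/\mathfrak p_2$, $Q=\begin{bmatrix}-q&0\\ 0&1\end{bmatrix}$. $C(Q)$ is the set of $G\in\mathcal G(C_\mu(\dot{\mathbb R}))^{2\times2}$ with $G^TQG=\det G\cdot Q$; such $G$ have the form $G=\begin{bmatrix}\alpha&\delta\\ q\delta&\alpha\end{bmatrix}$ with $\alpha,\delta\in C_\mu(\dot{\mathbb R})$. The $\Sigma$-symbol of $G$ is $g=\alpha+\frac{\tau}{\mathfrak p_2}\delta\in\mathcal GC_\mu(\Gamma)$. $\det G=\gamma_-(\lambda_-/\lambda_+)^m\gamma_+$ with $\gamma_\pm\in\mathcal GC_\mu^\pm(\dot{\mathbb R})$, $m\in\mathbb Z$. A bounded (Wiener–Hopf) factorization of $G$ is $G=G_-DG_+$ with $G_\pm\in\mathcal G(C_\mu^\pm(\dot{\mathbb R}))^{2\times2}$ and $D=\operatorname{diag}((\lambda_-/\lambda_+)^{k_1},(\lambda_-/\lambda_+)^{k_2})$, $k_1,k_2\in\mathbb Z$ (the partial indices, unique up to order); it is canonical if $k_1=k_2=0$.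 *)

theory Defs
  imports "HOL-Complex_Analysis.Complex_Analysis"
begin

section \<open>The extended real line and its function algebras\<close>

text \<open>The Riemann sphere is the type \<open>complex option\<close>, with \<open>None\<close> as the point at infinity.
  A function on a subset \<open>X\<close> (such as \<open>Rdot\<close>) is a function on the whole type of which only the
  values on \<open>X\<close> matter.\<close>

definition Rdot :: "complex option set" where
  "Rdot = insert None (range (\<lambda>x::real. Some (complex_of_real x)))"

definition upper_half :: "complex set" where
  "upper_half = {z. Im z > 0}"

definition lower_half :: "complex set" where
  "lower_half = {z. Im z < 0}"

text \<open>The function \<open>\<lambda>\<^sub>- / \<lambda>\<^sub>+\<close>; the same map carries \<open>Rdot\<close> onto the unit circle.\<close>

definition cay :: "complex option \<Rightarrow> complex" where
  "cay z = (case z of None \<Rightarrow> 1 | Some \<xi> \<Rightarrow> (\<xi> - \<i>) / (\<xi> + \<i>))"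

definition C_mu :: "real \<Rightarrow> (complex option \<Rightarrow> complex) set" where
  "C_mu \<mu> = {f. \<exists>M. \<forall>x\<in>Rdot. \<forall>y\<in>Rdot. norm (f x - f y) \<le> M * dist (cay x) (cay y) powr \<mu>}"

text \<open>\<open>U\<close> is a half-plane. As usual, a bounded analytic function is identified with its
  nontangential boundary function, defined almost everywhere on the real line.\<close>

definition H_infty :: "complex set \<Rightarrow> (complex option \<Rightarrow> complex) set" where
  "H_infty U = {f. \<exists>F. F holomorphic_on U \<and> bounded (F ` U) \<and>
     (AE x in lborel. \<forall>a>0.
        (F \<longlongrightarrow> f (Some (complex_of_real x)))
          (at (complex_of_real x) within {z \<in> U. \<bar>Re z - x\<bar> \<le> a * \<bar>Im z\<bar>}))}"

definition C_mu_half :: "real \<Rightarrow> complex set \<Rightarrow> (complex option \<Rightarrow> complex) set" where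
  "C_mu_half \<mu> U = C_mu \<mu> \<inter> H_infty U"

definition units_on :: "'a set \<Rightarrow> ('a \<Rightarrow> complex) set \<Rightarrow> ('a \<Rightarrow> complex) set" where
  "units_on X A = {f \<in> A. \<exists>h\<in>A. \<forall>x\<in>X. f x * h x = 1}"

definition mat2_over :: "('a \<Rightarrow> complex) set \<Rightarrow> ('a \<Rightarrow> complex^2^2) set" where
  "mat2_over A = {G. \<forall>i j. (\<lambda>x. G x $ i $ j) \<in> A}"

definition mat2_units_on :: "'a set \<Rightarrow> ('a \<Rightarrow> complex) set \<Rightarrow> ('a \<Rightarrow> complex^2^2) set" where
  "mat2_units_on X A = {G \<in> mat2_over A.
     \<exists>H \<in> mat2_over A. \<forall>x\<in>X. G x ** H x = mat 1 \<and> H x ** G x = mat 1}"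


section \<open>The elliptic Riemann surface\<close>

definition p_poly :: "real \<Rightarrow> complex \<Rightarrow> complex" where
  "p_poly k0 \<xi> = (1 + \<xi>^2) * (complex_of_real k0 ^ 2 + \<xi>^2)"

definition p1 :: "real \<Rightarrow> complex \<Rightarrow> complex" where
  "p1 k0 \<xi> = (\<xi> + \<i>) * (\<xi> + \<i> * complex_of_real k0)"

definition p2 :: "real \<Rightarrow> complex \<Rightarrow> complex" where
  "p2 k0 \<xi> = (\<xi> - \<i>) * (\<xi> - \<i> * complex_of_real k0)"

text \<open>\<open>Pt \<xi> \<tau>\<close> is a point of the affine curve, and \<open>At_inf \<sigma>\<close>, for \<open>\<sigma> = 1\<close> or \<open>\<sigma> = -1\<close>, is the
  point at infinity at which \<open>\<tau> / \<xi>\<^sup>2\<close> takes the value \<open>\<sigma>\<close>.\<close>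

datatype surf_point = Pt complex complex | At_inf complex

definition Sig :: "real \<Rightarrow> surf_point set" where
  "Sig k0 = {Pt \<xi> \<tau> | \<xi> \<tau>. \<tau>^2 = p_poly k0 \<xi>} \<union> {At_inf 1, At_inf (-1)}"

definition Proj :: "surf_point \<Rightarrow> complex option" where
  "Proj P = (case P of Pt \<xi> \<tau> \<Rightarrow> Some \<xi> | At_inf \<sigma> \<Rightarrow> None)"

definition Sig_half :: "real \<Rightarrow> complex set \<Rightarrow> surf_point set" where
  "Sig_half k0 U = {P \<in> Sig k0. Proj P \<in> Some ` U}"

definition Gam :: "real \<Rightarrow> surf_point set" where
  "Gam k0 = {P \<in> Sig k0. Proj P \<in> Rdot}"

text \<open>The inverse of the projection on \<open>\<Gamma>\<^sub>1\<close> (for \<open>\<sigma> = 1\<close>) and on \<open>\<Gamma>\<^sub>2\<close> (for \<open>\<sigma> = -1\<close>),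
  meaningful on \<open>Rdot\<close>.\<close>

definition Gam_lift :: "real \<Rightarrow> complex \<Rightarrow> complex option \<Rightarrow> surf_point" where
  "Gam_lift k0 \<sigma> z = (case z of
      None \<Rightarrow> At_inf \<sigma>
    | Some \<xi> \<Rightarrow> Pt \<xi> (\<sigma> * complex_of_real (sqrt ((1 + (Re \<xi>)^2) * (k0^2 + (Re \<xi>)^2)))))"

lemma Gam_lift_image: "k0 > 1 \<Longrightarrow> Gam k0 = Gam_lift k0 1 ` Rdot \<union> Gam_lift k0 (-1) ` Rdot"
proof -
  have s: "t^2 = p_poly k0 (complex_of_real x) \<longleftrightarrow> t = complex_of_real (sqrt ((1+x^2)*(k0^2+x^2))) \<or> t = - complex_of_real (sqrt ((1+x^2)*(k0^2+x^2)))" for t x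
  proof -
    have "p_poly k0 (complex_of_real x) = complex_of_real (sqrt ((1+x^2)*(k0^2+x^2)))^2"
      unfolding p_poly_def of_real_power[symmetric] by simp
    then show ?thesis by (simp add: power2_eq_iff)
  qed
  show ?thesis
    unfolding Gam_def Sig_def Rdot_def Proj_def Gam_lift_def
    by (auto simp: s image_iff)
qed

text \<open>The compact surface is glued from the affine curve and the curve
  \<open>\<omega>\<^sup>2 = (1 + \<zeta>\<^sup>2) (1 + k\<^sub>0\<^sup>2 \<zeta>\<^sup>2)\<close> by \<open>\<zeta> = 1 / \<xi>\<close>, \<open>\<omega> = \<tau> / \<xi>\<^sup>2\<close>. Both pieces are open, so continuity on
  a subset of the surface may be tested on the two pieces separately.\<close>

definition chart_fin :: "complex \<times> complex \<Rightarrow> surf_point" where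
  "chart_fin = (\<lambda>(\<xi>, \<tau>). Pt \<xi> \<tau>)"

definition chart_inf :: "complex \<times> complex \<Rightarrow> surf_point" where
  "chart_inf = (\<lambda>(\<zeta>, \<omega>). if \<zeta> = 0 then At_inf \<omega> else Pt (1 / \<zeta>) (\<omega> / \<zeta>^2))"

definition surf_continuous_on :: "surf_point set \<Rightarrow> (surf_point \<Rightarrow> complex) \<Rightarrow> bool" where
  "surf_continuous_on S F \<longleftrightarrow>
     continuous_on (chart_fin -` S) (F \<circ> chart_fin) \<and>
     continuous_on (chart_inf -` S) (F \<circ> chart_inf)"

text \<open>Analyticity at a finite point of the surface, by means of a regular holomorphic
  parametrization of the curve near that point. At a branch point (\<open>\<tau> = 0\<close>), where \<open>\<xi>\<close> is not a
  local coordinate, \<open>\<tau>\<close> may serve as the parameter.\<close>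

definition local_param ::
  "real \<Rightarrow> complex \<Rightarrow> complex \<Rightarrow> (complex \<Rightarrow> complex) \<Rightarrow> (complex \<Rightarrow> complex) \<Rightarrow> bool" where
  "local_param k0 \<xi>0 \<tau>0 x t \<longleftrightarrow>
     x analytic_on {0} \<and> t analytic_on {0} \<and> x 0 = \<xi>0 \<and> t 0 = \<tau>0 \<and>
     (deriv x 0 \<noteq> 0 \<or> deriv t 0 \<noteq> 0) \<and>
     (\<forall>\<^sub>F z in nhds 0. (t z)^2 = p_poly k0 (x z))"

definition surf_analytic_on :: "real \<Rightarrow> surf_point set \<Rightarrow> (surf_point \<Rightarrow> complex) \<Rightarrow> bool" where
  "surf_analytic_on k0 S F \<longleftrightarrow>
     (\<forall>\<xi> \<tau>. Pt \<xi> \<tau> \<in> S \<longrightarrow>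
        (\<exists>x t. local_param k0 \<xi> \<tau> x t \<and> (\<lambda>z. F (Pt (x z) (t z))) analytic_on {0}))"

definition C_mu_Gam :: "real \<Rightarrow> real \<Rightarrow> (surf_point \<Rightarrow> complex) set" where
  "C_mu_Gam k0 \<mu> = {g. \<forall>\<sigma>\<in>{1, -1}. (\<lambda>z. g (Gam_lift k0 \<sigma> z)) \<in> C_mu \<mu>}"

definition C_mu_Gam_half ::
  "real \<Rightarrow> real \<Rightarrow> complex set \<Rightarrow> (surf_point \<Rightarrow> complex) set" where
  "C_mu_Gam_half k0 \<mu> U = {g \<in> C_mu_Gam k0 \<mu>.
     \<exists>F. (\<forall>P\<in>Gam k0. F P = g P) \<and>
         surf_continuous_on (Sig_half k0 U \<union> Gam k0) F \<and>
         surf_analytic_on k0 (Sig_half k0 U) F}"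


section \<open>The class \<open>C(Q)\<close>, symbols and factorizations\<close>

text \<open>Below, the value of a rational function at infinity is its limit there.\<close>

definition q_fun :: "real \<Rightarrow> complex option \<Rightarrow> complex" where
  "q_fun k0 z = (case z of None \<Rightarrow> 1 | Some \<xi> \<Rightarrow> p1 k0 \<xi> / p2 k0 \<xi>)"

definition Q_mat :: "real \<Rightarrow> complex option \<Rightarrow> complex^2^2" where
  "Q_mat k0 z = vector [vector [- q_fun k0 z, 0], vector [0, 1]]"

definition C_Q :: "real \<Rightarrow> real \<Rightarrow> (complex option \<Rightarrow> complex^2^2) set" where
  "C_Q k0 \<mu> = {G \<in> mat2_units_on Rdot (C_mu \<mu>).
     \<forall>x\<in>Rdot. transpose (G x) ** Q_mat k0 x ** G x = mat (det (G x)) ** Q_mat k0 x}"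

lemma q_fun_nonzero: "k0 > 1 \<Longrightarrow> x \<in> Rdot \<Longrightarrow> q_fun k0 x \<noteq> 0"
  by (auto simp: q_fun_def Rdot_def p1_def p2_def) (auto simp: complex_eq_iff)

lemma C_Q_form:
  assumes "G \<in> C_Q k0 \<mu>" and "k0 > 1" and "x \<in> Rdot"
  shows "G x = vector [vector [G x $ 1 $ 1, G x $ 1 $ 2],
                       vector [q_fun k0 x * G x $ 1 $ 2, G x $ 1 $ 1]]"
proof -
  define q a b c d where "q = q_fun k0 x" and "a = G x $ 1 $ 1" and "b = G x $ 1 $ 2" and "c = G x $ 2 $ 1" and "d = G x $ 2 $ 2"
  note defs = q_def[symmetric] a_def[symmetric] b_def[symmetric] c_def[symmetric] d_def[symmetric]
  have q0: "q \<noteq> 0" using q_fun_nonzero assms by (simp add: q_def)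
  obtain H where "G x ** H = mat 1" using assms by (auto simp: C_Q_def mat2_units_on_def)
  then have "det (G x) * det H = 1" by (metis det_I det_mul)
  then have D: "a * d - b * c \<noteq> 0" by (auto simp: det_2 defs)
  have "transpose (G x) ** Q_mat k0 x ** G x = mat (det (G x)) ** Q_mat k0 x"
    using assms by (auto simp: C_Q_def)
  then have E: "c*c - q*a*a = -(a*d-b*c)*q" "c*d - q*a*b = 0" "d*d - q*b*b = a*d-b*c"
    by (auto simp: vec_eq_iff forall_2 matrix_matrix_mult_def sum_2 transpose_def mat_def Q_mat_def det_2 defs algebra_simps)
  have "(a*d-b*c) * (c - q*b) = 0" "(a*d-b*c) * (a - d) = 0" using E q0 by algebra+
  then have "c = q*b" "d = a" using D by auto
  then show ?thesis by (simp add: vec_eq_iff forall_2 defs)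
qed

definition tau_over_p2 :: "real \<Rightarrow> surf_point \<Rightarrow> complex" where
  "tau_over_p2 k0 P = (case P of Pt \<xi> \<tau> \<Rightarrow> \<tau> / p2 k0 \<xi> | At_inf \<sigma> \<Rightarrow> \<sigma>)"

definition Sig_symbol ::
  "real \<Rightarrow> (complex option \<Rightarrow> complex^2^2) \<Rightarrow> surf_point \<Rightarrow> complex" where
  "Sig_symbol k0 G P = G (Proj P) $ 1 $ 1 + tau_over_p2 k0 P * G (Proj P) $ 1 $ 2"

definition r0 :: "real \<Rightarrow> surf_point \<Rightarrow> complex" where
  "r0 k0 P = (case P of
      Pt \<xi> \<tau> \<Rightarrow> \<tau> / ((\<xi> + \<i>) * (\<xi> - \<i> * complex_of_real k0))
    | At_inf \<sigma> \<Rightarrow> \<sigma>)"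

definition D_mat :: "int \<Rightarrow> int \<Rightarrow> complex option \<Rightarrow> complex^2^2" where
  "D_mat k1 k2 z = vector [vector [cay z powi k1, 0], vector [0, cay z powi k2]]"

definition bounded_factorization ::
  "real \<Rightarrow> (complex option \<Rightarrow> complex^2^2) \<Rightarrow> int \<Rightarrow> int \<Rightarrow> bool" where
  "bounded_factorization \<mu> G k1 k2 \<longleftrightarrow>
     (\<exists>Gm \<in> mat2_units_on Rdot (C_mu_half \<mu> lower_half).
      \<exists>Gp \<in> mat2_units_on Rdot (C_mu_half \<mu> upper_half).
        \<forall>x\<in>Rdot. G x = Gm x ** D_mat k1 k2 x ** Gp x)"

definition r0_factorization :: "real \<Rightarrow> real \<Rightarrow> (surf_point \<Rightarrow> complex) \<Rightarrow> bool" where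
  "r0_factorization k0 \<mu> g \<longleftrightarrow>
     (\<exists>gm \<in> units_on (Gam k0) (C_mu_Gam_half k0 \<mu> lower_half).
      \<exists>gp \<in> units_on (Gam k0) (C_mu_Gam_half k0 \<mu> upper_half).
        \<forall>P\<in>Gam k0. g P = gm P * r0 k0 P * gp P)"

end

theory Submission
  imports Defs
begin

text \<open>
  Over the line the matrices of \<open>C(Q)\<close> have the common eigenvectors \<open>(1, \<plusminus>t)\<close>, \<open>t = \<tau> / p\<^sub>2\<close>, and the
  eigenvalues of \<open>G\<close> are the values of its symbol \<open>g\<close> on the two curves over the line. Multiplying
  matrices means multiplying symbols (\<open>symb_mult\<close>). A Hoelder function that extends to the lower
  half surface is \<open>u + t v\<close>, one that extends to the upper half surface is \<open>u + v / t\<close>, where \<open>u\<close> and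
  \<open>v\<close> extend to the corresponding half-plane (\<open>surface_function_components\<close>,
  \<open>surface_function_from_components\<close>). So units on the half surfaces give left and right factors.

  A factorization exists for the following reason (\<open>C_Q_factorization_exists\<close>). Approximating the
  entries by Laurent polynomials in \<open>cay\<close> gives \<open>g = h e\<^sup>\<phi>\<close> with \<open>h\<close> algebraic and \<open>\<phi>\<close> small. As the surface has genus one, there is
  one linear condition, \<open>obstruction\<close>, for \<open>\<phi>\<close> to be the sum of a function on the lower and a function
  on the upper half surface. Replacing \<open>h\<close> by \<open>h (1 + s r\<^sub>0)\<close> changes the obstruction analytically in \<open>s\<close>,
  and by the open mapping theorem some small \<open>s\<close> makes it vanish (\<open>r0_log_obstruction_surj\<close>). Then
  \<open>e\<^sup>\<phi>\<close> splits (\<open>exponential_splitting\<close>), and what remains is a rational matrix, which is factorized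
  by elementary operations (\<open>rational_symbol_factorization\<close>). Analysis enters only through scalar
  Hoelder functions: they split into boundary values of analytic functions (\<open>C_mu_splitting\<close>), and
  bounded analytic functions with Hoelder boundary values are continuous up to the boundary
  (\<open>C_mu_half_eq_disc_alg\<close>).

  Since the determinant has winding number zero, the indices of any factorization are \<open>k, - k\<close>
  (\<open>index_sum_zero\<close>). If \<open>k > 0\<close>, a row of the inverse left factor is a function \<open>f\<^sub>-\<close> on the lower half
  surface for which \<open>f\<^sub>- g\<close> extends to the upper half surface with a factor \<open>cay\<^sup>k\<close>. The product of the
  values on the two sheets turns this into a relation between functions on the half-planes, and
  Liouville's theorem yields \<open>k = 1\<close> and that \<open>f\<^sub>-\<close> and \<open>f\<^sub>- g / r\<^sub>0\<close> are units; hence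
  \<open>g = f\<^sub>-\<^sup>-\<^sup>1 r\<^sub>0 g\<^sub>+\<close> (\<open>positive_index_r0_factorization\<close>). Conversely \<open>r\<^sub>0 = t cay\<close> has a matrix with
  zero diagonal whose other entries are, up to units, \<open>cay\<close> and \<open>1 / cay\<close>, so that the indices are \<open>\<plusminus>1\<close>
  (\<open>r0_factorization_indices\<close>), which excludes a canonical factorization (\<open>not_canonical\<close>).
\<close>

section \<open>Hoelder functions on the extended line\<close>

lemma norm_cay: "x \<in> Rdot \<Longrightarrow> norm (cay x) = 1"
proof -
  have "norm (complex_of_real r - \<i>) = norm (complex_of_real r + \<i>)" for r
    by (simp add: cmod_def)
  moreover have "complex_of_real r + \<i> \<noteq> 0" for r by (simp add: complex_eq_iff)
  ultimately show "x \<in> Rdot \<Longrightarrow> norm (cay x) = 1"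
    by (auto simp: cay_def Rdot_def norm_divide)
qed

lemma cay_nonzero: "x \<in> Rdot \<Longrightarrow> cay x \<noteq> 0"
  using norm_cay by fastforce

lemma C_muI:
  "(\<And>x y. x \<in> Rdot \<Longrightarrow> y \<in> Rdot \<Longrightarrow> norm (f x - f y) \<le> M * dist (cay x) (cay y) powr \<mu>) \<Longrightarrow> f \<in> C_mu \<mu>"
  by (auto simp: C_mu_def)

lemma C_muE:
  assumes "f \<in> C_mu \<mu>"
  obtains M where "M \<ge> 0"
    "\<And>x y. x \<in> Rdot \<Longrightarrow> y \<in> Rdot \<Longrightarrow> norm (f x - f y) \<le> M * dist (cay x) (cay y) powr \<mu>"
proof -
  from assms obtain M where M: "\<forall>x\<in>Rdot. \<forall>y\<in>Rdot. norm (f x - f y) \<le> M * dist (cay x) (cay y) powr \<mu>"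
    by (auto simp: C_mu_def)
  show ?thesis
  proof (rule that[of "\<bar>M\<bar>"])
    fix x y assume "x \<in> Rdot" "y \<in> Rdot"
    then have "norm (f x - f y) \<le> M * dist (cay x) (cay y) powr \<mu>" using M by blast
    also have "\<dots> \<le> \<bar>M\<bar> * dist (cay x) (cay y) powr \<mu>" by (intro mult_right_mono) auto
    finally show "norm (f x - f y) \<le> \<bar>M\<bar> * dist (cay x) (cay y) powr \<mu>" .
  qed simp
qed

lemma C_mu_cong: "f \<in> C_mu \<mu> \<Longrightarrow> (\<And>x. x \<in> Rdot \<Longrightarrow> g x = f x) \<Longrightarrow> g \<in> C_mu \<mu>"
  by (auto simp: C_mu_def)

lemma C_mu_const [simp]: "(\<lambda>x. c) \<in> C_mu \<mu>"
  by (rule C_muI[where M=0]) simp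

lemma C_mu_add: "f \<in> C_mu \<mu> \<Longrightarrow> g \<in> C_mu \<mu> \<Longrightarrow> (\<lambda>x. f x + g x) \<in> C_mu \<mu>"
proof (elim C_muE)
  fix M N assume M: "\<And>x y. x \<in> Rdot \<Longrightarrow> y \<in> Rdot \<Longrightarrow> norm (f x - f y) \<le> M * dist (cay x) (cay y) powr \<mu>"
    and N: "\<And>x y. x \<in> Rdot \<Longrightarrow> y \<in> Rdot \<Longrightarrow> norm (g x - g y) \<le> N * dist (cay x) (cay y) powr \<mu>"
  show ?thesis
  proof (rule C_muI[where M="M+N"])
    fix x y assume xy: "x \<in> Rdot" "y \<in> Rdot"
    have "norm (f x + g x - (f y + g y)) \<le> norm (f x - f y) + norm (g x - g y)"
      by (rule norm_diff_triangle_ineq)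
    with M[OF xy] N[OF xy] show "norm (f x + g x - (f y + g y)) \<le> (M+N) * dist (cay x) (cay y) powr \<mu>"
      by (simp add: algebra_simps)
  qed
qed

lemma C_mu_bounded:
  assumes "f \<in> C_mu \<mu>" and "0 < \<mu>"
  obtains B where "B > 0" "\<And>x. x \<in> Rdot \<Longrightarrow> norm (f x) \<le> B"
proof -
  obtain M where M: "M \<ge> 0"
    "\<And>x y. x \<in> Rdot \<Longrightarrow> y \<in> Rdot \<Longrightarrow> norm (f x - f y) \<le> M * dist (cay x) (cay y) powr \<mu>"
    by (rule C_muE[OF assms(1)]) (rule that; assumption)
  have N: "None \<in> Rdot" by (simp add: Rdot_def)
  show ?thesis
  proof (rule that[of "norm (f None) + M * 2 powr \<mu> + 1"])
    fix x assume x: "x \<in> Rdot"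
    have "dist (cay x) (cay None) \<le> 2"
      using norm_triangle_ineq4[of "cay x" "cay None"] norm_cay[OF x] norm_cay[OF N] by (simp add: dist_norm)
    then have "dist (cay x) (cay None) powr \<mu> \<le> 2 powr \<mu>" using assms(2) by (intro powr_mono2) auto
    then have "norm (f x - f None) \<le> M * 2 powr \<mu>"
      using M(2)[OF x N] mult_left_mono[OF _ M(1)] by fastforce
    then show "norm (f x) \<le> norm (f None) + M * 2 powr \<mu> + 1"
      using norm_triangle_ineq2[of "f x" "f None"] by linarith
  next
    have "0 \<le> M * 2 powr \<mu>" using M(1) by simp
    then show "0 < norm (f None) + M * 2 powr \<mu> + 1"
      using norm_ge_zero[of "f None"] by linarith
  qed
qed

lemma C_mu_mult:
  assumes "f \<in> C_mu \<mu>" "g \<in> C_mu \<mu>" "0 < \<mu>"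
  shows "(\<lambda>x. f x * g x) \<in> C_mu \<mu>"
proof -
  obtain M where M: "M \<ge> 0"
    "\<And>x y. x \<in> Rdot \<Longrightarrow> y \<in> Rdot \<Longrightarrow> norm (f x - f y) \<le> M * dist (cay x) (cay y) powr \<mu>"
    by (rule C_muE[OF assms(1)]) (rule that; assumption)
  obtain N where N: "N \<ge> 0"
    "\<And>x y. x \<in> Rdot \<Longrightarrow> y \<in> Rdot \<Longrightarrow> norm (g x - g y) \<le> N * dist (cay x) (cay y) powr \<mu>"
    by (rule C_muE[OF assms(2)]) (rule that; assumption)
  obtain A where A: "A > 0" "\<And>x. x \<in> Rdot \<Longrightarrow> norm (f x) \<le> A" by (rule C_mu_bounded[OF assms(1,3)]) (rule that; assumption)
  obtain B where B: "B > 0" "\<And>x. x \<in> Rdot \<Longrightarrow> norm (g x) \<le> B" by (rule C_mu_bounded[OF assms(2,3)]) (rule that; assumption)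
  show ?thesis
  proof (rule C_muI[where M="A*N+B*M"])
    fix x y assume xy: "x \<in> Rdot" "y \<in> Rdot"
    have "f x * g x - f y * g y = f x * (g x - g y) + g y * (f x - f y)" by (simp add: algebra_simps)
    then have "norm (f x * g x - f y * g y) \<le> norm (f x) * norm (g x - g y) + norm (g y) * norm (f x - f y)"
      by (metis norm_mult norm_triangle_ineq)
    also have "\<dots> \<le> A * (N * dist (cay x) (cay y) powr \<mu>) + B * (M * dist (cay x) (cay y) powr \<mu>)"
      using A B M N xy by (intro add_mono mult_mono) auto
    finally show "norm (f x * g x - f y * g y) \<le> (A*N+B*M) * dist (cay x) (cay y) powr \<mu>"
      by (simp add: algebra_simps)
  qed
qed

lemma C_mu_uminus: "f \<in> C_mu \<mu> \<Longrightarrow> (\<lambda>x. - f x) \<in> C_mu \<mu>"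
  by (auto simp: C_mu_def norm_minus_commute)

lemma C_mu_diff: "f \<in> C_mu \<mu> \<Longrightarrow> g \<in> C_mu \<mu> \<Longrightarrow> (\<lambda>x. f x - g x) \<in> C_mu \<mu>"
  using C_mu_add[OF _ C_mu_uminus] by fastforce

lemma C_mu_Lipschitz:
  assumes "f \<in> C_mu \<mu>" "\<And>x y. x \<in> Rdot \<Longrightarrow> y \<in> Rdot \<Longrightarrow> norm (g x - g y) \<le> L * norm (f x - f y)" "L \<ge> 0"
  shows "g \<in> C_mu \<mu>"
proof -
  obtain M where M: "M \<ge> 0"
    "\<And>x y. x \<in> Rdot \<Longrightarrow> y \<in> Rdot \<Longrightarrow> norm (f x - f y) \<le> M * dist (cay x) (cay y) powr \<mu>"
    by (rule C_muE[OF assms(1)]) (rule that; assumption)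
  show ?thesis
  proof (rule C_muI[where M="L*M"])
    fix x y assume xy: "x \<in> Rdot" "y \<in> Rdot"
    have "L * norm (f x - f y) \<le> L * (M * dist (cay x) (cay y) powr \<mu>)" using M(2)[OF xy] assms(3) by (rule mult_left_mono)
    then show "norm (g x - g y) \<le> L*M * dist (cay x) (cay y) powr \<mu>" using assms(2)[OF xy] by (simp add: mult.assoc)
  qed
qed

lemma C_mu_comp_holomorphic:
  assumes f: "f \<in> C_mu \<mu>" and \<phi>: "\<phi> holomorphic_on S" "open S" and K: "compact K" "convex K" "K \<subseteq> S"
    and fK: "\<And>x. x \<in> Rdot \<Longrightarrow> f x \<in> K"
  shows "(\<lambda>x. \<phi> (f x)) \<in> C_mu \<mu>"
proof -
  have "continuous_on K (deriv \<phi>)"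
    using holomorphic_on_imp_continuous_on[OF holomorphic_deriv[OF \<phi>]] K(3) continuous_on_subset by blast
  then have "bounded (deriv \<phi> ` K)" using compact_continuous_image compact_imp_bounded K(1) by blast
  then obtain B where B: "B > 0" "\<And>z. z \<in> K \<Longrightarrow> norm (deriv \<phi> z) \<le> B" unfolding bounded_pos by blast
  show ?thesis
  proof (rule C_mu_Lipschitz[OF f])
    fix x y assume "x \<in> Rdot" "y \<in> Rdot"
    then have "f x \<in> K" "f y \<in> K" using fK by auto
    moreover have "(\<phi> has_field_derivative deriv \<phi> z) (at z within K)" if "z \<in> K" for z
      using holomorphic_derivI[OF \<phi>] that K(3) by blast
    ultimately show "norm (\<phi> (f x) - \<phi> (f y)) \<le> B * norm (f x - f y)"
      by (intro field_differentiable_bound[OF K(2)]) (use B in auto)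
  qed (use B in simp)
qed

lemma C_mu_entire:
  assumes "f \<in> C_mu \<mu>" "0 < \<mu>" "\<phi> holomorphic_on UNIV"
  shows "(\<lambda>x. \<phi> (f x)) \<in> C_mu \<mu>"
proof -
  obtain B where B: "B > 0" "\<And>x. x \<in> Rdot \<Longrightarrow> norm (f x) \<le> B" by (rule C_mu_bounded[OF assms(1,2)]) (rule that; assumption)
  show ?thesis
    by (rule C_mu_comp_holomorphic[OF assms(1,3), where K="cball 0 B"]) (use B in auto)
qed

lemma C_mu_inverse:
  assumes f: "f \<in> C_mu \<mu>" and c: "c > 0" "\<And>x. x \<in> Rdot \<Longrightarrow> norm (f x) \<ge> c"
  shows "(\<lambda>x. 1 / f x) \<in> C_mu \<mu>"
proof (rule C_mu_Lipschitz[OF f])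
  fix x y assume xy: "x \<in> Rdot" "y \<in> Rdot"
  have n: "norm (f x) \<ge> c" "norm (f y) \<ge> c" using c xy by auto
  then have nz: "f x \<noteq> 0" "f y \<noteq> 0" using c(1) by auto
  then have "norm (1 / f x - 1 / f y) = norm (f x - f y) / (norm (f x) * norm (f y))"
    using norm_minus_commute[of "f x" "f y"] by (simp add: diff_frac_eq norm_divide norm_mult)
  also have "\<dots> \<le> norm (f x - f y) / (c * c)"
    using n c(1) by (intro divide_left_mono mult_mono mult_pos_pos) auto
  finally show "norm (1 / f x - 1 / f y) \<le> (1/(c*c)) * norm (f x - f y)" by simp
qed (use c in simp)

lemma C_mu_cay:
  assumes "0 < \<mu>" "\<mu> \<le> 1" shows "cay \<in> C_mu \<mu>"
proof (rule C_muI[where M="2 powr (1-\<mu>)"])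
  fix x y assume xy: "x \<in> Rdot" "y \<in> Rdot"
  have d: "dist (cay x) (cay y) \<le> 2"
    using norm_triangle_ineq4[of "cay x" "cay y"] norm_cay xy by (simp add: dist_norm)
  have "dist (cay x) (cay y) = dist (cay x) (cay y) powr (1-\<mu>) * dist (cay x) (cay y) powr \<mu>"
    by (cases "cay x = cay y") (auto simp flip: powr_add)
  also have "\<dots> \<le> 2 powr (1-\<mu>) * dist (cay x) (cay y) powr \<mu>"
    using d assms by (intro mult_right_mono powr_mono2) auto
  finally show "norm (cay x - cay y) \<le> 2 powr (1-\<mu>) * dist (cay x) (cay y) powr \<mu>" by (simp add: dist_norm)
qed


section \<open>Boundary values of disc functions\<close>

definition half :: "real \<Rightarrow> complex set" where
  "half e = {z. e * Im z < 0}"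

lemma half_lower: "half 1 = lower_half" and half_upper: "half (-1) = upper_half"
  by (auto simp: half_def lower_half_def upper_half_def)

text \<open>The two half-planes are treated together through a sign \<open>e\<close>: the coordinate below maps
  \<open>half e\<close> onto the unit disc. For \<open>e = -1\<close> it is \<open>cay\<close>, for \<open>e = 1\<close> it is \<open>1 / cay\<close>.\<close>

definition disc_coord :: "real \<Rightarrow> complex option \<Rightarrow> complex" where
  "disc_coord e z = (case z of None \<Rightarrow> 1 | Some \<xi> \<Rightarrow> (\<xi> + of_real e * \<i>) / (\<xi> - of_real e * \<i>))"

lemma disc_coord_upper: "disc_coord (-1) z = cay z"
  by (auto simp: disc_coord_def cay_def split: option.split)

lemma disc_coord_lower: "disc_coord 1 z = 1 / cay z"
  by (auto simp: disc_coord_def cay_def split: option.split)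

lemma disc_coord_cases:
  "e \<in> {1, -1} \<Longrightarrow> x \<in> Rdot \<Longrightarrow> disc_coord e x = cay x \<or> disc_coord e x = 1 / cay x"
  by (auto simp: disc_coord_upper disc_coord_lower)

lemma norm_disc_coord: "e \<in> {1, -1} \<Longrightarrow> x \<in> Rdot \<Longrightarrow> norm (disc_coord e x) = 1"
  using disc_coord_cases norm_cay by (fastforce simp: norm_divide)

lemma disc_coord_C_mu:
  assumes "e \<in> {1, -1}" "0 < \<mu>" "\<mu> \<le> 1" shows "disc_coord e \<in> C_mu \<mu>"
proof -
  have "(\<lambda>x. 1 / cay x) \<in> C_mu \<mu>"
    by (rule C_mu_inverse[OF C_mu_cay, where c=1]) (use norm_cay assms in auto)
  then show ?thesis using assms C_mu_cay[of \<mu>]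
    by (auto intro: C_mu_cong simp: disc_coord_upper disc_coord_lower)
qed

lemma disc_coord_onto_circle:
  assumes "e \<in> {1, -1}" "norm w = 1" shows "\<exists>x\<in>Rdot. disc_coord e x = w"
proof (cases "w = 1")
  case True then show ?thesis by (intro bexI[of _ None]) (auto simp: disc_coord_def Rdot_def)
next
  case False
  define \<xi> where "\<xi> = of_real e * \<i> * (w + 1) / (w - 1)"
  have "w \<noteq> 0" using assms by auto
  then have c: "cnj w = 1 / w" using assms(2)
    by (metis complex_norm_square mult.commute nonzero_eq_divide_eq of_real_1 power_one)
  have "cnj \<xi> = \<xi>" unfolding \<xi>_def using assms(1) False \<open>w \<noteq> 0\<close> by (auto simp: c field_simps)
  then have r: "\<xi> = of_real (Re \<xi>)" by (metis complex_cnj_cancel_iff complex_is_Real_iff Reals_cnj_iff of_real_Re)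
  have "disc_coord e (Some \<xi>) = w"
  proof -
    have "\<xi> + of_real e * \<i> = 2 * of_real e * \<i> * w / (w - 1)" "\<xi> - of_real e * \<i> = 2 * of_real e * \<i> / (w - 1)"
      unfolding \<xi>_def using False by (auto simp: divide_simps algebra_simps)
    then show ?thesis using assms(1) False by (auto simp: disc_coord_def)
  qed
  then show ?thesis using r by (intro bexI[of _ "Some \<xi>"]) (auto simp: Rdot_def)
qed

definition disc_functions :: "(complex \<Rightarrow> complex) set" where
  "disc_functions = {F. continuous_on (cball 0 1) F \<and> F holomorphic_on ball 0 1}"

lemma disc_functions_eqI:
  assumes F: "F \<in> disc_functions" and H: "H \<in> disc_functions"
    and eq: "\<And>w. norm w = 1 \<Longrightarrow> F w = H w" and z: "norm z \<le> 1"
  shows "F z = H z"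
proof -
  have "norm (F z - H z) \<le> 0"
  proof (rule maximum_modulus_frontier[where S="cball 0 1" and f="\<lambda>z. F z - H z"])
    show "(\<lambda>z. F z - H z) holomorphic_on interior (cball 0 1)"
      using F H by (auto simp: disc_functions_def intro!: holomorphic_intros)
    show "continuous_on (closure (cball 0 1)) (\<lambda>z. F z - H z)"
      using F H by (auto simp: disc_functions_def intro!: continuous_intros)
    show "\<And>z. z \<in> frontier (cball 0 1) \<Longrightarrow> cmod (F z - H z) \<le> 0" using eq by auto
  qed (use z in auto)
  then show ?thesis by simp
qed

text \<open>This turns out to be the algebra of Hoelder functions with a bounded analytic extension to
  the half-plane \<open>half e\<close>; the continuous extension to the closed disc is what makes values at
  interior points and divisions by zeros available.\<close>

definition disc_alg :: "real \<Rightarrow> real \<Rightarrow> (complex option \<Rightarrow> complex) set" where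
  "disc_alg \<mu> e = {f \<in> C_mu \<mu>. \<exists>F\<in>disc_functions. \<forall>x\<in>Rdot. f x = F (disc_coord e x)}"

lemma disc_algI:
  "f \<in> C_mu \<mu> \<Longrightarrow> F \<in> disc_functions \<Longrightarrow> (\<And>x. x \<in> Rdot \<Longrightarrow> f x = F (disc_coord e x)) \<Longrightarrow> f \<in> disc_alg \<mu> e"
  by (auto simp: disc_alg_def)

lemma disc_algE:
  assumes "f \<in> disc_alg \<mu> e"
  obtains F where "F \<in> disc_functions" "\<And>x. x \<in> Rdot \<Longrightarrow> f x = F (disc_coord e x)"
  using assms by (auto simp: disc_alg_def)

lemma disc_alg_C_mu: "f \<in> disc_alg \<mu> e \<Longrightarrow> f \<in> C_mu \<mu>"
  by (simp add: disc_alg_def)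

lemma disc_alg_cong: "f \<in> disc_alg \<mu> e \<Longrightarrow> (\<And>x. x \<in> Rdot \<Longrightarrow> g x = f x) \<Longrightarrow> g \<in> disc_alg \<mu> e"
  by (auto simp: disc_alg_def intro: C_mu_cong)

lemma disc_alg_const [simp]: "(\<lambda>x. c) \<in> disc_alg \<mu> e"
  by (rule disc_algI[where F="\<lambda>_. c"]) (auto simp: disc_functions_def)

lemma disc_alg_add:
  assumes "f \<in> disc_alg \<mu> e" "g \<in> disc_alg \<mu> e" shows "(\<lambda>x. f x + g x) \<in> disc_alg \<mu> e"
proof -
  obtain F where F: "F \<in> disc_functions" "\<And>x. x \<in> Rdot \<Longrightarrow> f x = F (disc_coord e x)" by (rule disc_algE[OF assms(1)]) (rule that; assumption)
  obtain H where H: "H \<in> disc_functions" "\<And>x. x \<in> Rdot \<Longrightarrow> g x = H (disc_coord e x)" by (rule disc_algE[OF assms(2)]) (rule that; assumption)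
  show ?thesis
    by (rule disc_algI[where F="\<lambda>z. F z + H z"])
      (use F H assms in \<open>auto simp: disc_functions_def intro!: continuous_intros holomorphic_intros C_mu_add[OF assms(1,2)[THEN disc_alg_C_mu]]\<close>)
qed

lemma disc_alg_mult:
  assumes "f \<in> disc_alg \<mu> e" "g \<in> disc_alg \<mu> e" "0 < \<mu>" shows "(\<lambda>x. f x * g x) \<in> disc_alg \<mu> e"
proof -
  obtain F where F: "F \<in> disc_functions" "\<And>x. x \<in> Rdot \<Longrightarrow> f x = F (disc_coord e x)" by (rule disc_algE[OF assms(1)]) (rule that; assumption)
  obtain H where H: "H \<in> disc_functions" "\<And>x. x \<in> Rdot \<Longrightarrow> g x = H (disc_coord e x)" by (rule disc_algE[OF assms(2)]) (rule that; assumption)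
  show ?thesis
    by (rule disc_algI[where F="\<lambda>z. F z * H z"])
      (use F H assms in \<open>auto simp: disc_functions_def intro!: continuous_intros holomorphic_intros C_mu_mult[OF assms(1,2)[THEN disc_alg_C_mu]]\<close>)
qed

lemma disc_alg_uminus:
  assumes "f \<in> disc_alg \<mu> e" shows "(\<lambda>x. - f x) \<in> disc_alg \<mu> e"
proof -
  obtain F where F: "F \<in> disc_functions" "\<And>x. x \<in> Rdot \<Longrightarrow> f x = F (disc_coord e x)" by (rule disc_algE[OF assms]) (rule that; assumption)
  show ?thesis
    by (rule disc_algI[where F="\<lambda>z. - F z"])
      (use F assms in \<open>auto simp: disc_functions_def intro!: continuous_intros holomorphic_intros C_mu_uminus[OF assms[THEN disc_alg_C_mu]]\<close>)
qed

lemma disc_alg_diff: "f \<in> disc_alg \<mu> e \<Longrightarrow> g \<in> disc_alg \<mu> e \<Longrightarrow> (\<lambda>x. f x - g x) \<in> disc_alg \<mu> e"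
  using disc_alg_add[OF _ disc_alg_uminus] by fastforce

lemma disc_coord_disc_alg: "e \<in> {1, -1} \<Longrightarrow> 0 < \<mu> \<Longrightarrow> \<mu> \<le> 1 \<Longrightarrow> disc_coord e \<in> disc_alg \<mu> e"
  by (rule disc_algI[where F="\<lambda>z. z"]) (auto intro: disc_coord_C_mu simp: disc_functions_def)

lemma disc_alg_entire:
  assumes "f \<in> disc_alg \<mu> e" "0 < \<mu>" "\<phi> holomorphic_on UNIV"
  shows "(\<lambda>x. \<phi> (f x)) \<in> disc_alg \<mu> e"
proof -
  obtain F where F: "F \<in> disc_functions" "\<And>x. x \<in> Rdot \<Longrightarrow> f x = F (disc_coord e x)" by (rule disc_algE[OF assms(1)]) (rule that; assumption)
  have c: "continuous_on UNIV \<phi>" using assms(3) by (rule holomorphic_on_imp_continuous_on)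
  show ?thesis
  proof (rule disc_algI[where F="\<lambda>z. \<phi> (F z)"])
    show "(\<lambda>z. \<phi> (F z)) \<in> disc_functions"
      using F(1) unfolding disc_functions_def
      by (auto intro: continuous_on_compose2[OF c] holomorphic_on_compose_gen[OF _ assms(3), unfolded o_def])
  qed (use F assms C_mu_entire disc_alg_C_mu in auto)
qed

lemma disc_alg_inverse:
  assumes e: "e \<in> {1, -1}" and f: "f \<in> C_mu \<mu>" and F: "F \<in> disc_functions" "\<And>x. x \<in> Rdot \<Longrightarrow> f x = F (disc_coord e x)"
    and nz: "\<And>z. norm z \<le> 1 \<Longrightarrow> F z \<noteq> 0"
  shows "(\<lambda>x. 1 / f x) \<in> disc_alg \<mu> e"
proof -
  have I: "(\<lambda>z. 1 / F z) \<in> disc_functions"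
    using F(1) nz by (auto simp: disc_functions_def intro!: continuous_intros holomorphic_intros)
  then have "bounded ((\<lambda>z. 1 / F z) ` cball 0 1)"
    by (intro compact_imp_bounded compact_continuous_image) (auto simp: disc_functions_def)
  then obtain B where "B > 0" and B': "\<forall>y\<in>(\<lambda>z. 1 / F z) ` cball 0 1. norm y \<le> B"
    unfolding bounded_pos by blast
  then have B: "B > 0" "\<And>z. norm z \<le> 1 \<Longrightarrow> norm (1 / F z) \<le> B" by auto
  have "norm (f x) \<ge> 1 / B" if x: "x \<in> Rdot" for x
  proof -
    have "norm (1 / f x) \<le> B" "f x \<noteq> 0" using B(2) F(2)[OF x] norm_disc_coord[OF e x] nz by auto
    then show ?thesis using B(1) by (auto simp: norm_divide field_simps)
  qed
  then have "(\<lambda>x. 1 / f x) \<in> C_mu \<mu>" using B(1) by (intro C_mu_inverse[OF f, where c="1/B"]) auto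
  then show ?thesis using I F(2) by (intro disc_algI) auto
qed

text \<open>The extensions of a function and of its inverse have a product that is \<open>1\<close> on the circle, hence in
  the whole disc.\<close>

lemma disc_alg_units_nonzero:
  assumes e: "e \<in> {1, -1}" and fg: "f \<in> units_on Rdot (disc_alg \<mu> e)"
    and F: "F \<in> disc_functions" "\<And>x. x \<in> Rdot \<Longrightarrow> f x = F (disc_coord e x)" and z: "norm z \<le> 1"
  shows "F z \<noteq> 0"
proof -
  obtain g where g: "g \<in> disc_alg \<mu> e" "\<And>x. x \<in> Rdot \<Longrightarrow> f x * g x = 1" using fg by (auto simp: units_on_def)
  obtain H where H: "H \<in> disc_functions" "\<And>x. x \<in> Rdot \<Longrightarrow> g x = H (disc_coord e x)" by (rule disc_algE[OF g(1)]) (rule that; assumption)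
  have "F z * H z = 1"
  proof (rule disc_functions_eqI[where F="\<lambda>z. F z * H z" and H="\<lambda>_. 1"])
    fix w :: complex assume "norm w = 1"
    then obtain x where "x \<in> Rdot" "disc_coord e x = w" using disc_coord_onto_circle[OF e] by blast
    then show "F w * H w = 1" using g F H by metis
  qed (use F H z in \<open>auto simp: disc_functions_def intro!: continuous_intros holomorphic_intros\<close>)
  then show ?thesis by auto
qed

lemma C_mu_unit_bounded_below:
  assumes "f \<in> units_on Rdot (C_mu \<mu>)" "0 < \<mu>"
  obtains c where "c > 0" "\<And>x. x \<in> Rdot \<Longrightarrow> norm (f x) \<ge> c"
proof -
  obtain g where g: "g \<in> C_mu \<mu>" "\<And>x. x \<in> Rdot \<Longrightarrow> f x * g x = 1" using assms by (auto simp: units_on_def)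
  obtain B where B: "B > 0" "\<And>x. x \<in> Rdot \<Longrightarrow> norm (g x) \<le> B" by (rule C_mu_bounded[OF g(1) assms(2)]) (rule that; assumption)
  show ?thesis
  proof (rule that[of "1/B"])
    fix x assume x: "x \<in> Rdot"
    have "1 = norm (f x) * norm (g x)" using g(2)[OF x] by (metis norm_mult norm_one)
    also have "\<dots> \<le> norm (f x) * B" using B(2)[OF x] by (intro mult_left_mono) auto
    finally show "1 / B \<le> norm (f x)" using B(1) by (simp add: field_simps)
  qed (use B in simp)
qed

text \<open>The quotient has a removable singularity; on the circle the denominator stays away from zero.\<close>

lemma disc_alg_divide_zero:
  assumes e: "e \<in> {1, -1}" and \<mu>: "0 < \<mu>" "\<mu> \<le> 1" and f: "f \<in> C_mu \<mu>"
    and F: "F \<in> disc_functions" "\<And>x. x \<in> Rdot \<Longrightarrow> f x = F (disc_coord e x)"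
    and a: "norm a < 1" "F a = 0"
  obtains H where "H \<in> disc_functions" "(\<lambda>x. f x / (disc_coord e x - a)) \<in> C_mu \<mu>"
    "\<And>x. x \<in> Rdot \<Longrightarrow> f x / (disc_coord e x - a) = H (disc_coord e x)"
    "\<And>z. norm z \<le> 1 \<Longrightarrow> F z = (z - a) * H z"
proof -
  define H where "H z = (if z = a then deriv F a else (F z - F a) / (z - a))" for z
  have FH: "F z = (z - a) * H z" if "norm z \<le> 1" for z using a by (auto simp: H_def)
  have hol: "H holomorphic_on ball 0 1"
    unfolding H_def using F(1) by (intro pole_lemma_open) (auto simp: disc_functions_def)
  have "continuous_on (cball 0 1) H"
  proof (rule continuous_on_eq_continuous_within[THEN iffD2], rule ballI)
    fix z :: complex assume z: "z \<in> cball 0 1"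
    show "continuous (at z within cball 0 1) H"
    proof (cases "norm z < 1")
      case True
      then have "isCont H z" using holomorphic_on_imp_continuous_on[OF hol]
        by (simp add: continuous_on_eq_continuous_at)
      then show ?thesis by (rule continuous_at_imp_continuous_at_within)
    next
      case False
      then have za: "z \<noteq> a" using a by auto
      have "continuous (at z within cball 0 1) (\<lambda>z. F z / (z - a))"
        using F(1) z za by (intro continuous_intros) (auto simp: disc_functions_def continuous_on_eq_continuous_within)
      then show ?thesis
        by (rule continuous_transform_within[where \<delta>="dist z a"]) (use za z a in \<open>auto simp: H_def dist_commute\<close>)
    qed
  qed
  then have HD: "H \<in> disc_functions" using hol by (simp add: disc_functions_def)
  have ne: "norm (disc_coord e x - a) \<ge> 1 - norm a" if "x \<in> Rdot" for x
    using norm_disc_coord[OF e that] norm_triangle_ineq2[of "disc_coord e x" a] by simp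
  have nz: "disc_coord e x - a \<noteq> 0" if "x \<in> Rdot" for x using ne[OF that] a by auto
  have "(\<lambda>x. f x * (1 / (disc_coord e x - a))) \<in> C_mu \<mu>"
    using ne a \<mu> e by (intro C_mu_mult C_mu_inverse[where c="1 - norm a"] f C_mu_diff disc_coord_C_mu) auto
  then have Cm: "(\<lambda>x. f x / (disc_coord e x - a)) \<in> C_mu \<mu>" by simp
  show ?thesis
    by (rule that[OF HD Cm _ FH]) (use F(2) nz FH norm_disc_coord[OF e] in auto)
qed

section \<open>Cauchy integrals of Hoelder functions\<close>

abbreviation circ :: "real \<Rightarrow> complex" where
  "circ \<equiv> circlepath 0 1"

lemma circ_eq: "circ x = exp (2 * of_real pi * \<i> * of_real x)"
  by (simp add: circlepath)

lemma norm_circ [simp]: "norm (circ x) = 1"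
  by (simp add: circ_eq)

lemma circ_nonzero [simp]: "circ x \<noteq> 0"
  by (simp add: circ_eq)

lemma circ_mult: "circ x * circ y = circ (x + y)" and circ_minus: "circ (- x) = 1 / circ x"
  and cnj_circ: "cnj (circ x) = circ (- x)"
  by (simp_all add: circ_eq distrib_left exp_add exp_minus divide_inverse exp_cnj)

lemma circ_reflect: "circ (1 - x) = circ (- x)"
  using circlepath_add1[of 0 1 "-x"] by (simp add: add.commute)

lemma continuous_on_circ [continuous_intros]: "continuous_on S circ"
  unfolding circ_eq by (intro continuous_intros)

lemma circ_onto: "norm w = 1 \<Longrightarrow> \<exists>a\<in>{0..1}. w = circ a"
  using path_image_circlepath[of 0 1] by (auto simp: path_image_def image_iff)

text \<open>With \<open>\<zeta> = circ x\<close> this is \<open>1/(2\<pi>\<i>)\<close> times the contour integral of \<open>h \<zeta> / (\<zeta> - z)\<close>.\<close>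

definition cauchy_int :: "(complex \<Rightarrow> complex) \<Rightarrow> complex \<Rightarrow> complex" where
  "cauchy_int h z = integral {0..1} (\<lambda>x. h (circ x) * circ x / (circ x - z))"

lemma circ_minus_nonzero: "norm z < 1 \<Longrightarrow> circ x - z \<noteq> 0"
  using norm_circ[of x] by (metis eq_iff_diff_eq_0 less_irrefl)

lemma continuous_on_circ_comp: "continuous_on (sphere 0 1) h \<Longrightarrow> continuous_on {0..1} (\<lambda>x. h (circ x))"
  by (rule continuous_on_compose2[where t="sphere 0 1"]) (auto intro: continuous_on_circ)

lemma cauchy_int_integrable:
  assumes "continuous_on (sphere 0 1) h" "norm z < 1"
  shows "(\<lambda>x. h (circ x) * circ x / (circ x - z)) integrable_on {0..1}"
  using continuous_on_circ_comp[OF assms(1)] circ_minus_nonzero[OF assms(2)]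
  by (intro integrable_continuous_interval continuous_intros) auto

lemma cauchy_int_diff:
  assumes "continuous_on (sphere 0 1) h" "continuous_on (sphere 0 1) g" "norm z < 1"
  shows "cauchy_int (\<lambda>\<zeta>. h \<zeta> - g \<zeta>) z = cauchy_int h z - cauchy_int g z"
  unfolding cauchy_int_def using cauchy_int_integrable[OF assms(1,3)] cauchy_int_integrable[OF assms(2,3)]
  by (subst integral_diff[symmetric]) (auto simp: diff_divide_distrib left_diff_distrib)

lemma cauchy_int_contour:
  assumes "continuous_on (sphere 0 1) h" "norm z < 1"
  shows "((\<lambda>\<zeta>. h \<zeta> / (\<zeta> - z)) has_contour_integral 2 * of_real pi * \<i> * cauchy_int h z) circ"
proof -
  have "((\<lambda>x. 2 * of_real pi * \<i> * (h (circ x) * circ x / (circ x - z))) has_integral 2 * of_real pi * \<i> * cauchy_int h z) {0..1}"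
    unfolding cauchy_int_def using cauchy_int_integrable[OF assms] by (intro has_integral_mult_right) blast
  then show ?thesis
    unfolding has_contour_integral
    by (rule has_integral_eq[rotated]) (simp add: vector_derivative_circlepath circ_eq)
qed

lemma cauchy_int_disc_function:
  assumes "F \<in> disc_functions" "norm z < 1"
  shows "cauchy_int F z = F z"
proof -
  have F: "continuous_on (cball 0 1) F" "F holomorphic_on ball 0 1" using assms by (auto simp: disc_functions_def)
  have "((\<lambda>u. F u / (u - z)) has_contour_integral 2 * of_real pi * \<i> * F z) circ"
    using Cauchy_integral_circlepath[OF F] assms(2) by simp
  moreover have "continuous_on (sphere 0 1) F" using F(1) by (rule continuous_on_subset) auto
  ultimately show ?thesis using has_contour_integral_unique[OF cauchy_int_contour[OF _ assms(2)]] by fastforce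
qed

lemma cauchy_int_const: "norm z < 1 \<Longrightarrow> cauchy_int (\<lambda>_. c) z = c"
  by (rule cauchy_int_disc_function) (auto simp: disc_functions_def)

lemma cauchy_int_deriv:
  assumes h: "continuous_on (sphere 0 1) h" and z: "norm z < 1"
  shows "(cauchy_int h has_field_derivative integral {0..1} (\<lambda>x. h (circ x) * circ x / (circ x - z)^2)) (at z)"
proof -
  have "((\<lambda>z. 2 * of_real pi * \<i> * cauchy_int h z) has_field_derivative
      (of_nat 1 * contour_integral circ (\<lambda>u. h u / (u - z)^(Suc 1)))) (at z)"
    by (rule Cauchy_next_derivative_circlepath(2)) (use h z cauchy_int_contour[OF h] in auto)
  then have "((\<lambda>z. (2 * of_real pi * \<i> * cauchy_int h z) / (2 * of_real pi * \<i>)) has_field_derivative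
      contour_integral circ (\<lambda>u. h u / (u - z)^2) / (2 * of_real pi * \<i>)) (at z)"
    by (intro DERIV_cdivide) (simp add: numeral_2_eq_2)
  moreover have "contour_integral circ (\<lambda>u. h u / (u - z)^2) / (2 * of_real pi * \<i>)
      = integral {0..1} (\<lambda>x. h (circ x) * circ x / (circ x - z)^2)"
    unfolding contour_integral_integral
    by (subst integral_divide[symmetric], rule integral_cong) (simp add: vector_derivative_circlepath circ_eq)
  ultimately show ?thesis by simp
qed

lemma cauchy_int_holomorphic: "continuous_on (sphere 0 1) h \<Longrightarrow> cauchy_int h holomorphic_on ball 0 1"
  by (auto simp: holomorphic_on_open intro!: exI cauchy_int_deriv)

text \<open>Subtracting a constant from \<open>h\<close> does not change the derivative; the constant \<open>h \<omega>\<close> makes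
  the integrand small near the boundary point \<open>\<omega>\<close>.\<close>

lemma cauchy_int_deriv_shift:
  assumes h: "continuous_on (sphere 0 1) h" and z: "norm z < 1"
  shows "deriv (cauchy_int h) z = integral {0..1} (\<lambda>x. (h (circ x) - c) * circ x / (circ x - z)^2)"
proof -
  have h': "continuous_on (sphere 0 1) (\<lambda>\<zeta>. h \<zeta> - c)" using h by (intro continuous_intros)
  have "(cauchy_int (\<lambda>\<zeta>. h \<zeta> - c) has_field_derivative deriv (cauchy_int h) z) (at z)"
  proof (rule has_field_derivative_transform_within_open[where S="ball 0 1" and f="\<lambda>z. cauchy_int h z - c"])
    have "(cauchy_int h has_field_derivative deriv (cauchy_int h) z) (at z)"
      using cauchy_int_deriv[OF h z] DERIV_imp_deriv by metis
    then show "((\<lambda>z. cauchy_int h z - c) has_field_derivative deriv (cauchy_int h) z) (at z)"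
      by (auto intro!: derivative_eq_intros)
  qed (use z cauchy_int_diff[OF h, of "\<lambda>_. c"] cauchy_int_const in auto)
  then show ?thesis using cauchy_int_deriv[OF h' z] DERIV_unique by blast
qed

text \<open>A form of Jordan's inequality: up to a factor, \<open>circ y\<close> is as far from \<open>1\<close> as \<open>y\<close> is from the
  integers.\<close>

lemma norm_circ_minus_1_ge:
  assumes "\<bar>y\<bar> \<le> 1" shows "norm (circ y - 1) \<ge> 2 * min \<bar>y\<bar> (1 - \<bar>y\<bar>)"
proof -
  have s: "t / 2 \<le> sin t" if t: "0 \<le> t" "t \<le> pi / 2" for t :: real
  proof -
    define s where "s = t / 2"
    have s: "0 \<le> s" "s \<le> pi / 4" using t by (auto simp: s_def)
    have "sin 0 - 0 * cos 0 \<le> sin s - s * cos s"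
    proof (rule DERIV_nonneg_imp_nondecreasing[OF s(1)])
      fix x assume x: "0 \<le> x" "x \<le> s"
      have "0 \<le> x * sin x" using x s by (intro mult_nonneg_nonneg sin_ge_zero) auto
      moreover have "((\<lambda>x. sin x - x * cos x) has_real_derivative x * sin x) (at x)"
        by (auto intro!: derivative_eq_intros)
      ultimately show "\<exists>y. ((\<lambda>x. sin x - x * cos x) has_real_derivative y) (at x) \<and> 0 \<le> y" by blast
    qed
    then have "s * cos s \<le> sin s" by simp
    moreover have "sqrt 2 / 2 \<le> cos s" using cos_monotone_0_pi_le[of s "pi/4"] s by (simp add: cos_45)
    moreover have "0 \<le> cos s" using calculation(2) by (smt (verit) real_sqrt_ge_zero divide_nonneg_pos)
    ultimately have "s * cos s * cos s \<le> sin s * cos s" and "sqrt 2 / 2 * (sqrt 2 / 2) \<le> cos s * cos s"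
      by (intro mult_right_mono mult_mono; simp)+
    then have "s * (1/2) \<le> sin s * cos s" using mult_left_mono[of "1/2" "cos s * cos s" s] s(1) by (simp add: mult.assoc)
    moreover have "sin t = 2 * sin s * cos s" using sin_double[of s] by (simp add: s_def)
    ultimately show ?thesis by (simp add: s_def)
  qed
  have *: "m \<le> sin (pi * m)" if "0 \<le> m" "m \<le> 1/2" for m :: real
  proof -
    have "pi * m / 2 \<le> sin (pi * m)" using that by (intro s) (auto simp: field_simps)
    moreover have "2 * m \<le> pi * m" using that pi_gt3 by (intro mult_right_mono) auto
    ultimately show ?thesis by simp
  qed
  have a: "sin (pi * \<bar>y\<bar>) \<ge> min \<bar>y\<bar> (1 - \<bar>y\<bar>)"
  proof (cases "\<bar>y\<bar> \<le> 1/2")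
    case True then show ?thesis using *[of "\<bar>y\<bar>"] by auto
  next
    case False
    moreover have "sin (pi * \<bar>y\<bar>) = sin (pi * (1 - \<bar>y\<bar>))" by (simp add: right_diff_distrib)
    ultimately show ?thesis using *[of "1 - \<bar>y\<bar>"] assms by auto
  qed
  have "norm (circ y - 1) = 2 * \<bar>sin (pi * y)\<bar>"
    using dist_exp_i_1[of "2 * pi * y"] by (simp add: circ_eq mult.commute mult.left_commute mult.assoc)
  also have "\<bar>sin (pi * y)\<bar> = \<bar>sin (pi * \<bar>y\<bar>)\<bar>" by (simp add: abs_if)
  finally have "norm (circ y - 1) = 2 * \<bar>sin (pi * \<bar>y\<bar>)\<bar>" .
  moreover have "min \<bar>y\<bar> (1 - \<bar>y\<bar>) \<le> \<bar>sin (pi * \<bar>y\<bar>)\<bar>" using a by (rule order_trans) simp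
  ultimately show ?thesis by simp
qed

lemma norm_circ_minus_ge:
  fixes r x a :: real
  assumes r: "0 \<le> r" "r < 1" and xa: "\<bar>x - a\<bar> \<le> 1"
  shows "norm (circ x - circ a) \<le> 2 * norm (circ x - r * circ a)"
    and "(1 - r) + min \<bar>x - a\<bar> (1 - \<bar>x - a\<bar>) \<le> 2 * norm (circ x - r * circ a)"
proof -
  have 1: "norm (circ x - r * circ a) \<ge> 1 - r"
    using norm_triangle_ineq2[of "circ x" "r * circ a"] r by (simp add: norm_mult)
  have "norm (circ x - circ a) \<le> norm (circ x - r * circ a) + norm (of_real (r - 1) * circ a)"
    using norm_triangle_ineq[of "circ x - r * circ a" "of_real (r - 1) * circ a"] by (simp add: algebra_simps)
  also have "norm (of_real (r - 1) * circ a) = 1 - r" using r by (simp add: norm_mult del: of_real_diff)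
  finally show 2: "norm (circ x - circ a) \<le> 2 * norm (circ x - r * circ a)" using 1 by simp
  have "circ x - circ a = circ a * (circ (x - a) - 1)" by (simp add: algebra_simps circ_mult)
  then have "norm (circ x - circ a) = norm (circ (x - a) - 1)" by (simp add: norm_mult)
  then have "min \<bar>x - a\<bar> (1 - \<bar>x - a\<bar>) \<le> norm (circ x - r * circ a)"
    using order_trans[OF norm_circ_minus_1_ge[OF xa], of "2 * norm (circ x - r * circ a)"] 2 by simp
  with 1 show "(1 - r) + min \<bar>x - a\<bar> (1 - \<bar>x - a\<bar>) \<le> 2 * norm (circ x - r * circ a)" by linarith
qed

text \<open>The kernel dominates \<open>\<bar>circ x - r circ a\<bar> powr (\<mu> - 2)\<close> with \<open>h = 1 - r\<close>, up to a factor. Its two terms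
  measure the distance from \<open>x\<close> to \<open>a\<close> along the two arcs of the circle.\<close>

lemma kernel_integral:
  fixes a h \<mu> :: real
  assumes a: "0 \<le> a" "a \<le> 1" and h: "0 < h" and \<mu>: "0 < \<mu>" "\<mu> < 1"
  obtains I where "((\<lambda>x. (h + \<bar>x - a\<bar>) powr (\<mu> - 2) + (h + (1 - \<bar>x - a\<bar>)) powr (\<mu> - 2)) has_integral I) {0..1}"
    "I \<le> 4 * h powr (\<mu> - 1) / (1 - \<mu>)"
proof -
  have up: "((\<lambda>x. (c + x) powr (\<mu> - 2)) has_integral ((c + p) powr (\<mu> - 1) - (c + q) powr (\<mu> - 1)) / (1 - \<mu>)) {p..q}"
    if "p \<le> q" "c + p > 0" for c p q :: real
  proof -
    have "((\<lambda>x. (c + x) powr (\<mu> - 2)) has_integral (- ((c + q) powr (\<mu> - 1)) / (1 - \<mu>) - (- ((c + p) powr (\<mu> - 1)) / (1 - \<mu>)))) {p..q}"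
    proof (rule fundamental_theorem_of_calculus[OF that(1)])
      fix x assume "x \<in> {p..q}"
      then have "c + x > 0" using that by auto
      then have "((\<lambda>x. (c + x) powr (\<mu> - 1)) has_real_derivative (\<mu> - 1) * (c + x) powr (\<mu> - 2)) (at x)"
        by (auto intro!: derivative_eq_intros)
      then have "((\<lambda>x. (-1 / (1 - \<mu>)) * (c + x) powr (\<mu> - 1)) has_real_derivative (-1 / (1 - \<mu>)) * ((\<mu> - 1) * (c + x) powr (\<mu> - 2))) (at x)"
        by (rule DERIV_cmult)
      moreover have "(-1 / (1 - \<mu>)) * ((\<mu> - 1) * (c + x) powr (\<mu> - 2)) = (c + x) powr (\<mu> - 2)"
        using \<mu> by (simp add: divide_simps) (simp add: algebra_simps)
      ultimately have "((\<lambda>x. - ((c + x) powr (\<mu> - 1)) / (1 - \<mu>)) has_real_derivative (c + x) powr (\<mu> - 2)) (at x)"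
        by simp
      then show "((\<lambda>x. - ((c + x) powr (\<mu> - 1)) / (1 - \<mu>)) has_vector_derivative (c + x) powr (\<mu> - 2)) (at x within {p..q})"
        by (simp add: has_real_derivative_iff_has_vector_derivative has_vector_derivative_at_within)
    qed
    then show ?thesis by (simp add: diff_divide_distrib)
  qed
  have down: "((\<lambda>x. (c - x) powr (\<mu> - 2)) has_integral ((c - q) powr (\<mu> - 1) - (c - p) powr (\<mu> - 1)) / (1 - \<mu>)) {p..q}"
    if "p \<le> q" "c - q > 0" for c p q :: real
  proof -
    have "((\<lambda>x. (c - x) powr (\<mu> - 2)) has_integral ((c - q) powr (\<mu> - 1) / (1 - \<mu>) - ((c - p) powr (\<mu> - 1) / (1 - \<mu>)))) {p..q}"
    proof (rule fundamental_theorem_of_calculus[OF that(1)])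
      fix x assume "x \<in> {p..q}"
      then have "c - x > 0" using that by auto
      then have "((\<lambda>x. (c - x) powr (\<mu> - 1)) has_real_derivative (1 - \<mu>) * (c - x) powr (\<mu> - 2)) (at x)"
        by (auto intro!: derivative_eq_intros simp: algebra_simps)
      then have "((\<lambda>x. (1 / (1 - \<mu>)) * (c - x) powr (\<mu> - 1)) has_real_derivative (1 / (1 - \<mu>)) * ((1 - \<mu>) * (c - x) powr (\<mu> - 2))) (at x)"
        by (rule DERIV_cmult)
      then have "((\<lambda>x. (c - x) powr (\<mu> - 1) / (1 - \<mu>)) has_real_derivative (c - x) powr (\<mu> - 2)) (at x)"
        using \<mu> by simp
      then show "((\<lambda>x. (c - x) powr (\<mu> - 1) / (1 - \<mu>)) has_vector_derivative (c - x) powr (\<mu> - 2)) (at x within {p..q})"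
        by (simp add: has_real_derivative_iff_has_vector_derivative has_vector_derivative_at_within)
    qed
    then show ?thesis by (simp add: diff_divide_distrib)
  qed
  let ?k = "\<lambda>x. (h + \<bar>x - a\<bar>) powr (\<mu> - 2) + (h + (1 - \<bar>x - a\<bar>)) powr (\<mu> - 2)"
  let ?N = "h powr (\<mu> - 1)"
  have "((\<lambda>x. (h + a - x) powr (\<mu> - 2) + (h + 1 - a + x) powr (\<mu> - 2)) has_integral
      (?N - (h + a) powr (\<mu> - 1)) / (1 - \<mu>) + ((h + 1 - a) powr (\<mu> - 1) - (h + 1) powr (\<mu> - 1)) / (1 - \<mu>)) {0..a}"
    using down[of 0 a "h + a"] up[of 0 a "h + 1 - a"] a h by (intro has_integral_add) auto
  then have i1: "(?k has_integral (?N - (h + a) powr (\<mu> - 1)) / (1 - \<mu>) + ((h + 1 - a) powr (\<mu> - 1) - (h + 1) powr (\<mu> - 1)) / (1 - \<mu>)) {0..a}"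
    by (rule has_integral_eq[rotated]) (auto simp: algebra_simps)
  have "((\<lambda>x. (h - a + x) powr (\<mu> - 2) + (h + 1 + a - x) powr (\<mu> - 2)) has_integral
      (?N - (h - a + 1) powr (\<mu> - 1)) / (1 - \<mu>) + ((h + a) powr (\<mu> - 1) - (h + 1) powr (\<mu> - 1)) / (1 - \<mu>)) {a..1}"
    using up[of a 1 "h - a"] down[of a 1 "h + 1 + a"] a h by (intro has_integral_add) auto
  then have i2: "(?k has_integral (?N - (h - a + 1) powr (\<mu> - 1)) / (1 - \<mu>) + ((h + a) powr (\<mu> - 1) - (h + 1) powr (\<mu> - 1)) / (1 - \<mu>)) {a..1}"
    by (rule has_integral_eq[rotated]) (auto simp: algebra_simps)
  have m: "(h + 1 - a) powr (\<mu> - 1) \<le> ?N" "(h + a) powr (\<mu> - 1) \<le> ?N"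
    using a h \<mu> by (auto intro!: powr_mono2')
  have "((?N - (h + a) powr (\<mu> - 1)) / (1 - \<mu>) + ((h + 1 - a) powr (\<mu> - 1) - (h + 1) powr (\<mu> - 1)) / (1 - \<mu>)) +
      ((?N - (h - a + 1) powr (\<mu> - 1)) / (1 - \<mu>) + ((h + a) powr (\<mu> - 1) - (h + 1) powr (\<mu> - 1)) / (1 - \<mu>))
      = (2 * ?N - 2 * (h + 1) powr (\<mu> - 1) + ((h + 1 - a) powr (\<mu> - 1) - (h - a + 1) powr (\<mu> - 1))) / (1 - \<mu>)"
    unfolding add_divide_distrib[symmetric] by (rule arg_cong[where f="\<lambda>t. t / (1 - \<mu>)"]) simp
  also have "\<dots> \<le> 4 * ?N / (1 - \<mu>)"
    using m \<mu> powr_ge_zero[of "h + 1" "\<mu> - 1"] powr_ge_zero[of h "\<mu> - 1"] by (intro divide_right_mono) (auto simp: algebra_simps)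
  finally show ?thesis using that[OF has_integral_combine[OF a i1 i2]] by blast
qed

definition hoelder_circle :: "real \<Rightarrow> real \<Rightarrow> (complex \<Rightarrow> complex) \<Rightarrow> bool" where
  "hoelder_circle \<mu> M h \<longleftrightarrow> M \<ge> 0 \<and> (\<forall>z w. norm z = 1 \<longrightarrow> norm w = 1 \<longrightarrow> norm (h z - h w) \<le> M * norm (z - w) powr \<mu>)"

lemma hoelder_circle_continuous:
  assumes "hoelder_circle \<mu> M h" "0 < \<mu>" shows "continuous_on (sphere 0 1) h"
proof (rule continuous_on_eq_continuous_within[THEN iffD2], rule ballI)
  fix w :: complex assume w: "w \<in> sphere 0 1"
  have "((\<lambda>z. M * norm (z - w) powr \<mu>) \<longlongrightarrow> M * norm (w - w) powr \<mu>) (at w within sphere 0 1)"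
    using assms(2) by (intro tendsto_intros tendsto_powr') auto
  then have "((\<lambda>z. M * norm (z - w) powr \<mu>) \<longlongrightarrow> 0) (at w within sphere 0 1)" using assms(2) by simp
  then have "((\<lambda>z. h z - h w) \<longlongrightarrow> 0) (at w within sphere 0 1)"
    by (rule Lim_null_comparison[rotated])
      (use assms(1) w in \<open>auto simp: hoelder_circle_def eventually_at_filter intro!: always_eventually\<close>)
  then show "continuous (at w within sphere 0 1) h" by (simp add: continuous_within LIM_zero_iff)
qed

text \<open>At \<open>z = r \<omega>\<close> the integrand with \<open>h \<omega>\<close> subtracted is of order \<open>\<bar>\<zeta> - z\<bar> powr (\<mu> - 2)\<close>, since
  \<open>\<bar>\<zeta> - \<omega>\<bar> \<le> 2 \<bar>\<zeta> - z\<bar>\<close>.\<close>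

lemma cauchy_int_deriv_bound:
  assumes h: "hoelder_circle \<mu> M h" and \<mu>: "0 < \<mu>" "\<mu> < 1" and z: "norm z < 1"
  shows "norm (deriv (cauchy_int h) z) \<le> 64 * M / (1 - \<mu>) * (1 - norm z) powr (\<mu> - 1)"
proof -
  define r where "r = norm z"
  have r: "0 \<le> r" "r < 1" using z by (auto simp: r_def)
  have "\<exists>a\<in>{0..1}. z = r * circ a"
  proof (cases "z = 0")
    case True then show ?thesis by (auto simp: r_def)
  next
    case False
    then have "norm (z / r) = 1" by (simp add: r_def norm_divide)
    then obtain a where "a \<in> {0..1}" "z / r = circ a" using circ_onto by blast
    then show ?thesis using False by (intro bexI[of _ a]) (auto simp: r_def field_simps)
  qed
  then obtain a where a: "0 \<le> a" "a \<le> 1" and za: "z = r * circ a" by auto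
  have c: "continuous_on (sphere 0 1) h" by (rule hoelder_circle_continuous[OF h \<mu>(1)])
  have M: "M \<ge> 0" using h by (simp add: hoelder_circle_def)
  obtain I where I: "((\<lambda>x. ((1 - r) + \<bar>x - a\<bar>) powr (\<mu> - 2) + ((1 - r) + (1 - \<bar>x - a\<bar>)) powr (\<mu> - 2)) has_integral I) {0..1}"
    "I \<le> 4 * (1 - r) powr (\<mu> - 1) / (1 - \<mu>)"
    by (rule kernel_integral[OF a _ \<mu>, of "1 - r"]) (use r in auto)
  let ?k = "\<lambda>x. 16 * M * (((1 - r) + \<bar>x - a\<bar>) powr (\<mu> - 2) + ((1 - r) + (1 - \<bar>x - a\<bar>)) powr (\<mu> - 2))"
  have k: "(?k has_integral 16 * M * I) {0..1}" using I(1) by (rule has_integral_mult_right)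
  have "norm (integral {0..1} (\<lambda>x. (h (circ x) - h (circ a)) * circ x / (circ x - z)^2)) \<le> integral {0..1} ?k"
  proof (rule integral_norm_bound_integral)
    show "(\<lambda>x. (h (circ x) - h (circ a)) * circ x / (circ x - z)\<^sup>2) integrable_on {0..1}"
      using continuous_on_circ_comp[OF c] circ_minus_nonzero[OF z]
      by (intro integrable_continuous_interval continuous_intros) auto
    show "?k integrable_on {0..1}" using k by blast
    fix x :: real assume x: "x \<in> {0..1}"
    define d where "d = norm (circ x - z)"
    have xa: "\<bar>x - a\<bar> \<le> 1" using x a by auto
    have d: "norm (circ x - circ a) \<le> 2 * d" "(1 - r) + min \<bar>x - a\<bar> (1 - \<bar>x - a\<bar>) \<le> 2 * d"
      using norm_circ_minus_ge[OF r xa] by (auto simp: d_def za)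
    define m where "m = (1 - r) + min \<bar>x - a\<bar> (1 - \<bar>x - a\<bar>)"
    have m: "m > 0" "m / 2 \<le> d" using d(2) r xa by (auto simp: m_def)
    have dp: "d > 0" using m by linarith
    have "norm (h (circ x) - h (circ a)) \<le> M * norm (circ x - circ a) powr \<mu>"
      using h by (simp add: hoelder_circle_def)
    also have "\<dots> \<le> M * (2 * d) powr \<mu>" using d(1) \<mu> M by (intro mult_left_mono powr_mono2) auto
    also have "(2 * d) powr \<mu> = 2 powr \<mu> * d powr \<mu>" using dp by (simp add: powr_mult)
    finally have "norm (h (circ x) - h (circ a)) \<le> M * (2 powr \<mu> * d powr \<mu>)" .
    then have "norm ((h (circ x) - h (circ a)) * circ x / (circ x - z)\<^sup>2) \<le> M * (2 powr \<mu> * d powr \<mu>) / d^2"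
      by (simp add: norm_divide norm_mult norm_power d_def divide_right_mono)
    also have "d^2 = d powr 2" using dp by simp
    also have "M * (2 powr \<mu> * d powr \<mu>) / d powr 2 = M * (2 powr \<mu> * d powr (\<mu> - 2))"
      using dp by (simp add: powr_diff)
    also have "\<dots> \<le> M * (2 powr 1 * (m / 2) powr (\<mu> - 2))"
      using \<mu> m M by (intro mult_left_mono mult_mono powr_mono powr_mono2') auto
    also have "(m / 2) powr (\<mu> - 2) = m powr (\<mu> - 2) * 2 powr (2 - \<mu>)"
      using m by (simp add: powr_divide powr_diff)
    also have "M * (2 powr 1 * (m powr (\<mu> - 2) * 2 powr (2 - \<mu>))) \<le> M * (2 powr 1 * (m powr (\<mu> - 2) * 2 powr 2))"
      using \<mu> M by (intro mult_left_mono powr_mono) auto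
    also have "\<dots> = 8 * M * m powr (\<mu> - 2)" by simp
    also have "\<dots> \<le> 16 * M * m powr (\<mu> - 2)" using M by (intro mult_right_mono) auto
    also have "\<dots> \<le> ?k x"
      using M unfolding m_def by (intro mult_left_mono) (auto simp: min_def)
    finally show "norm ((h (circ x) - h (circ a)) * circ x / (circ x - z)\<^sup>2) \<le> ?k x" .
  qed
  also have "integral {0..1} ?k = 16 * M * I" using k by (rule integral_unique)
  also have "\<dots> \<le> 16 * M * (4 * (1 - r) powr (\<mu> - 1) / (1 - \<mu>))" using I(2) M by (intro mult_left_mono) auto
  also have "\<dots> = 64 * M / (1 - \<mu>) * (1 - norm z) powr (\<mu> - 1)" by (simp add: r_def)
  finally show ?thesis unfolding cauchy_int_deriv_shift[OF c z, of "h (circ a)"] .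
qed

text \<open>The derivative bound is integrated along the path that goes radially inwards to depth
  \<open>norm (z - w)\<close>, across, and outwards again.\<close>

lemma Hardy_Littlewood_disc:
  assumes F: "F holomorphic_on ball 0 1" and \<mu>: "0 < \<mu>" and C: "C \<ge> 0"
    and bd: "\<And>z. norm z < 1 \<Longrightarrow> norm (deriv F z) \<le> C * (1 - norm z) powr (\<mu> - 1)"
    and mu1: "\<mu> < 1" and z: "norm z < 1" and w: "norm w < 1"
  shows "norm (F z - F w) \<le> (2 * C / \<mu> + C) * norm (z - w) powr \<mu>"
proof (cases "z = w")
  case True then show ?thesis by simp
next
  case False
  define h where "h = norm (z - w)"
  define l where "l = max 0 (1 - h)"
  have h: "h > 0" using False by (simp add: h_def)
  have l: "0 \<le> l" "l < 1" "1 - l \<le> h" using h by (auto simp: l_def)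
  have rad: "norm (F z - F (l * z)) \<le> C / \<mu> * h powr \<mu>" if z: "norm z < 1" for z :: complex
  proof -
    have in1: "norm (of_real s * z) < 1" if "0 \<le> s" "s \<le> 1" for s :: real
      using that z mult_left_le_one_le[of "norm z" s] by (simp add: norm_mult)
    have "norm ((\<lambda>s. F (of_real s * z)) 1 - (\<lambda>s. F (of_real s * z)) l) \<le> - (C / \<mu>) * (1 - 1) powr \<mu> - (- (C / \<mu>) * (1 - l) powr \<mu>)"
    proof (rule differentiable_bound_general[where f="\<lambda>s. F (of_real s * z)" and \<phi>="\<lambda>s. - (C / \<mu>) * (1 - s) powr \<mu>"
          and f'="\<lambda>s. z * deriv F (of_real s * z)" and \<phi>'="\<lambda>s. C * (1 - s) powr (\<mu> - 1)", OF l(2)])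
      show "continuous_on {l..1} (\<lambda>s. F (of_real s * z))"
        by (rule continuous_on_compose2[OF holomorphic_on_imp_continuous_on[OF F]])
          (use in1 l in \<open>auto intro!: continuous_intros simp: \<close>)
      show "continuous_on {l..1} (\<lambda>s. - (C / \<mu>) * (1 - s) powr \<mu>)"
        using \<mu> by (intro continuous_intros continuous_on_powr') auto
      fix s assume s: "l < s" "s < 1"
      have "(F has_field_derivative deriv F (of_real s * z)) (at (of_real s * z))"
        using holomorphic_derivI[OF F open_ball] in1[of s] s l by simp
      then have "((\<lambda>s. F (of_real s * z)) has_vector_derivative (z * deriv F (of_real s * z))) (at s)"
        by (intro field_vector_diff_chain_at[unfolded o_def, where f="\<lambda>s. of_real s * z"])
          (auto intro!: derivative_eq_intros)
      then show "((\<lambda>s. F (of_real s * z)) has_vector_derivative z * deriv F (of_real s * z)) (at s)" .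
      have "((\<lambda>s. - (C / \<mu>) * (1 - s) powr \<mu>) has_real_derivative C * (1 - s) powr (\<mu> - 1)) (at s)"
        using s \<mu> by (auto intro!: derivative_eq_intros simp: field_simps)
      then show "((\<lambda>s. - (C / \<mu>) * (1 - s) powr \<mu>) has_vector_derivative C * (1 - s) powr (\<mu> - 1)) (at s)"
        by (simp add: has_real_derivative_iff_has_vector_derivative)
      have "norm (z * deriv F (of_real s * z)) \<le> 1 * (C * (1 - norm (of_real s * z)) powr (\<mu> - 1))"
        unfolding norm_mult[of z] using z bd[OF in1] s l by (intro mult_mono) auto
      also have "\<dots> \<le> 1 * (C * (1 - s) powr (\<mu> - 1))"
        using s l z C mu1 mult_left_le[of "norm z" s] by (intro mult_left_mono powr_mono2') (auto simp: norm_mult)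
      finally show "norm (z * deriv F (of_real s * z)) \<le> C * (1 - s) powr (\<mu> - 1)" by simp
    qed
    also have "\<dots> = C / \<mu> * (1 - l) powr \<mu>" using \<mu> by simp
    also have "\<dots> \<le> C / \<mu> * h powr \<mu>" using l \<mu> C by (intro mult_left_mono powr_mono2) auto
    finally show ?thesis by simp
  qed
  have across: "norm (F (l * z) - F (l * w)) \<le> C * h powr \<mu>"
  proof -
    have "norm (F (l * z) - F (l * w)) \<le> (C * (1 - l) powr (\<mu> - 1)) * norm (l * z - l * w)"
    proof (rule field_differentiable_bound[where S="cball 0 l" and f'="deriv F"])
      fix u :: complex assume u: "u \<in> cball 0 l"
      then show "(F has_field_derivative deriv F u) (at u within cball 0 l)"
        using holomorphic_derivI[OF F open_ball] l by simp
      have "norm (deriv F u) \<le> C * (1 - norm u) powr (\<mu> - 1)" using u l by (intro bd) auto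
      also have "\<dots> \<le> C * (1 - l) powr (\<mu> - 1)"
        using u l C mu1 by (intro mult_left_mono powr_mono2') auto
      finally show "norm (deriv F u) \<le> C * (1 - l) powr (\<mu> - 1)" .
    qed (use z w l in \<open>auto simp: norm_mult mult_left_le\<close>)
    also have "l * z - l * w = l * (z - w)" by (simp add: algebra_simps)
    also have "norm (l * (z - w)) = l * h" using l by (simp add: norm_mult h_def)
    also have "C * (1 - l) powr (\<mu> - 1) * (l * h) \<le> C * h powr \<mu>"
    proof (cases "l = 0")
      case True then show ?thesis using C by simp
    next
      case False
      then have lh: "1 - l = h" by (auto simp: l_def)
      have "C * (1 - l) powr (\<mu> - 1) * (l * h) = C * (h powr (\<mu> - 1) * h) * l" unfolding lh by (simp add: ac_simps)
      also have "h powr (\<mu> - 1) * h = h powr \<mu>" using h by (simp add: powr_diff)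
      also have "C * h powr \<mu> * l \<le> C * h powr \<mu>" using l C by (intro mult_left_le) auto
      finally show ?thesis .
    qed
    finally show ?thesis .
  qed
  have "norm (F z - F w) \<le> norm (F z - F (l * z)) + norm (F (l * z) - F (l * w)) + norm (F w - F (l * w))"
    using norm_triangle_ineq[of "F z - F (l * z)" "F (l * z) - F w"]
      norm_triangle_ineq[of "F (l * z) - F (l * w)" "F (l * w) - F w"] by (simp add: norm_minus_commute)
  also have "\<dots> \<le> C / \<mu> * h powr \<mu> + C * h powr \<mu> + C / \<mu> * h powr \<mu>"
    using rad[OF z] rad[OF w] across by linarith
  finally show ?thesis by (simp add: h_def algebra_simps)
qed

text \<open>The Cauchy integral satisfies a Hoelder condition in the open disc by the bound on its derivative,
  so it extends uniformly continuously to the boundary.\<close>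

lemma privalov:
  assumes h: "hoelder_circle \<mu> M h" and \<mu>: "0 < \<mu>" "\<mu> < 1"
  obtains H N where "H \<in> disc_functions" "hoelder_circle \<mu> N H" "\<And>z. norm z < 1 \<Longrightarrow> H z = cauchy_int h z"
proof -
  have c: "continuous_on (sphere 0 1) h" by (rule hoelder_circle_continuous[OF h \<mu>(1)])
  have M: "M \<ge> 0" using h by (simp add: hoelder_circle_def)
  define C where "C = 64 * M / (1 - \<mu>)"
  define N where "N = 2 * C / \<mu> + C"
  have C: "C \<ge> 0" "N \<ge> 0" using M \<mu> by (auto simp: C_def N_def)
  have hol: "cauchy_int h holomorphic_on ball 0 1" by (rule cauchy_int_holomorphic[OF c])
  have H: "norm (cauchy_int h z - cauchy_int h w) \<le> N * norm (z - w) powr \<mu>" if "norm z < 1" "norm w < 1" for z w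
    unfolding N_def using cauchy_int_deriv_bound[OF h \<mu>] that
    by (intro Hardy_Littlewood_disc[OF hol \<mu>(1) C(1) _ \<mu>(2)]) (auto simp: C_def)
  have "uniformly_continuous_on (ball 0 1) (cauchy_int h)"
    unfolding uniformly_continuous_on_def
  proof (intro allI impI)
    fix e :: real assume e: "e > 0"
    define d where "d = (e / (N + 1)) powr (1 / \<mu>)"
    have d: "d > 0" using e C by (simp add: d_def)
    have "dist (cauchy_int h w) (cauchy_int h z) < e" if z: "norm z < 1" "norm w < 1" "dist w z < d" for z w
    proof -
      have "norm (w - z) powr \<mu> \<le> d powr \<mu>" using z \<mu> by (intro powr_mono2) (auto simp: dist_norm)
      also have "d powr \<mu> = e / (N + 1)" using \<mu> e C by (simp add: d_def powr_powr)
      finally have "N * norm (w - z) powr \<mu> \<le> N * (e / (N + 1))" using C by (intro mult_left_mono) auto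
      also have "\<dots> < e" using e C by (simp add: field_simps)
      finally show ?thesis using H[OF z(2,1)] by (simp add: dist_norm)
    qed
    then show "\<exists>d>0. \<forall>x\<in>ball 0 1. \<forall>x'\<in>ball 0 1. dist x' x < d \<longrightarrow> dist (cauchy_int h x') (cauchy_int h x) < e"
      using d by (intro exI[of _ d]) auto
  qed
  then obtain H where uc: "uniformly_continuous_on (closure (ball 0 1)) H" and eq: "\<And>x. x \<in> ball 0 1 \<Longrightarrow> cauchy_int h x = H x"
    by (rule uniformly_continuous_on_extension_on_closure) blast
  have cH: "continuous_on (cball 0 1) H" using uniformly_continuous_imp_continuous[OF uc] by simp
  have HD: "H \<in> disc_functions"
    using cH holomorphic_transform[OF hol eq] by (simp add: disc_functions_def)
  have rlim: "((\<lambda>r. H (of_real r * z)) \<longlongrightarrow> H z) (at_left 1)" if z: "norm z = 1" for z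
  proof (rule continuous_on_tendsto_compose[OF cH])
    have "((\<lambda>r. of_real r * z) \<longlongrightarrow> of_real 1 * z) (at_left 1)" by (intro tendsto_intros)
    then show "((\<lambda>r. of_real r * z) \<longlongrightarrow> z) (at_left 1)" by simp
    show "\<forall>\<^sub>F r in at_left 1. of_real r * z \<in> cball 0 1"
      using eventually_at_left_real[OF zero_less_one] by (rule eventually_mono) (use z in \<open>auto simp: norm_mult\<close>)
  qed (use z in auto)
  have "norm (H z - H w) \<le> N * norm (z - w) powr \<mu>" if zw: "norm z = 1" "norm w = 1" for z w
  proof (rule tendsto_upperbound)
    show "((\<lambda>r. norm (H (of_real r * z) - H (of_real r * w))) \<longlongrightarrow> norm (H z - H w)) (at_left 1)"
      using rlim zw by (intro tendsto_intros) auto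
    show "\<forall>\<^sub>F r in at_left 1. norm (H (of_real r * z) - H (of_real r * w)) \<le> N * norm (z - w) powr \<mu>"
      using eventually_at_left_real[OF zero_less_one]
    proof (rule eventually_mono)
      fix r :: real assume r: "r \<in> {0<..<1}"
      then have i: "of_real r * z \<in> ball 0 1" "of_real r * w \<in> ball 0 1" using zw by (auto simp: norm_mult)
      have "norm (H (of_real r * z) - H (of_real r * w)) \<le> N * norm (of_real r * z - of_real r * w) powr \<mu>"
        using H[of "of_real r * z" "of_real r * w"] i eq by simp
      also have "\<dots> \<le> N * norm (z - w) powr \<mu>"
      proof (intro mult_left_mono powr_mono2)
        have "of_real r * z - of_real r * w = of_real r * (z - w)" by (simp add: algebra_simps)
        then show "norm (of_real r * z - of_real r * w) \<le> norm (z - w)"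
          using r by (simp add: norm_mult mult_left_le_one_le)
      qed (use \<mu> C in auto)
      finally show "norm (H (of_real r * z) - H (of_real r * w)) \<le> N * norm (z - w) powr \<mu>" .
    qed
  qed simp
  then have "hoelder_circle \<mu> N H" using C by (auto simp: hoelder_circle_def)
  with HD eq show ?thesis by (intro that) auto
qed

lemma cauchy_int_cnj:
  assumes h: "continuous_on (sphere 0 1) h" and z: "norm z < 1"
  shows "((\<lambda>x. h (circ x) / (1 - cnj z * circ x)) has_integral cauchy_int (\<lambda>\<zeta>. h (cnj \<zeta>)) (cnj z)) {0..1}"
proof -
  have "continuous_on (sphere 0 1) (\<lambda>\<zeta>. h (cnj \<zeta>))"
    by (rule continuous_on_compose2[OF h]) (auto intro!: continuous_intros)
  then have "((\<lambda>x. h (cnj (circ x)) * circ x / (circ x - cnj z)) has_integral cauchy_int (\<lambda>\<zeta>. h (cnj \<zeta>)) (cnj z)) {0..1}"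
    unfolding cauchy_int_def using cauchy_int_integrable[of "\<lambda>\<zeta>. h (cnj \<zeta>)" "cnj z"] z by auto
  then have "((\<lambda>x. h (cnj (circ ((-1) *\<^sub>R x + 1))) * circ ((-1) *\<^sub>R x + 1) / (circ ((-1) *\<^sub>R x + 1) - cnj z)) has_integral
      (1 / (\<bar>-1\<bar> ^ DIM(real))) *\<^sub>R cauchy_int (\<lambda>\<zeta>. h (cnj \<zeta>)) (cnj z)) ((\<lambda>x. (1 / (-1)) *\<^sub>R x + -((1 / (-1)) *\<^sub>R 1)) ` cbox 0 1)"
    by (intro has_integral_affinity) auto
  moreover have "(\<lambda>x::real. (1 / (-1)) *\<^sub>R x + -((1 / (-1)) *\<^sub>R 1)) ` cbox 0 1 = {0..1}"
    by (auto simp: image_iff intro!: bexI[of _ "1 - _"])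
  ultimately have "((\<lambda>x. h (cnj (circ (1 - x))) * circ (1 - x) / (circ (1 - x) - cnj z)) has_integral
      cauchy_int (\<lambda>\<zeta>. h (cnj \<zeta>)) (cnj z)) {0..1}" by (simp add: add.commute)
  then show ?thesis
  proof (rule has_integral_eq[rotated])
    fix x :: real
    have "circ (1 - x) = 1 / circ x" "cnj (circ (1 - x)) = circ x"
      unfolding circ_reflect cnj_circ by (simp_all add: circ_minus)
    moreover have "1 - cnj z * circ x \<noteq> 0"
    proof
      assume "1 - cnj z * circ x = 0"
      then have "norm (cnj z * circ x) = 1" by simp
      then show False using z by (simp add: norm_mult)
    qed
    moreover have "1 / circ x - cnj z = (1 - cnj z * circ x) / circ x" by (simp add: diff_divide_distrib)
    ultimately show "h (cnj (circ (1 - x))) * circ (1 - x) / (circ (1 - x) - cnj z) = h (circ x) / (1 - cnj z * circ x)"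
      by simp
  qed
qed

text \<open>The sum of the Cauchy integrals of \<open>h\<close> and of its reflection is, up to a constant, the
  Poisson integral of \<open>h\<close>, so it tends to \<open>h\<close> at the boundary. For the convergence it is enough
  to bound \<open>h \<zeta> - h \<omega>\<close> by \<open>\<epsilon> + C \<bar>\<zeta> - \<omega>\<bar>\<^sup>2\<close>, because \<open>\<bar>\<zeta> - \<omega>\<bar>\<^sup>2\<close> times the Poisson kernel at \<open>r \<omega>\<close> is at
  most \<open>4 (1 - r\<^sup>2)\<close>.\<close>

lemma plemelj:
  assumes h: "hoelder_circle \<mu> M h" and \<mu>: "0 < \<mu>"
    and H1: "H1 \<in> disc_functions" "\<And>z. norm z < 1 \<Longrightarrow> H1 z = cauchy_int h z"
    and H2: "H2 \<in> disc_functions" "\<And>z. norm z < 1 \<Longrightarrow> H2 z = cauchy_int (\<lambda>\<zeta>. h (cnj \<zeta>)) z"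
    and w: "norm w = 1"
  shows "H1 w + H2 (cnj w) - H1 0 = h w"
proof -
  have c: "continuous_on (sphere 0 1) h" by (rule hoelder_circle_continuous[OF h \<mu>(1)])
  have M: "M \<ge> 0" using h by (simp add: hoelder_circle_def)
  define P where "P r x = (1 - r\<^sup>2) / (norm (circ x - of_real r * w))\<^sup>2" for r x :: real
  have poisson: "((\<lambda>x. g (circ x) * of_real (P r x)) has_integral
      cauchy_int g (of_real r * w) + cauchy_int (\<lambda>\<zeta>. g (cnj \<zeta>)) (cnj (of_real r * w)) - cauchy_int g 0) {0..1}"
    if r: "0 \<le> r" "r < 1" and g: "continuous_on (sphere 0 1) g" for r g
  proof -
    define z where "z = of_real r * w"
    have z: "norm z < 1" using r w by (simp add: z_def norm_mult)
    have "((\<lambda>x. g (circ x) * circ x / (circ x - z) + g (circ x) / (1 - cnj z * circ x) - g (circ x) * circ x / (circ x - 0))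
      has_integral cauchy_int g z + cauchy_int (\<lambda>\<zeta>. g (cnj \<zeta>)) (cnj z) - cauchy_int g 0) {0..1}"
      by (intro has_integral_add has_integral_diff cauchy_int_cnj[OF g z])
        (use cauchy_int_integrable[OF g] cauchy_int_integrable[OF g, of 0] z in \<open>auto simp: cauchy_int_def\<close>)
    moreover have "g (circ x) * circ x / (circ x - z) + g (circ x) / (1 - cnj z * circ x) - g (circ x) * circ x / (circ x - 0)
       = g (circ x) * of_real (P r x)" for x
    proof -
      let ?u = "circ x"
      have u: "cnj ?u = 1 / ?u" by (simp add: cnj_circ circ_minus)
      have nz: "?u - z \<noteq> 0" "1 - cnj z * ?u \<noteq> 0"
        using circ_minus_nonzero[OF z, of x] z norm_circ[of x] by (auto, metis complex_mod_cnj less_irrefl mult.right_neutral norm_mult norm_one)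
      have "complex_of_real ((norm (?u - z))\<^sup>2) = (?u - z) * cnj (?u - z)" by (rule complex_norm_square)
      also have "\<dots> = (?u - z) * (1 - cnj z * ?u) / ?u" by (simp add: u field_simps)
      finally have n: "complex_of_real ((norm (?u - z))\<^sup>2) = (?u - z) * (1 - cnj z * ?u) / ?u" .
      have "complex_of_real ((norm z)\<^sup>2) = z * cnj z" by (rule complex_norm_square)
      moreover have "(norm z)\<^sup>2 = r\<^sup>2" using w by (simp add: z_def norm_mult)
      ultimately have zz: "(of_real r)\<^sup>2 = z * cnj z" by simp
      have "complex_of_real (P r x) = (1 - z * cnj z) / ((?u - z) * (1 - cnj z * ?u) / ?u)"
        unfolding P_def z_def[symmetric] of_real_divide n by (simp add: zz)
      moreover have "?u / (?u - z) + 1 / (1 - cnj z * ?u) - 1 = (1 - z * cnj z) / ((?u - z) * (1 - cnj z * ?u) / ?u)"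
        using nz by (simp add: divide_simps) (simp add: algebra_simps)
      ultimately have "g ?u * of_real (P r x) = g ?u * (?u / (?u - z) + 1 / (1 - cnj z * ?u) - 1)" by simp
      then show ?thesis by (simp add: right_diff_distrib distrib_left)
    qed
    ultimately show ?thesis by (simp add: z_def)
  qed
  have one: "((\<lambda>x. P r x) has_integral 1) {0..1}" if r: "0 \<le> r" "r < 1" for r
  proof -
    have n: "norm (of_real r * w) < 1" using r w by (simp add: norm_mult)
    have "((\<lambda>x. complex_of_real (P r x)) has_integral 1) {0..1}"
      using poisson[OF r, of "\<lambda>_. 1"] n by (simp add: cauchy_int_const del: complex_cnj_mult complex_cnj_complex_of_real)
    then have "((\<lambda>x. Re (complex_of_real (P r x))) has_integral Re 1) {0..1}" by (rule has_integral_Re)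
    then show ?thesis by simp
  qed
  define D where "D = H1 w + H2 (cnj w) - H1 0 - h w"
  have "norm D \<le> \<epsilon>" if \<epsilon>: "\<epsilon> > 0" for \<epsilon>
  proof -
    \<comment> \<open>Within distance \<open>d\<close> the Hoelder bound is at most \<open>\<epsilon>\<close>; beyond it, it is at most \<open>K\<close> times the
      square of the distance.\<close>
    define d where "d = (\<epsilon> / (M + 1)) powr (1 / \<mu>)"
    have d: "d > 0" using \<epsilon> M by (simp add: d_def)
    define K where "K = M * 2 powr \<mu> / d\<^sup>2"
    have K: "K \<ge> 0" using M by (simp add: K_def)
    have hb: "norm (h v - h w) \<le> \<epsilon> + K * (norm (v - w))\<^sup>2" if v: "norm v = 1" for v
    proof -
      have hv: "norm (h v - h w) \<le> M * norm (v - w) powr \<mu>" using h v w by (simp add: hoelder_circle_def)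
      show ?thesis
      proof (cases "norm (v - w) \<le> d")
        case True
        then have "norm (v - w) powr \<mu> \<le> d powr \<mu>" using \<mu> by (intro powr_mono2) auto
        also have "d powr \<mu> = \<epsilon> / (M + 1)" using \<mu> \<epsilon> M by (simp add: d_def powr_powr)
        finally have "M * norm (v - w) powr \<mu> \<le> M * (\<epsilon> / (M + 1))" using M by (intro mult_left_mono) auto
        also have "\<dots> \<le> \<epsilon>" using \<epsilon> M by (simp add: field_simps)
        finally show ?thesis using hv K by (smt (verit) mult_nonneg_nonneg zero_le_power2)
      next
        case False
        have "norm (v - w) \<le> 2" using norm_triangle_ineq4[of v w] v w by simp
        then have "M * norm (v - w) powr \<mu> \<le> M * 2 powr \<mu>" using \<mu> M by (intro mult_left_mono powr_mono2) auto
        also have "\<dots> = K * d\<^sup>2" using d by (simp add: K_def)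
        also have "\<dots> \<le> K * (norm (v - w))\<^sup>2" using False d K by (intro mult_left_mono power_mono) auto
        finally show ?thesis using hv \<epsilon> by linarith
      qed
    qed
    have est: "norm (H1 (of_real r * w) + H2 (cnj (of_real r * w)) - H1 0 - h w) \<le> \<epsilon> + 4 * K * (1 - r\<^sup>2)" if r: "0 \<le> r" "r < 1" for r
    proof -
      have n: "norm (of_real r * w) < 1" using r w by (simp add: norm_mult)
      have "norm (cnj (of_real r * w)) < 1" using n by (subst complex_mod_cnj)
      then have eq: "H1 (of_real r * w) + H2 (cnj (of_real r * w)) - H1 0
          = cauchy_int h (of_real r * w) + cauchy_int (\<lambda>\<zeta>. h (cnj \<zeta>)) (cnj (of_real r * w)) - cauchy_int h 0"
        using H1(2) H2(2) n by simp
      have P0: "P r x \<ge> 0" for x using r by (simp add: P_def abs_square_le_1)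
      have i: "((\<lambda>x. h (circ x) * of_real (P r x) - h w * of_real (P r x)) has_integral
          (cauchy_int h (of_real r * w) + cauchy_int (\<lambda>\<zeta>. h (cnj \<zeta>)) (cnj (of_real r * w)) - cauchy_int h 0) - h w * 1) {0..1}"
        using has_integral_of_real[OF one[OF r]] by (intro has_integral_diff poisson[OF r c] has_integral_mult_right) simp
      have j: "((\<lambda>x. \<epsilon> * P r x + 4 * K * (1 - r\<^sup>2)) has_integral \<epsilon> * 1 + 4 * K * (1 - r\<^sup>2)) {0..1}"
        using has_integral_const_real[of "1 - r\<^sup>2" 0 1] by (intro has_integral_add has_integral_mult_right one[OF r]) simp
      have "norm (integral {0..1} (\<lambda>x. h (circ x) * of_real (P r x) - h w * of_real (P r x))) \<le> integral {0..1} (\<lambda>x. \<epsilon> * P r x + 4 * K * (1 - r\<^sup>2))"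
      proof (rule integral_norm_bound_integral)
        fix x :: real
        obtain a where a: "a \<in> {0..1}" "w = circ a" using circ_onto[OF w] by blast
        assume "x \<in> {0..1}"
        then have "norm (circ x - w) \<le> 2 * norm (circ x - of_real r * w)"
          using norm_circ_minus_ge(1)[OF r, of x a] a by auto
        then have "(norm (circ x - w))\<^sup>2 \<le> (2 * norm (circ x - of_real r * w))\<^sup>2" by (intro power_mono) auto
        then have sq: "(norm (circ x - w))\<^sup>2 \<le> 4 * (norm (circ x - of_real r * w))\<^sup>2" by (simp add: power_mult_distrib)
        have r2: "1 - r\<^sup>2 \<ge> 0" using r by (simp add: abs_square_le_1)
        have "circ x - of_real r * w \<noteq> 0" using circ_minus_nonzero[OF n] .
        then have kp: "(norm (circ x - w))\<^sup>2 * P r x \<le> 4 * (1 - r\<^sup>2)"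
          using mult_right_mono[OF sq r2] by (simp add: P_def divide_simps) (simp add: algebra_simps)
        have "norm (h (circ x) * of_real (P r x) - h w * of_real (P r x)) = norm (h (circ x) - h w) * P r x"
          using P0[of x] by (simp add: norm_mult flip: left_diff_distrib)
        also have "\<dots> \<le> (\<epsilon> + K * (norm (circ x - w))\<^sup>2) * P r x" using hb[of "circ x"] P0[of x] by (intro mult_right_mono) auto
        also have "\<dots> = \<epsilon> * P r x + K * ((norm (circ x - w))\<^sup>2 * P r x)" by (simp add: algebra_simps)
        also have "\<dots> \<le> \<epsilon> * P r x + K * (4 * (1 - r\<^sup>2))" using kp K by (intro add_left_mono mult_left_mono) auto
        finally show "norm (h (circ x) * of_real (P r x) - h w * of_real (P r x)) \<le> \<epsilon> * P r x + 4 * K * (1 - r\<^sup>2)" by (simp add: algebra_simps)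
      qed (use i j in auto)
      then show ?thesis unfolding integral_unique[OF i] integral_unique[OF j] eq by simp
    qed
    have rl: "((\<lambda>r. of_real r * w) \<longlongrightarrow> w) (at_left 1)"
    proof -
      have "((\<lambda>r. of_real r * w) \<longlongrightarrow> of_real 1 * w) (at_left 1)" by (intro tendsto_intros)
      then show ?thesis by simp
    qed
    have ev: "\<forall>\<^sub>F r::real in at_left 1. r \<in> {0<..<1}" by (rule eventually_at_left_real) simp
    have lD: "((\<lambda>r. norm (H1 (of_real r * w) + H2 (cnj (of_real r * w)) - H1 0 - h w)) \<longlongrightarrow> norm D) (at_left 1)"
      unfolding D_def
    proof (intro tendsto_intros)
      show "((\<lambda>r. H1 (of_real r * w)) \<longlongrightarrow> H1 w) (at_left 1)"
        by (rule continuous_on_tendsto_compose[OF _ rl, where s="cball 0 1"])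
          (use H1 w ev in \<open>auto simp: disc_functions_def norm_mult elim!: eventually_mono\<close>)
      have cl: "((\<lambda>r. cnj (of_real r * w)) \<longlongrightarrow> cnj w) (at_left 1)" by (intro tendsto_cnj rl)
      show "((\<lambda>r. H2 (cnj (of_real r * w))) \<longlongrightarrow> H2 (cnj w)) (at_left 1)"
        by (rule continuous_on_tendsto_compose[OF _ cl, where s="cball 0 1"])
          (use H2 w ev in \<open>auto simp: disc_functions_def norm_mult elim!: eventually_mono\<close>)
    qed
    have lE: "((\<lambda>r. \<epsilon> + 4 * K * (1 - r\<^sup>2)) \<longlongrightarrow> \<epsilon> + 4 * K * (1 - 1\<^sup>2)) (at_left (1::real))" by (intro tendsto_intros)
    have "norm D \<le> \<epsilon> + 4 * K * (1 - 1\<^sup>2)"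
    proof (rule tendsto_le[OF _ lE lD])
      show "\<forall>\<^sub>F r in at_left 1. norm (H1 (of_real r * w) + H2 (cnj (of_real r * w)) - H1 0 - h w) \<le> \<epsilon> + 4 * K * (1 - r\<^sup>2)"
        using ev by (rule eventually_mono) (rule est; auto)
    qed simp
    then show ?thesis by simp
  qed
  then have "norm D \<le> 0" by (rule dense_ge)
  then show ?thesis by (simp add: D_def)
qed

text \<open>Choosing a preimage saves the inverse of \<open>cay\<close>; for a Hoelder function the choice does not matter.\<close>

definition on_circle :: "(complex option \<Rightarrow> complex) \<Rightarrow> complex \<Rightarrow> complex" where
  "on_circle f w = f (SOME x. x \<in> Rdot \<and> cay x = w)"

lemma on_circle_some:
  assumes "norm w = 1" obtains x where "x \<in> Rdot" "cay x = w" "on_circle f w = f x"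
proof -
  have "\<exists>x. x \<in> Rdot \<and> cay x = w" using disc_coord_onto_circle[of "-1" w] assms by (auto simp: disc_coord_upper)
  then have "(SOME x. x \<in> Rdot \<and> cay x = w) \<in> Rdot \<and> cay (SOME x. x \<in> Rdot \<and> cay x = w) = w" by (rule someI_ex)
  then show ?thesis by (intro that) (auto simp: on_circle_def)
qed

lemma on_circle_hoelder:
  assumes "f \<in> C_mu \<mu>" obtains M where "hoelder_circle \<mu> M (on_circle f)"
proof -
  obtain M where M: "M \<ge> 0"
    "\<And>x y. x \<in> Rdot \<Longrightarrow> y \<in> Rdot \<Longrightarrow> norm (f x - f y) \<le> M * dist (cay x) (cay y) powr \<mu>"
    by (rule C_muE[OF assms]) (rule that; assumption)
  have "norm (on_circle f z - on_circle f w) \<le> M * norm (z - w) powr \<mu>" if "norm z = 1" "norm w = 1" for z w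
    by (metis M(2) on_circle_some that dist_norm)
  then show ?thesis using M by (intro that[of M]) (auto simp: hoelder_circle_def)
qed

lemma on_circle_cay:
  assumes "f \<in> C_mu \<mu>" "x \<in> Rdot" shows "on_circle f (cay x) = f x"
proof -
  obtain M where M: "M \<ge> 0"
    "\<And>x y. x \<in> Rdot \<Longrightarrow> y \<in> Rdot \<Longrightarrow> norm (f x - f y) \<le> M * dist (cay x) (cay y) powr \<mu>"
    by (rule C_muE[OF assms(1)]) (rule that; assumption)
  obtain y where y: "y \<in> Rdot" "cay y = cay x" "on_circle f (cay x) = f y"
    by (rule on_circle_some[OF norm_cay[OF assms(2)]]) (rule that; assumption)
  have "norm (f y - f x) \<le> M * dist (cay y) (cay x) powr \<mu>" using M(2) y assms by blast
  then show ?thesis using y by simp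
qed

lemma hoelder_circle_C_mu:
  "hoelder_circle \<mu> N H \<Longrightarrow> e \<in> {1, -1} \<Longrightarrow> (\<lambda>x. H (disc_coord e x)) \<in> C_mu \<mu>"
proof (rule C_muI[where M=N])
  fix x y assume a: "hoelder_circle \<mu> N H" "e \<in> {1, -1}" "x \<in> Rdot" "y \<in> Rdot"
  have "norm (disc_coord e x - disc_coord e y) = dist (cay x) (cay y)"
  proof (cases "e = 1")
    case True
    have "1 / cay x - 1 / cay y = (cay y - cay x) / (cay x * cay y)" using a cay_nonzero by (simp add: field_simps)
    then have "norm (1 / cay x - 1 / cay y) = norm (cay y - cay x)" using a norm_cay by (simp add: norm_divide norm_mult)
    with True show ?thesis by (simp add: disc_coord_lower dist_norm norm_minus_commute)
  qed (use a in \<open>auto simp: disc_coord_upper dist_norm\<close>)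
  then show "norm (H (disc_coord e x) - H (disc_coord e y)) \<le> N * dist (cay x) (cay y) powr \<mu>"
    using a norm_disc_coord by (metis hoelder_circle_def)
qed

lemma C_mu_splitting:
  assumes f: "f \<in> C_mu \<mu>" and \<mu>: "0 < \<mu>" "\<mu> < 1"
  obtains H1 fm where "H1 \<in> disc_functions" "\<And>z. norm z < 1 \<Longrightarrow> H1 z = cauchy_int (on_circle f) z"
    "(\<lambda>x. H1 (cay x)) \<in> C_mu \<mu>" "fm \<in> disc_alg \<mu> 1" "\<And>x. x \<in> Rdot \<Longrightarrow> f x = H1 (cay x) + fm x"
proof -
  obtain M where M: "hoelder_circle \<mu> M (on_circle f)" by (rule on_circle_hoelder[OF f])
  then have M': "hoelder_circle \<mu> M (\<lambda>\<zeta>. on_circle f (cnj \<zeta>))"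
    unfolding hoelder_circle_def by (metis complex_cnj_diff complex_mod_cnj)
  obtain H1 N1 where H1: "H1 \<in> disc_functions" "hoelder_circle \<mu> N1 H1" "\<And>z. norm z < 1 \<Longrightarrow> H1 z = cauchy_int (on_circle f) z"
    by (rule privalov[OF M \<mu>]) (rule that; assumption)
  obtain H2 N2 where H2: "H2 \<in> disc_functions" "hoelder_circle \<mu> N2 H2" "\<And>z. norm z < 1 \<Longrightarrow> H2 z = cauchy_int (\<lambda>\<zeta>. on_circle f (cnj \<zeta>)) z"
    by (rule privalov[OF M' \<mu>]) (rule that; assumption)
  have "(\<lambda>x. H2 (disc_coord 1 x)) \<in> disc_alg \<mu> 1"
    by (rule disc_algI[OF hoelder_circle_C_mu[OF H2(2)] H2(1)]) auto
  then have fm: "(\<lambda>x. H2 (disc_coord 1 x) - H1 0) \<in> disc_alg \<mu> 1" by (intro disc_alg_diff) auto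
  have "f x = H1 (cay x) + (H2 (disc_coord 1 x) - H1 0)" if x: "x \<in> Rdot" for x
  proof -
    have "cnj (cay x) = disc_coord 1 x"
      using norm_cay[OF x] complex_norm_square[of "cay x"] cay_nonzero[OF x] by (simp add: disc_coord_lower field_simps)
    then show ?thesis
      using plemelj[OF M \<mu>(1) H1(1,3) H2(1,3) norm_cay[OF x]] on_circle_cay[OF f x] by (simp add: algebra_simps)
  qed
  moreover have "(\<lambda>x. H1 (cay x)) \<in> C_mu \<mu>" using hoelder_circle_C_mu[OF H1(2), of "-1"] by (simp add: disc_coord_upper)
  ultimately show ?thesis using that[OF H1(1,3) _ fm] by blast
qed

section \<open>Bounded analytic functions with Hoelder boundary values\<close>

lemma half_eq_inner: "half e = {z. (of_real e * \<i>) \<bullet> z < 0}"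
  by (simp add: half_def inner_complex_def)

lemma half_convex: "convex (half e)" and half_open: "open (half e)"
  unfolding half_eq_inner by (rule convex_halfspace_lt open_halfspace_lt)+

lemma half_closure: "e \<noteq> 0 \<Longrightarrow> closure (half e) = {z. e * Im z \<le> 0}"
  unfolding half_eq_inner by (subst closure_halfspace_lt) (auto simp: inner_complex_def)

lemma AE_lborel_negligible:
  assumes "AE x in lborel. P (x::real)" obtains N where "negligible N" "\<And>x. x \<notin> N \<Longrightarrow> P x"
proof -
  obtain N where "N \<in> null_sets lborel" "{x. \<not> P x} \<subseteq> N" using assms by (auto simp: eventually_ae_filter)
  then show ?thesis using that[of N] by (auto simp: negligible_iff_null_sets intro: null_sets_completionI)
qed

text \<open>A bounded analytic function has a Lipschitz primitive, which extends continuously to the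
  boundary; by dominated convergence its boundary values are a primitive of the boundary
  function. This replaces almost everywhere limits by continuous boundary values.\<close>

lemma H_infty_primitive:
  assumes e: "e \<in> {1, -1}" and F: "F holomorphic_on half e" "\<forall>z\<in>half e. norm (F z) \<le> B"
    and lim: "AE x in lborel. \<forall>a>0. (F \<longlongrightarrow> k x) (at (complex_of_real x) within {z \<in> half e. \<bar>Re z - x\<bar> \<le> a * \<bar>Im z\<bar>})"
  obtains I where "continuous_on {z. e * Im z \<le> 0} I" "\<And>z. z \<in> half e \<Longrightarrow> (I has_field_derivative F z) (at z)"
    "\<And>p q. p \<le> q \<Longrightarrow> I (of_real q) - I (of_real p) = integral {p..q} k"
proof -
  obtain I0 where I0: "\<And>z. z \<in> half e \<Longrightarrow> (I0 has_field_derivative F z) (at z within half e)"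
    using holomorphic_convex_primitive'[OF half_convex half_open F(1)] by blast
  have B: "B \<ge> 0"
  proof -
    have "- of_real e * \<i> \<in> half e" using e by (auto simp: half_def)
    then show ?thesis using F(2) norm_ge_zero order_trans by blast
  qed
  have "norm (I0 z - I0 w) \<le> B * norm (z - w)" if "z \<in> half e" "w \<in> half e" for z w
    using F(2) that by (intro field_differentiable_bound[OF half_convex I0]) auto
  then have "B-lipschitz_on (half e) I0" using B by (auto intro!: lipschitz_onI simp: dist_norm)
  then have "uniformly_continuous_on (half e) I0" by (rule lipschitz_on_uniformly_continuous)
  then obtain I where uc: "uniformly_continuous_on (closure (half e)) I" and eq: "\<And>z. z \<in> half e \<Longrightarrow> I0 z = I z"
    by (rule uniformly_continuous_on_extension_on_closure) blast
  have cI: "continuous_on {z. e * Im z \<le> 0} I"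
    using uniformly_continuous_imp_continuous[OF uc] half_closure[of e] e by auto
  have dI: "(I has_field_derivative F z) (at z)" if z: "z \<in> half e" for z
  proof -
    have "(I0 has_field_derivative F z) (at z)" using I0[OF z] at_within_open[OF z half_open] by simp
    then show ?thesis by (rule has_field_derivative_transform_within_open[OF _ half_open z eq])
  qed
  obtain N where N: "negligible N" "\<And>x. x \<notin> N \<Longrightarrow> \<forall>a>0. (F \<longlongrightarrow> k x) (at (complex_of_real x) within {z \<in> half e. \<bar>Re z - x\<bar> \<le> a * \<bar>Im z\<bar>})"
    by (rule AE_lborel_negligible[OF lim]) (rule that; assumption)
  define s where "s n = inverse (real (Suc n))" for n
  have s: "s n > 0" for n by (simp add: s_def)
  have s0: "s \<longlonglongrightarrow> 0" unfolding s_def by (rule LIMSEQ_inverse_real_of_nat)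
  define v where "v n x = complex_of_real x - of_real (e * s n) * \<i>" for n x
  have v: "v n x \<in> half e" for n x using e s[of n] by (auto simp: v_def half_def)
  have vlim: "(\<lambda>n. v n x) \<longlonglongrightarrow> of_real x" for x
  proof -
    have "(\<lambda>n. v n x) \<longlonglongrightarrow> of_real x - of_real (e * 0) * \<i>" unfolding v_def by (intro tendsto_intros s0)
    then show ?thesis by simp
  qed
  have Flim: "(\<lambda>n. F (v n x)) \<longlonglongrightarrow> k x" if "x \<notin> N" for x
  proof -
    have "(F \<longlongrightarrow> k x) (at (complex_of_real x) within {z \<in> half e. \<bar>Re z - x\<bar> \<le> 1 * \<bar>Im z\<bar>})" using N(2)[OF that] zero_less_one by blast
    moreover have "filterlim (\<lambda>n. v n x) (at (complex_of_real x) within {z \<in> half e. \<bar>Re z - x\<bar> \<le> 1 * \<bar>Im z\<bar>}) sequentially"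
    proof (rule filterlim_at_withinI[OF vlim])
      show "\<forall>\<^sub>F n in sequentially. v n x \<in> {z \<in> half e. \<bar>Re z - x\<bar> \<le> 1 * \<bar>Im z\<bar>} - {complex_of_real x}"
        using v s e by (intro always_eventually allI) (auto simp: v_def complex_eq_iff less_imp_neq[symmetric])
    qed
    ultimately show ?thesis by (rule filterlim_compose)
  qed
  have "I (of_real q) - I (of_real p) = integral {p..q} k" if pq: "p \<le> q" for p q
  proof -
    have FTC: "((\<lambda>x. F (v n x)) has_integral I (v n q) - I (v n p)) {p..q}" for n
    proof (rule fundamental_theorem_of_calculus[OF pq])
      fix x
      have "((\<lambda>x. v n x) has_vector_derivative 1) (at x within {p..q})"
        unfolding v_def by (auto intro!: derivative_eq_intros simp: has_vector_derivative_of_real)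
      then have "((I \<circ> v n) has_vector_derivative 1 * F (v n x)) (at x within {p..q})"
        by (rule field_vector_diff_chain_within[OF _ has_field_derivative_at_within[OF dI[OF v]]])
      then show "((\<lambda>x. I (v n x)) has_vector_derivative F (v n x)) (at x within {p..q})" by (simp add: o_def)
    qed
    let ?f = "\<lambda>n x. if x \<in> N then 0 else F (v n x)"
    let ?k = "\<lambda>x. if x \<in> N then 0 else k x"
    have f: "(?f n has_integral I (v n q) - I (v n p)) {p..q}" for n
      by (rule has_integral_spike[OF N(1) _ FTC]) auto
    have "(\<lambda>n. integral {p..q} (?f n)) \<longlonglongrightarrow> integral {p..q} ?k"
    proof (rule dominated_convergence(2)[where h="\<lambda>_. B"])
      show "?f n integrable_on {p..q}" for n using f by (rule has_integral_integrable)
      show "(\<lambda>_. B) integrable_on {p..q}" by (rule integrable_const_ivl)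
      show "norm (?f n x) \<le> B" for n x using F(2) v B by simp
      show "(\<lambda>n. ?f n x) \<longlonglongrightarrow> ?k x" for x using Flim[of x] by simp
    qed
    then have "(\<lambda>n. I (v n q) - I (v n p)) \<longlonglongrightarrow> integral {p..q} ?k" by (simp only: integral_unique[OF f])
    moreover have "integral {p..q} ?k = integral {p..q} k" by (rule integral_spike[OF N(1)]) auto
    moreover have "(\<lambda>n. I (v n x)) \<longlonglongrightarrow> I (of_real x)" for x
    proof (rule continuous_on_tendsto_compose[OF cI vlim])
      show "\<forall>\<^sub>F n in sequentially. v n x \<in> {z. e * Im z \<le> 0}"
        by (intro always_eventually allI) (use v in \<open>auto simp: half_def intro: less_imp_le\<close>)
    qed simp
    then have "(\<lambda>n. I (v n q) - I (v n p)) \<longlonglongrightarrow> I (of_real q) - I (of_real p)" by (intro tendsto_diff)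
    ultimately show ?thesis using LIMSEQ_unique by fastforce
  qed
  with cI dI show ?thesis by (rule that)
qed

text \<open>The primitives on the two sides have the same boundary values and can be pasted together to an
  entire function. Its derivative is bounded, hence constant by Liouville's theorem.\<close>

lemma H_infty_both_halves_const:
  assumes f: "f \<in> H_infty (half 1)" "f \<in> H_infty (half (-1))"
  obtains c where "AE x in lborel. f (Some (complex_of_real x)) = c"
proof -
  let ?lim = "\<lambda>F e. AE x in lborel. \<forall>a>0. (F \<longlongrightarrow> f (Some (complex_of_real x))) (at (complex_of_real x) within {z \<in> half e. \<bar>Re z - x\<bar> \<le> a * \<bar>Im z\<bar>})"
  obtain F where F: "F holomorphic_on half 1" "bounded (F ` half 1)" "?lim F 1" using f(1) by (auto simp: H_infty_def)
  obtain K where K: "K holomorphic_on half (-1)" "bounded (K ` half (-1))" "?lim K (-1)" using f(2) by (auto simp: H_infty_def)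
  obtain B where B: "\<forall>z\<in>half 1. norm (F z) \<le> B" "\<forall>z\<in>half (-1). norm (K z) \<le> B"
  proof -
    obtain B1 where B1: "\<forall>z\<in>half 1. norm (F z) \<le> B1" using F(2) by (auto simp: bounded_iff)
    obtain B2 where B2: "\<forall>z\<in>half (-1). norm (K z) \<le> B2" using K(2) by (auto simp: bounded_iff)
    show ?thesis by (rule that[of "max B1 B2"]) (use B1 B2 in \<open>meson max.coboundedI1 max.coboundedI2\<close>)+
  qed
  have e: "(1::real) \<in> {1, -1}" "(-1::real) \<in> {1, -1}" by auto
  note primF = H_infty_primitive[OF e(1) F(1) B(1) F(3)]
  note primK = H_infty_primitive[OF e(2) K(1) B(2) K(3)]
  obtain I where I: "continuous_on {z. 1 * Im z \<le> 0} I" "\<And>z. z \<in> half 1 \<Longrightarrow> (I has_field_derivative F z) (at z)"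
    "\<And>p q. p \<le> q \<Longrightarrow> I (of_real q) - I (of_real p) = integral {p..q} (\<lambda>x. f (Some (complex_of_real x)))"
    by (rule primF) (rule that; assumption)
  obtain J where J: "continuous_on {z. -1 * Im z \<le> 0} J" "\<And>z. z \<in> half (-1) \<Longrightarrow> (J has_field_derivative K z) (at z)"
    "\<And>p q. p \<le> q \<Longrightarrow> J (of_real q) - J (of_real p) = integral {p..q} (\<lambda>x. f (Some (complex_of_real x)))"
    by (rule primK) (rule that; assumption)
  define L where "L z = (if Im z \<le> 0 then I z - I 0 else J z - J 0)" for z
  have match: "I (of_real x) - I 0 = J (of_real x) - J 0" for x
    using I(3)[of 0 x] J(3)[of 0 x] I(3)[of x 0] J(3)[of x 0] by (cases "x \<ge> 0") (auto simp: algebra_simps)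
  have "continuous_on ({z. Im z \<le> 0} \<union> {z. Im z \<ge> 0}) L"
    unfolding L_def
  proof (rule continuous_on_cases)
    show "closed {z. Im z \<le> 0}" "closed {z. Im z \<ge> 0}" by (simp_all add: closed_halfspace_Im_le closed_halfspace_Im_ge)
    show "continuous_on {z. Im z \<le> 0} (\<lambda>z. I z - I 0)" "continuous_on {z. 0 \<le> Im z} (\<lambda>z. J z - J 0)"
      using I(1) J(1) by (auto intro!: continuous_intros)
    show "\<forall>z. z \<in> {z. Im z \<le> 0} \<and> \<not> Im z \<le> 0 \<or> z \<in> {z. 0 \<le> Im z} \<and> Im z \<le> 0 \<longrightarrow> I z - I 0 = J z - J 0"
    proof (intro allI impI)
      fix z :: complex assume "z \<in> {z. Im z \<le> 0} \<and> \<not> Im z \<le> 0 \<or> z \<in> {z. 0 \<le> Im z} \<and> Im z \<le> 0"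
      then have "Im z = 0" by auto
      then have "z = of_real (Re z)" by (simp add: complex_eq_iff)
      then show "I z - I 0 = J z - J 0" using match[of "Re z"] by simp
    qed
  qed
  then have cL: "continuous_on UNIV L"
    by (rule continuous_on_subset) (auto simp: linear)
  have low: "(L has_field_derivative F z) (at z)" if z: "Im z < 0" for z
  proof (rule has_field_derivative_transform_within_open[where S="half 1" and f="\<lambda>z. I z - I 0"])
    show "((\<lambda>z. I z - I 0) has_field_derivative F z) (at z)"
      using I(2)[of z] z by (auto intro!: derivative_eq_intros simp: half_def)
  qed (use z half_open[of 1] half_open[of "-1"] in \<open>auto simp: half_def L_def\<close>)
  have up: "(L has_field_derivative K z) (at z)" if z: "Im z > 0" for z
  proof (rule has_field_derivative_transform_within_open[where S="half (-1)" and f="\<lambda>z. J z - J 0"])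
    show "((\<lambda>z. J z - J 0) has_field_derivative K z) (at z)"
      using J(2)[of z] z by (auto intro!: derivative_eq_intros simp: half_def)
  qed (use z half_open[of 1] half_open[of "-1"] in \<open>auto simp: half_def L_def\<close>)
  have hol: "L holomorphic_on UNIV"
  proof (rule holomorphic_on_paste_across_line[where d=\<i> and k=0, OF open_UNIV])
    have "open {z. \<i> \<bullet> z < 0}" "open {z. 0 < \<i> \<bullet> z}" by (rule open_halfspace_lt open_halfspace_gt)+
    then show "L holomorphic_on UNIV \<inter> {z. \<i> \<bullet> z < 0}" "L holomorphic_on UNIV \<inter> {z. 0 < \<i> \<bullet> z}"
      using low up by (auto simp: holomorphic_on_open inner_complex_def intro!: exI)
  qed (use cL in auto)
  have hol': "deriv L holomorphic_on UNIV" using holomorphic_deriv[OF hol open_UNIV] .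
  have B': "norm (deriv L z) \<le> B" if "Im z \<noteq> 0" for z
    using low[of z] up[of z] B that by (cases "Im z < 0") (auto dest!: DERIV_imp_deriv simp: half_def)
  have "norm (deriv L z) \<le> B" for z
  proof (cases "Im z = 0")
    case True
    show ?thesis
    proof (rule tendsto_upperbound)
      have "isCont (deriv L) z" using holomorphic_on_imp_continuous_on[OF hol'] by (simp add: continuous_on_eq_continuous_at)
      moreover have "(\<lambda>n. z + of_real (inverse (real (Suc n))) * \<i>) \<longlonglongrightarrow> z + of_real 0 * \<i>"
        by (intro tendsto_intros LIMSEQ_inverse_real_of_nat)
      ultimately show "(\<lambda>n. norm (deriv L (z + of_real (inverse (real (Suc n))) * \<i>))) \<longlonglongrightarrow> norm (deriv L z)"
        by (intro tendsto_norm isCont_tendsto_compose[of z "deriv L"]) auto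
      show "\<forall>\<^sub>F n in sequentially. norm (deriv L (z + of_real (inverse (real (Suc n))) * \<i>)) \<le> B"
        using True by (intro always_eventually allI B') auto
    qed simp
  qed (rule B')
  then have "bounded (range (deriv L))" by (auto simp: bounded_iff)
  then obtain c where c: "\<And>z. deriv L z = c" using Liouville_theorem[OF hol'] by (auto simp: constant_on_def)
  have Fc: "F z = c" if "z \<in> half 1" for z
    using low[of z] c[of z] that by (auto dest!: DERIV_imp_deriv simp: half_def)
  have "AE x in lborel. f (Some (complex_of_real x)) = c"
    using F(3)
  proof (rule eventually_mono)
    fix x :: real
    let ?S = "{z \<in> half 1. \<bar>Re z - x\<bar> \<le> 1 * \<bar>Im z\<bar>}"
    assume "\<forall>a>0. (F \<longlongrightarrow> f (Some (complex_of_real x))) (at (complex_of_real x) within {z \<in> half 1. \<bar>Re z - x\<bar> \<le> a * \<bar>Im z\<bar>})"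
    then have l: "(F \<longlongrightarrow> f (Some (complex_of_real x))) (at (complex_of_real x) within ?S)" using zero_less_one by blast
    have "((\<lambda>_. c) \<longlongrightarrow> f (Some (complex_of_real x))) (at (complex_of_real x) within ?S)"
      using l by (rule Lim_transform_eventually) (auto simp: eventually_at_filter Fc)
    moreover have "complex_of_real x islimpt ?S"
      unfolding islimpt_sequential
    proof (intro exI[of _ "\<lambda>n. of_real x - of_real (inverse (real (Suc n))) * \<i>"] conjI allI)
      have "(\<lambda>n. of_real x - of_real (inverse (real (Suc n))) * \<i>) \<longlonglongrightarrow> of_real x - of_real 0 * \<i>"
        by (intro tendsto_intros LIMSEQ_inverse_real_of_nat)
      then show "(\<lambda>n. of_real x - of_real (inverse (real (Suc n))) * \<i>) \<longlonglongrightarrow> complex_of_real x" by simp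
    qed (auto simp: half_def complex_eq_iff)
    then have "at (complex_of_real x) within ?S \<noteq> bot" by (simp add: trivial_limit_within)
    ultimately show "f (Some (complex_of_real x)) = c" by (simp add: tendsto_const_iff)
  qed
  then show ?thesis by (rule that)
qed

text \<open>A null set contains no interval, so the points with value \<open>c\<close> are dense in the extended line.\<close>

lemma C_mu_AE_const:
  assumes f: "f \<in> C_mu \<mu>" and \<mu>: "0 < \<mu>" and ae: "AE x in lborel. f (Some (complex_of_real x)) = c" and y: "y \<in> Rdot"
  shows "f y = c"
proof -
  obtain N where N: "negligible N" "\<And>x. x \<notin> N \<Longrightarrow> f (Some (complex_of_real x)) = c" by (rule AE_lborel_negligible[OF ae]) (rule that; assumption)
  obtain M where M: "M \<ge> 0"
    "\<And>x y. x \<in> Rdot \<Longrightarrow> y \<in> Rdot \<Longrightarrow> norm (f x - f y) \<le> M * dist (cay x) (cay y) powr \<mu>"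
    by (rule C_muE[OF f]) (rule that; assumption)
  have ex: "\<exists>x. x \<notin> N \<and> dist (cay (Some (complex_of_real x))) (cay y) < d" if d: "d > 0" for d
  proof -
    have "\<exists>a b. a < b \<and> (\<forall>x\<in>{a<..<b}. dist (cay (Some (complex_of_real x))) (cay y) < d)"
    proof (cases y)
      case None
      define a where "a = 2 / d + 1"
      have a: "dist (cay (Some (complex_of_real x))) 1 < d" if x: "x > a" for x
      proof -
        have ap: "a > 0" using d by (simp add: a_def add_pos_pos)
        have nz: "complex_of_real x + \<i> \<noteq> 0" by (simp add: complex_eq_iff)
        have "(complex_of_real x - \<i>) / (complex_of_real x + \<i>) - 1 = - 2 * \<i> / (complex_of_real x + \<i>)" using nz by (simp add: field_simps)
        then have "dist (cay (Some (complex_of_real x))) 1 = 2 / norm (complex_of_real x + \<i>)"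
          by (simp add: cay_def dist_norm norm_divide norm_mult)
        also have "\<dots> \<le> 2 / x" using abs_Re_le_cmod[of "complex_of_real x + \<i>"] x ap nz by (intro divide_left_mono mult_pos_pos) auto
        also have "\<dots> < d"
        proof -
          have "2 / d < x" using x by (simp add: a_def)
          then show ?thesis using d x ap by (simp add: field_simps)
        qed
        finally show ?thesis .
      qed
      then show ?thesis using None by (intro exI[of _ a] exI[of _ "a + 1"]) (auto simp: cay_def)
    next
      case (Some r)
      then obtain r' where r': "r = complex_of_real r'" using y by (auto simp: Rdot_def)
      have "isCont (\<lambda>x. (complex_of_real x - \<i>) / (complex_of_real x + \<i>)) r'"
        by (intro continuous_intros) (simp add: complex_eq_iff)
      then have "\<forall>\<^sub>F x in at r'. dist ((complex_of_real x - \<i>) / (complex_of_real x + \<i>)) ((complex_of_real r' - \<i>) / (complex_of_real r' + \<i>)) < d"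
        using d unfolding isCont_def by (rule tendstoD)
      then obtain \<delta> where \<delta>: "\<delta> > 0" "\<And>x. x \<noteq> r' \<Longrightarrow> dist x r' < \<delta> \<Longrightarrow> dist ((complex_of_real x - \<i>) / (complex_of_real x + \<i>)) ((complex_of_real r' - \<i>) / (complex_of_real r' + \<i>)) < d"
        by (auto simp: eventually_at)
      then show ?thesis using Some r' by (intro exI[of _ r'] exI[of _ "r' + \<delta>"]) (auto simp: cay_def dist_real_def)
    qed
    then obtain a b where ab: "a < b" "\<And>x. x \<in> {a<..<b} \<Longrightarrow> dist (cay (Some (complex_of_real x))) (cay y) < d" by blast
    have "\<not> {a<..<b} \<subseteq> N"
    proof
      assume "{a<..<b} \<subseteq> N"
      then have "negligible (box a b)" using negligible_subset[OF N(1)] by auto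
      then show False using ab(1) negligible_interval(2)[of a b] by simp
    qed
    then show ?thesis using ab(2) by blast
  qed
  have "norm (f y - c) \<le> \<epsilon>" if \<epsilon>: "\<epsilon> > 0" for \<epsilon>
  proof -
    define d where "d = (\<epsilon> / (M + 1)) powr (1 / \<mu>)"
    have d: "d > 0" using \<epsilon> M by (simp add: d_def)
    obtain x where x: "x \<notin> N" "dist (cay (Some (complex_of_real x))) (cay y) < d" using ex[OF d] by blast
    have xr: "Some (complex_of_real x) \<in> Rdot" by (simp add: Rdot_def)
    have "norm (f y - c) \<le> M * dist (cay (Some (complex_of_real x))) (cay y) powr \<mu>"
      using M(2)[OF xr y] N(2)[OF x(1)] by (simp add: norm_minus_commute)
    also have "\<dots> \<le> M * d powr \<mu>" using x \<mu> M by (intro mult_left_mono powr_mono2) auto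
    also have "d powr \<mu> = \<epsilon> / (M + 1)" using \<mu> \<epsilon> M by (simp add: d_def powr_powr)
    also have "M * (\<epsilon> / (M + 1)) \<le> \<epsilon>" using \<epsilon> M by (simp add: field_simps)
    finally show ?thesis .
  qed
  then have "norm (f y - c) \<le> 0" by (rule dense_ge)
  then show ?thesis by simp
qed

lemma H_infty_diff:
  assumes "f \<in> H_infty U" "g \<in> H_infty U" shows "(\<lambda>x. f x - g x) \<in> H_infty U"
proof -
  let ?lim = "\<lambda>F f x. \<forall>a>0. (F \<longlongrightarrow> f (Some (complex_of_real x))) (at (complex_of_real x) within {z \<in> U. \<bar>Re z - x\<bar> \<le> a * \<bar>Im z\<bar>})"
  obtain F where F: "F holomorphic_on U" "bounded (F ` U)" "AE x in lborel. ?lim F f x" using assms(1) by (auto simp: H_infty_def)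
  obtain K where K: "K holomorphic_on U" "bounded (K ` U)" "AE x in lborel. ?lim K g x" using assms(2) by (auto simp: H_infty_def)
  have "AE x in lborel. ?lim (\<lambda>z. F z - K z) (\<lambda>x. f x - g x) x"
    using F(3) K(3) by eventually_elim (auto intro!: tendsto_diff)
  moreover have "bounded ((\<lambda>z. F z - K z) ` U)" using bounded_minus_comp[OF F(2) K(2)] .
  moreover have "(\<lambda>z. F z - K z) holomorphic_on U" using F(1) K(1) by (rule holomorphic_on_diff)
  ultimately show ?thesis unfolding H_infty_def by blast
qed

lemma disc_coord_half:
  assumes e: "e \<in> {1, -1}" and z: "z \<in> half e"
  shows "z - of_real e * \<i> \<noteq> 0" "norm (disc_coord e (Some z)) < 1"
proof -
  show n: "z - of_real e * \<i> \<noteq> 0" using e z by (auto simp: half_def complex_eq_iff)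
  have "(norm (z - of_real e * \<i>))\<^sup>2 - (norm (z + of_real e * \<i>))\<^sup>2 = - 4 * (e * Im z)"
    unfolding cmod_power2 by (simp add: power2_eq_square algebra_simps)
  then have "(norm (z + of_real e * \<i>))\<^sup>2 < (norm (z - of_real e * \<i>))\<^sup>2" using z by (simp add: half_def)
  then have "norm (z + of_real e * \<i>) < norm (z - of_real e * \<i>)" by (rule power2_less_imp_less) simp
  then show "norm (disc_coord e (Some z)) < 1" using n by (simp add: disc_coord_def norm_divide divide_less_eq)
qed

lemma disc_alg_H_infty:
  assumes e: "e \<in> {1, -1}" and f: "f \<in> disc_alg \<mu> e" shows "f \<in> H_infty (half e)"
proof -
  obtain F where F: "F \<in> disc_functions" "\<And>x. x \<in> Rdot \<Longrightarrow> f x = F (disc_coord e x)"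
    by (rule disc_algE[OF f]) (rule that; assumption)
  have cF: "continuous_on (cball 0 1) F" "F holomorphic_on ball 0 1" using F by (auto simp: disc_functions_def)
  let ?w = "\<lambda>z. (z + of_real e * \<i>) / (z - of_real e * \<i>)"
  have w: "norm (?w z) < 1" "z - of_real e * \<i> \<noteq> 0" if "z \<in> half e" for z
    using disc_coord_half[OF e that] by (auto simp: disc_coord_def)
  have "bounded (F ` cball 0 1)" using cF(1) by (intro compact_imp_bounded compact_continuous_image) auto
  then have "bounded ((\<lambda>z. F (?w z)) ` half e)" by (rule bounded_subset) (use w in \<open>force intro: less_imp_le\<close>)
  moreover have "(\<lambda>z. F (?w z)) holomorphic_on half e"
  proof (rule holomorphic_on_compose_gen[OF _ cF(2), unfolded o_def])
    show "?w holomorphic_on half e" using w by (auto intro!: holomorphic_intros)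
  qed (use w in auto)
  moreover have "((\<lambda>z. F (?w z)) \<longlongrightarrow> f (Some (complex_of_real x))) (at (complex_of_real x) within {z \<in> half e. \<bar>Re z - x\<bar> \<le> a * \<bar>Im z\<bar>})" for x a
  proof -
    let ?S = "{z \<in> half e. \<bar>Re z - x\<bar> \<le> a * \<bar>Im z\<bar>}"
    have xr: "Some (complex_of_real x) \<in> Rdot" by (simp add: Rdot_def)
    have "(?w \<longlongrightarrow> ?w (of_real x)) (at (complex_of_real x) within ?S)"
      using e by (intro tendsto_intros) (auto simp: complex_eq_iff)
    moreover have "\<forall>\<^sub>F z in at (complex_of_real x) within ?S. ?w z \<in> cball 0 1"
      using w by (auto simp: eventually_at_filter intro!: always_eventually less_imp_le)
    ultimately have "((\<lambda>z. F (?w z)) \<longlongrightarrow> F (?w (of_real x))) (at (complex_of_real x) within ?S)"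
      using norm_disc_coord[OF e xr] by (intro continuous_on_tendsto_compose[OF cF(1)]) (auto simp: disc_coord_def)
    then show ?thesis using F(2)[OF xr] by (simp add: disc_coord_def)
  qed
  ultimately show ?thesis unfolding H_infty_def by blast
qed

lemma disc_alg_both_const:
  assumes "f \<in> disc_alg \<mu> 1" "f \<in> disc_alg \<mu> (-1)" "0 < \<mu>"
  obtains c where "\<And>x. x \<in> Rdot \<Longrightarrow> f x = c"
proof -
  obtain c where "AE x in lborel. f (Some (complex_of_real x)) = c"
    using H_infty_both_halves_const disc_alg_H_infty assms by (metis insertCI)
  then show ?thesis using C_mu_AE_const[OF disc_alg_C_mu[OF assms(1)] assms(3)] that by blast
qed

text \<open>Splitting the function and subtracting the part that is already known to extend leaves a function
  that is bounded analytic on both sides, hence constant.\<close>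

lemma C_mu_half_eq_disc_alg:
  assumes \<mu>: "0 < \<mu>" "\<mu> < 1" and e: "e \<in> {1, -1}"
  shows "C_mu_half \<mu> (half e) = disc_alg \<mu> e"
proof (intro equalityI subsetI)
  fix f assume "f \<in> disc_alg \<mu> e"
  then show "f \<in> C_mu_half \<mu> (half e)" using disc_alg_H_infty[OF e] disc_alg_C_mu by (auto simp: C_mu_half_def)
next
  fix f assume "f \<in> C_mu_half \<mu> (half e)"
  then have f: "f \<in> C_mu \<mu>" "f \<in> H_infty (half e)" by (auto simp: C_mu_half_def)
  obtain H1 fm where H: "H1 \<in> disc_functions" "(\<lambda>x. H1 (cay x)) \<in> C_mu \<mu>" "fm \<in> disc_alg \<mu> 1" "\<And>x. x \<in> Rdot \<Longrightarrow> f x = H1 (cay x) + fm x"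
    by (rule C_mu_splitting[OF f(1) \<mu>]) (rule that; assumption)
  have fp: "(\<lambda>x. H1 (cay x)) \<in> disc_alg \<mu> (-1)" by (rule disc_algI[OF H(2,1)]) (simp add: disc_coord_upper)
  obtain g h where gh: "g \<in> disc_alg \<mu> e" "h \<in> disc_alg \<mu> (-e)" "\<And>x. x \<in> Rdot \<Longrightarrow> f x = g x + h x"
  proof (cases "e = 1")
    case True show ?thesis by (rule that[of fm "\<lambda>x. H1 (cay x)"]) (use True H fp in \<open>auto simp: add.commute\<close>)
  next
    case False show ?thesis by (rule that[of "\<lambda>x. H1 (cay x)" fm]) (use False H fp e in auto)
  qed
  have "(\<lambda>x. f x - g x) \<in> H_infty (half e)" using f(2) disc_alg_H_infty[OF e gh(1)] by (rule H_infty_diff)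
  moreover have "(\<lambda>x. f x - g x) \<in> disc_alg \<mu> (-e)" using gh by (intro disc_alg_cong[OF gh(2)]) auto
  then have "(\<lambda>x. f x - g x) \<in> H_infty (half (-e))" using e by (intro disc_alg_H_infty) auto
  ultimately have "(\<lambda>x. f x - g x) \<in> H_infty (half 1)" "(\<lambda>x. f x - g x) \<in> H_infty (half (-1))" using e by auto
  then obtain c where "AE x in lborel. f (Some (complex_of_real x)) - g (Some (complex_of_real x)) = c"
    by (rule H_infty_both_halves_const) (rule that; assumption)
  then have "f x - g x = c" if "x \<in> Rdot" for x
    using C_mu_AE_const[OF C_mu_diff[OF f(1) disc_alg_C_mu[OF gh(1)]] \<mu>(1) _ that] by simp
  then show "f \<in> disc_alg \<mu> e"
    by (intro disc_alg_cong[OF disc_alg_add[OF gh(1) disc_alg_const[of c]]]) (metis add.commute diff_add_cancel)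
qed

section \<open>Functions on the two halves of the elliptic surface\<close>

definition pole_poly :: "real \<Rightarrow> real \<Rightarrow> complex \<Rightarrow> complex" where
  "pole_poly k0 e \<xi> = (\<xi> - of_real e * \<i>) * (\<xi> - of_real e * \<i> * of_real k0)"

text \<open>The coordinate \<open>\<tau> / p\<^sub>2\<close> (for \<open>e = 1\<close>) or \<open>\<tau> / p\<^sub>1\<close> (for \<open>e = -1\<close>), which is finite over the
  closure of \<open>half e\<close>.\<close>

definition t_coord :: "real \<Rightarrow> real \<Rightarrow> surf_point \<Rightarrow> complex" where
  "t_coord k0 e P = (case P of Pt \<xi> \<tau> \<Rightarrow> \<tau> / pole_poly k0 e \<xi> | At_inf \<sigma> \<Rightarrow> \<sigma>)"

definition t_line :: "real \<Rightarrow> real \<Rightarrow> complex option \<Rightarrow> complex" where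
  "t_line k0 e x = t_coord k0 e (Gam_lift k0 1 x)"

definition branch_zero :: "real \<Rightarrow> real" where
  "branch_zero k0 = (k0 - 1) / (k0 + 1)"

text \<open>The square of the coordinate \<open>t_coord\<close> as a function of the coordinate of the disc; its
  zeros are the branch points over \<open>half e\<close>.\<close>

definition blaschke :: "real \<Rightarrow> complex \<Rightarrow> complex" where
  "blaschke k0 w = w * (w - of_real (branch_zero k0)) / (1 - of_real (branch_zero k0) * w)"

lemma of_real_k0_neq: "k0 > 1 \<Longrightarrow> 1 + complex_of_real k0 \<noteq> 0" "k0 > 1 \<Longrightarrow> complex_of_real k0 + 1 \<noteq> 0" "k0 > 1 \<Longrightarrow> complex_of_real k0 \<noteq> -1"
  by (auto simp: complex_eq_iff)

lemma branch_zero_bounds: "k0 > 1 \<Longrightarrow> 0 < branch_zero k0 \<and> branch_zero k0 < 1"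
  by (simp add: branch_zero_def)

lemma blaschke_denominator:
  fixes w :: complex
  assumes "k0 > 1" "norm w \<le> 1" shows "1 - of_real (branch_zero k0) * w \<noteq> 0"
proof
  assume "1 - of_real (branch_zero k0) * w = 0"
  then have "norm (of_real (branch_zero k0) * w) = 1" by simp
  moreover have "norm (of_real (branch_zero k0) * w) \<le> branch_zero k0"
    using branch_zero_bounds[OF assms(1)] assms(2) by (simp add: norm_mult mult_left_le)
  ultimately show False using branch_zero_bounds[OF assms(1)] by simp
qed

lemma blaschke_continuous: "k0 > 1 \<Longrightarrow> continuous_on (cball 0 1) (blaschke k0)"
  unfolding blaschke_def using blaschke_denominator by (intro continuous_intros) auto

lemma blaschke_holomorphic: "k0 > 1 \<Longrightarrow> blaschke k0 holomorphic_on ball 0 1"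
  unfolding blaschke_def using blaschke_denominator by (intro holomorphic_intros) auto

lemma blaschke_zero_iff:
  "k0 > 1 \<Longrightarrow> norm w \<le> 1 \<Longrightarrow> blaschke k0 w = 0 \<longleftrightarrow> w = 0 \<or> w = of_real (branch_zero k0)"
  using blaschke_denominator by (auto simp: blaschke_def)

lemma norm_blaschke:
  assumes "k0 > 1" "norm w = 1" shows "norm (blaschke k0 w) = 1"
proof -
  let ?a = "complex_of_real (branch_zero k0)"
  have "w \<noteq> 0" using assms by auto
  have "w * cnj w = 1" using assms(2) by (metis complex_norm_square of_real_1 power_one)
  then have "w - ?a = w * cnj (1 - ?a * w)" by (simp add: algebra_simps)
  then have "norm (w - ?a) = norm (1 - ?a * w)" using assms(2) by (metis complex_mod_cnj mult_1 norm_mult)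
  then show ?thesis using blaschke_denominator[OF assms(1), of w] assms by (simp add: blaschke_def norm_divide norm_mult)
qed


subsection \<open>The coordinates on the curves over the line\<close>

lemma pole_poly_nonzero_Rdot: "k0 > 1 \<Longrightarrow> e \<in> {1, -1} \<Longrightarrow> pole_poly k0 e (complex_of_real x) \<noteq> 0"
  unfolding pole_poly_def mult_eq_0_iff by (auto simp: complex_eq_iff)

lemma pole_poly_mult: "e \<in> {1, -1} \<Longrightarrow> pole_poly k0 e \<xi> * pole_poly k0 (-e) \<xi> = p_poly k0 \<xi>"
  by (auto simp: pole_poly_def p_poly_def algebra_simps power2_eq_square)

lemma t_coord_lift: "t_coord k0 e (Gam_lift k0 \<sigma> x) = \<sigma> * t_line k0 e x"
  by (auto simp: t_coord_def t_line_def Gam_lift_def split: option.split)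

definition tau_line :: "real \<Rightarrow> real \<Rightarrow> real" where
  "tau_line k0 x = sqrt ((1 + x\<^sup>2) * (k0\<^sup>2 + x\<^sup>2))"

lemma tau_line_pos: "k0 > 1 \<Longrightarrow> tau_line k0 x > 0"
  unfolding tau_line_def by (intro real_sqrt_gt_zero mult_pos_pos add_pos_nonneg) auto

lemma tau_line_square: "(complex_of_real (tau_line k0 x))\<^sup>2 = p_poly k0 (of_real x)"
  by (simp add: tau_line_def p_poly_def flip: of_real_power)

lemma t_line_Some: "t_line k0 e (Some (complex_of_real x)) = of_real (tau_line k0 x) / pole_poly k0 e (of_real x)"
  by (simp add: t_line_def t_coord_def Gam_lift_def tau_line_def)

lemma t_line_None: "t_line k0 e None = 1"
  by (simp add: t_line_def t_coord_def Gam_lift_def)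

lemma Rdot_cases:
  assumes "x \<in> Rdot" obtains "x = None" | r where "x = Some (complex_of_real r)"
  using assms by (auto simp: Rdot_def)

lemma t_line_mult:
  assumes "k0 > 1" "e \<in> {1, -1}" "x \<in> Rdot" shows "t_line k0 e x * t_line k0 (-e) x = 1"
  using assms(3)
proof (cases rule: Rdot_cases)
  case (2 r)
  have "pole_poly k0 e (of_real r) * pole_poly k0 (-e) (of_real r) = (complex_of_real (tau_line k0 r))\<^sup>2"
    using pole_poly_mult[OF assms(2)] tau_line_square by metis
  moreover have "tau_line k0 r \<noteq> 0" using tau_line_pos[OF assms(1), of r] by simp
  ultimately show ?thesis by (simp add: 2 t_line_Some power2_eq_square)
qed (simp add: t_line_None)

lemma disc_coord_affine:
  assumes "k0 > 1" "e \<in> {1, -1}" "\<xi> - of_real e * \<i> \<noteq> 0" "\<xi> - of_real e * \<i> * of_real k0 \<noteq> 0"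
  shows "blaschke k0 (disc_coord e (Some \<xi>)) = pole_poly k0 (-e) \<xi> / pole_poly k0 e \<xi>"
proof -
  note k = of_real_k0_neq[OF assms(1)]
  have e2: "(of_real e * \<i>)^2 = (-1::complex)" using assms(2) by auto
  define j where "j = of_real e * \<i>"
  have j: "\<xi> - j \<noteq> 0" "\<xi> - j * of_real k0 \<noteq> 0" "j \<noteq> 0" using assms by (auto simp: j_def)
  define w where "w = (\<xi> + j) / (\<xi> - j)"
  define c where "c = 2 / ((of_real k0 + 1) * (\<xi> - j))"
  have c: "c \<noteq> 0" using j k by (simp add: c_def)
  have w1: "w - of_real (branch_zero k0) = c * (\<xi> + j * of_real k0)"
    using j k by (simp add: w_def c_def branch_zero_def divide_simps) (simp add: algebra_simps)
  have w2: "1 - of_real (branch_zero k0) * w = c * (\<xi> - j * of_real k0)"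
    using j k by (simp add: w_def c_def branch_zero_def divide_simps) (simp add: algebra_simps)
  have "blaschke k0 w = (\<xi> + j) / (\<xi> - j) * ((\<xi> + j * of_real k0) / (\<xi> - j * of_real k0))"
    unfolding blaschke_def w1 w2 using c by (simp add: w_def)
  then show ?thesis by (simp add: disc_coord_def pole_poly_def w_def j_def)
qed

lemma t_line_square:
  assumes "k0 > 1" "e \<in> {1, -1}" "x \<in> Rdot" shows "(t_line k0 e x)\<^sup>2 = blaschke k0 (disc_coord e x)"
  using assms(3)
proof (cases rule: Rdot_cases)
  case 1
  have "1 - complex_of_real (branch_zero k0) \<noteq> 0" using branch_zero_bounds[OF assms(1)] by simp
  then show ?thesis by (simp add: 1 t_line_None blaschke_def disc_coord_def)
next
  case (2 r)
  have n: "pole_poly k0 e (of_real r) \<noteq> 0" by (rule pole_poly_nonzero_Rdot[OF assms(1,2)])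
  then have n': "complex_of_real r - of_real e * \<i> \<noteq> 0" "complex_of_real r - of_real e * \<i> * of_real k0 \<noteq> 0"
    by (auto simp: pole_poly_def)
  have "(t_line k0 e x)\<^sup>2 = p_poly k0 (of_real r) / (pole_poly k0 e (of_real r))\<^sup>2"
    by (simp add: 2 t_line_Some power_divide tau_line_square)
  also have "\<dots> = pole_poly k0 (-e) (of_real r) / pole_poly k0 e (of_real r)"
    using n by (simp add: power2_eq_square flip: pole_poly_mult[OF assms(2)])
  finally show ?thesis by (simp add: 2 disc_coord_affine[OF assms(1,2) n'])
qed

lemma norm_t_line: "k0 > 1 \<Longrightarrow> e \<in> {1, -1} \<Longrightarrow> x \<in> Rdot \<Longrightarrow> norm (t_line k0 e x) = 1"
  using norm_blaschke[of k0 "disc_coord e x"] norm_disc_coord[of e x] t_line_square[of k0 e x]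
  by (metis norm_ge_zero norm_power power2_eq_1_iff abs_of_nonneg abs_minus_cancel abs_one)

lemma q_fun_t_line: "k0 > 1 \<Longrightarrow> x \<in> Rdot \<Longrightarrow> q_fun k0 x = (t_line k0 1 x)\<^sup>2"
proof (cases rule: Rdot_cases[of x])
  fix r assume k: "k0 > 1" and x: "x = Some (complex_of_real r)"
  have n: "pole_poly k0 1 (of_real r) \<noteq> 0" using pole_poly_nonzero_Rdot[OF k] by simp
  have "(t_line k0 1 x)\<^sup>2 = p_poly k0 (of_real r) / (pole_poly k0 1 (of_real r))\<^sup>2"
    by (simp add: x t_line_Some power_divide tau_line_square)
  also have "\<dots> = pole_poly k0 (-1) (of_real r) / pole_poly k0 1 (of_real r)"
    using n by (simp add: power2_eq_square flip: pole_poly_mult[of 1])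
  finally show ?thesis by (simp add: x q_fun_def p1_def p2_def pole_poly_def)
qed (simp_all add: q_fun_def t_line_None)

lemma tau_over_p2_t_coord: "tau_over_p2 k0 P = t_coord k0 1 P"
  by (simp add: tau_over_p2_def t_coord_def p2_def pole_poly_def split: surf_point.split)

lemma r0_lift: "k0 > 1 \<Longrightarrow> x \<in> Rdot \<Longrightarrow> r0 k0 (Gam_lift k0 \<sigma> x) = \<sigma> * (cay x * t_line k0 1 x)"
proof (cases rule: Rdot_cases[of x])
  fix r assume k: "k0 > 1" and x: "x = Some (complex_of_real r)"
  have "complex_of_real r - \<i> \<noteq> 0" by (simp add: complex_eq_iff)
  then show ?thesis by (simp add: x r0_def Gam_lift_def t_line_Some cay_def pole_poly_def tau_line_def)
qed (simp_all add: r0_def Gam_lift_def t_line_None cay_def)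

text \<open>The function \<open>cay \<sqdot> t_line\<close> is a square root of a rational function without zeros and poles on the
  circle, and its real part is bounded below, so it inherits the Hoelder condition from its
  square.\<close>

lemma t_line_C_mu:
  assumes k: "k0 > 1" and e: "e \<in> {1, -1}" and \<mu>: "0 < \<mu>" "\<mu> \<le> 1"
  shows "t_line k0 e \<in> C_mu \<mu>"
proof -
  let ?R = "\<lambda>x. cay x * t_line k0 1 x"
  define c where "c = 2 * k0 / (1 + k0\<^sup>2)"
  have c: "0 < c" "c \<le> 1" using k sum_squares_bound[of 1 k0] by (auto simp: c_def add_pos_nonneg divide_le_eq)
  have ReR: "Re (?R x) \<ge> c" if "x \<in> Rdot" for x
    using that
  proof (cases rule: Rdot_cases)
    case 1 then show ?thesis using c by (simp add: cay_def t_line_None)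
  next
    case (2 r)
    define z where "z = (complex_of_real r + \<i>) * (complex_of_real r - \<i> * of_real k0)"
    have tp: "tau_line k0 r > 0" by (rule tau_line_pos[OF k])
    have t2: "(tau_line k0 r)\<^sup>2 = (1 + r\<^sup>2) * (k0\<^sup>2 + r\<^sup>2)" by (simp add: tau_line_def)
    have nz: "(norm z)\<^sup>2 = (tau_line k0 r)\<^sup>2"
      unfolding t2 z_def norm_mult power_mult_distrib cmod_power2 by (simp add: algebra_simps)
    have "complex_of_real r - \<i> \<noteq> 0" by (simp add: complex_eq_iff)
    then have "?R x = of_real (tau_line k0 r) / z" by (simp add: 2 z_def t_line_Some cay_def pole_poly_def mult.commute mult.left_commute)
    then have "Re (?R x) = tau_line k0 r * Re z / (norm z)\<^sup>2" by (simp add: Re_divide cmod_power2)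
    also have "\<dots> = Re z / tau_line k0 r" unfolding nz using tp by (simp add: power2_eq_square)
    also have "Re z = r\<^sup>2 + k0" by (simp add: z_def power2_eq_square)
    finally have R: "Re (?R x) = (r\<^sup>2 + k0) / tau_line k0 r" .
    have "2 * tau_line k0 r \<le> (1 + r\<^sup>2) + (k0\<^sup>2 + r\<^sup>2)"
      unfolding tau_line_def using arith_geo_mean_sqrt[of "1 + r\<^sup>2" "k0\<^sup>2 + r\<^sup>2"] by simp
    then have "c * (2 * tau_line k0 r) \<le> c * (1 + k0\<^sup>2 + 2 * r\<^sup>2)" using c by (intro mult_left_mono) auto
    also have "\<dots> = 2 * k0 + 2 * c * r\<^sup>2"
    proof -
      have "c * (1 + k0\<^sup>2) = 2 * k0" unfolding c_def using k by (simp add: add_pos_nonneg less_imp_neq[symmetric])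
      then show ?thesis by (simp add: algebra_simps)
    qed
    also have "\<dots> \<le> 2 * (r\<^sup>2 + k0)" using mult_right_mono[OF c(2), of "r\<^sup>2"] by simp
    finally show ?thesis unfolding R using tp by (simp add: le_divide_eq)
  qed
  have sq: "(\<lambda>x. (?R x)\<^sup>2) \<in> C_mu \<mu>"
  proof -
    let ?a = "complex_of_real (branch_zero k0)"
    have bz: "0 < branch_zero k0" "branch_zero k0 < 1" using branch_zero_bounds[OF k] by auto
    have lb: "norm (cay x - ?a) \<ge> 1 - branch_zero k0" if "x \<in> Rdot" for x
      using norm_triangle_ineq2[of "cay x" ?a] norm_cay[OF that] bz by simp
    have "(\<lambda>x. cay x * (1 - ?a * cay x) * (1 / (cay x - ?a))) \<in> C_mu \<mu>"
      using \<mu> bz lb by (intro C_mu_mult C_mu_diff C_mu_inverse[where c="1 - branch_zero k0"] C_mu_cay C_mu_const) auto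
    then show ?thesis
    proof (rule C_mu_cong)
      fix x assume x: "x \<in> Rdot"
      have n: "cay x - ?a \<noteq> 0" using lb[OF x] bz by auto
      have c0: "cay x \<noteq> 0" by (rule cay_nonzero[OF x])
      have "1 - ?a * (1 / cay x) = (cay x - ?a) / cay x" "1 / cay x - ?a = (1 - ?a * cay x) / cay x"
        using c0 by (simp_all add: diff_divide_distrib)
      then have "blaschke k0 (1 / cay x) = (1 - ?a * cay x) / (cay x * (cay x - ?a))"
        unfolding blaschke_def using c0 by simp
      then have "(?R x)\<^sup>2 = (cay x)\<^sup>2 * ((1 - ?a * cay x) / (cay x * (cay x - ?a)))"
        using t_line_square[OF k _ x, of 1] by (simp add: power_mult_distrib disc_coord_lower)
      then show "(?R x)\<^sup>2 = cay x * (1 - ?a * cay x) * (1 / (cay x - ?a))"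
        using c0 by (simp add: power2_eq_square)
    qed
  qed
  have R: "?R \<in> C_mu \<mu>"
  proof (rule C_mu_Lipschitz[OF sq])
    fix x y assume xy: "x \<in> Rdot" "y \<in> Rdot"
    have "2 * c \<le> Re (?R x + ?R y)" using ReR[OF xy(1)] ReR[OF xy(2)] by simp
    also have "\<dots> \<le> norm (?R x + ?R y)" by (rule complex_Re_le_cmod)
    finally have "norm (?R x - ?R y) * (2 * c) \<le> norm (?R x - ?R y) * norm (?R x + ?R y)" by (intro mult_left_mono) auto
    also have "\<dots> = norm ((?R x)\<^sup>2 - (?R y)\<^sup>2)"
      by (simp only: norm_mult[symmetric] power2_eq_square square_diff_square_factored) (simp only: mult.commute)
    finally show "norm (?R x - ?R y) \<le> (1 / (2 * c)) * norm ((?R x)\<^sup>2 - (?R y)\<^sup>2)" using c by (simp add: field_simps)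
  qed (use c in simp)
  have "(\<lambda>x. disc_coord 1 x * ?R x) \<in> C_mu \<mu>" using \<mu> by (intro C_mu_mult disc_coord_C_mu R) auto
  then have t1: "t_line k0 1 \<in> C_mu \<mu>"
    by (rule C_mu_cong) (simp add: disc_coord_lower cay_nonzero)
  then have "(\<lambda>x. 1 / t_line k0 1 x) \<in> C_mu \<mu>" using norm_t_line[OF k, of 1] by (intro C_mu_inverse[where c=1]) auto
  then have "t_line k0 (-1) \<in> C_mu \<mu>"
    by (rule C_mu_cong) (use t_line_mult[OF k, of 1] in \<open>auto simp: field_simps eq_divide_eq, force\<close>)
  then show ?thesis using t1 e by auto
qed


subsection \<open>A parametrization of the closed half surface\<close>

definition surf_pt :: "real \<Rightarrow> real \<Rightarrow> complex \<Rightarrow> complex \<Rightarrow> surf_point" where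
  "surf_pt k0 e w t = (if w = 1 then At_inf t else
     (let \<xi> = of_real e * \<i> * (w + 1) / (w - 1) in Pt \<xi> (t * pole_poly k0 e \<xi>)))"

lemma surf_pt_disc_coord:
  assumes "e \<in> {1, -1}" "\<xi> - of_real e * \<i> \<noteq> 0" "pole_poly k0 e \<xi> \<noteq> 0"
  shows "surf_pt k0 e (disc_coord e (Some \<xi>)) (\<tau> / pole_poly k0 e \<xi>) = Pt \<xi> \<tau>"
proof -
  define j where "j = of_real e * \<i>"
  have j: "j \<noteq> 0" "\<xi> - j \<noteq> 0" using assms by (auto simp: j_def)
  define w where "w = (\<xi> + j) / (\<xi> - j)"
  have w1: "w - 1 = 2 * j / (\<xi> - j)" "w + 1 = 2 * \<xi> / (\<xi> - j)" using j by (simp_all add: w_def field_simps)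
  have "w \<noteq> 1" using w1(1) j by auto
  moreover have "j * (w + 1) / (w - 1) = \<xi>" unfolding w1 using j by simp
  ultimately show ?thesis using assms(3) by (simp add: surf_pt_def disc_coord_def w_def[symmetric] j_def[symmetric])
qed

lemma surf_pt_lift:
  assumes k: "k0 > 1" and e: "e \<in> {1, -1}" and x: "x \<in> Rdot"
  shows "surf_pt k0 e (disc_coord e x) (\<sigma> * t_line k0 e x) = Gam_lift k0 \<sigma> x"
  using x
proof (cases rule: Rdot_cases)
  case 1 then show ?thesis by (simp add: surf_pt_def disc_coord_def t_line_None Gam_lift_def)
next
  case (2 r)
  have n: "pole_poly k0 e (of_real r) \<noteq> 0" by (rule pole_poly_nonzero_Rdot[OF k e])
  then have "complex_of_real r - of_real e * \<i> \<noteq> 0" by (auto simp: pole_poly_def)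
  from surf_pt_disc_coord[OF e this n, of "\<sigma> * of_real (tau_line k0 r)"]
  show ?thesis by (simp add: 2 t_line_Some Gam_lift_def tau_line_def)
qed

lemma surf_pt_pole_poly:
  assumes "e \<in> {1, -1}" "w \<noteq> 1" "k0 > 1"
  shows "pole_poly k0 e (of_real e * \<i> * (w + 1) / (w - 1)) = - 2 * (1 + of_real k0) * (1 - of_real (branch_zero k0) * w) / (w - 1)\<^sup>2"
proof -
  note k = of_real_k0_neq[OF assms(3)]
  define j where "j = of_real e * \<i>"
  have j2: "j * j = -1" using assms(1) by (auto simp: j_def)
  have w: "w - 1 \<noteq> 0" using assms by simp
  have 1: "j * (w + 1) / (w - 1) - j = 2 * j / (w - 1)" using w by (simp add: field_simps)
  have 2: "j * (w + 1) / (w - 1) - j * of_real k0 = j * (1 + of_real k0) * (1 - of_real (branch_zero k0) * w) / (w - 1)"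
    using w k by (simp add: branch_zero_def divide_simps) (simp add: algebra_simps)
  have "pole_poly k0 e (j * (w + 1) / (w - 1)) = 2 * j / (w - 1) * (j * (1 + of_real k0) * (1 - of_real (branch_zero k0) * w) / (w - 1))"
    unfolding pole_poly_def j_def[symmetric] 1 2 ..
  also have "\<dots> = 2 * (j * j) * (1 + of_real k0) * (1 - of_real (branch_zero k0) * w) / (w - 1)\<^sup>2"
    by (simp add: power2_eq_square)
  finally have "pole_poly k0 e (j * (w + 1) / (w - 1)) = 2 * (-1) * (1 + of_real k0) * (1 - of_real (branch_zero k0) * w) / (w - 1)\<^sup>2"
    by (simp only: j2)
  then show ?thesis by (simp add: j_def)
qed

lemma surf_pt_half:
  assumes "e \<in> {1, -1}" "w \<noteq> 1"
  shows "e * Im (of_real e * \<i> * (w + 1) / (w - 1)) = ((norm w)\<^sup>2 - 1) / (norm (w - 1))\<^sup>2"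
proof -
  have "of_real e * \<i> * (w + 1) / (w - 1) = of_real e * (\<i> * ((w + 1) / (w - 1)))" by simp
  then have "e * Im (of_real e * \<i> * (w + 1) / (w - 1)) = e * (e * Re ((w + 1) / (w - 1)))"
    by (simp del: times_divide_eq_right)
  also have "\<dots> = Re ((w + 1) / (w - 1))" using assms(1) by auto
  also have "\<dots> = Re ((w + 1) * cnj (w - 1)) / (norm (w - 1))\<^sup>2"
    by (subst complex_div_cnj) (simp add: Re_divide_of_real)
  also have "Re ((w + 1) * cnj (w - 1)) = (norm w)\<^sup>2 - 1"
    unfolding cmod_power2 by (simp add: power2_eq_square algebra_simps)
  finally show ?thesis .
qed

lemma surf_pt_curve:
  assumes k: "k0 > 1" and e: "e \<in> {1, -1}" and w: "w \<noteq> 1" "norm w \<le> 1" and t: "t\<^sup>2 = blaschke k0 w"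
    and \<xi>: "\<xi> = of_real e * \<i> * (w + 1) / (w - 1)"
  shows "(t * pole_poly k0 e \<xi>)\<^sup>2 = p_poly k0 \<xi>"
proof -
  have n: "\<xi> - of_real e * \<i> = 2 * (of_real e * \<i>) / (w - 1)" unfolding \<xi> using w by (simp add: field_simps)
  then have n1: "\<xi> - of_real e * \<i> \<noteq> 0" using e w by auto
  note k1 = of_real_k0_neq[OF k]
  have P: "pole_poly k0 e \<xi> \<noteq> 0"
    unfolding \<xi> surf_pt_pole_poly[OF e w(1) k] using blaschke_denominator[OF k w(2)] w k1 by simp
  then have n2: "\<xi> - of_real e * \<i> * of_real k0 \<noteq> 0" by (auto simp: pole_poly_def)
  have "\<xi> + of_real e * \<i> = 2 * (of_real e * \<i>) * w / (w - 1)" unfolding \<xi> using w by (simp add: field_simps)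
  then have dc: "disc_coord e (Some \<xi>) = w" using n1 n w e by (auto simp: disc_coord_def)
  have "t\<^sup>2 = pole_poly k0 (-e) \<xi> / pole_poly k0 e \<xi>" using disc_coord_affine[OF k e n1 n2] t by (simp add: dc)
  then have "(t * pole_poly k0 e \<xi>)\<^sup>2 = (pole_poly k0 (-e) \<xi> / pole_poly k0 e \<xi>) * (pole_poly k0 e \<xi>)\<^sup>2"
    by (simp only: power_mult_distrib)
  also have "\<dots> = pole_poly k0 (-e) \<xi> * pole_poly k0 e \<xi>" using P by (simp add: power2_eq_square)
  finally have "(t * pole_poly k0 e \<xi>)\<^sup>2 = pole_poly k0 (-e) \<xi> * pole_poly k0 e \<xi>" .
  then show ?thesis using pole_poly_mult[OF e] by (simp add: mult.commute)
qed

lemma surf_pt_mem: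
  assumes k: "k0 > 1" and e: "e \<in> {1, -1}" and w: "norm w \<le> 1" and t: "t\<^sup>2 = blaschke k0 w"
  shows "surf_pt k0 e w t \<in> Sig_half k0 (half e) \<union> Gam k0"
    and "norm w < 1 \<Longrightarrow> surf_pt k0 e w t \<in> Sig_half k0 (half e)"
proof -
  define \<xi> where "\<xi> = of_real e * \<i> * (w + 1) / (w - 1)"
  have in_half: "surf_pt k0 e w t \<in> Sig_half k0 (half e)" if w1: "norm w < 1"
  proof -
    have n: "w \<noteq> 1" using w1 by auto
    have "norm w * norm w < 1 * 1" using w1 by (intro mult_strict_mono') auto
    then have "e * Im \<xi> < 0" unfolding \<xi>_def surf_pt_half[OF e n] using n
      by (intro divide_neg_pos) (auto simp: power2_eq_square)
    then show ?thesis using surf_pt_curve[OF k e n w t \<xi>_def] n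
      by (auto simp: Sig_half_def Sig_def Proj_def surf_pt_def half_def \<xi>_def[symmetric])
  qed
  then show "norm w < 1 \<Longrightarrow> surf_pt k0 e w t \<in> Sig_half k0 (half e)" .
  have "surf_pt k0 e w t \<in> Gam k0" if w1: "norm w = 1"
  proof (cases "w = 1")
    case True
    have "1 - complex_of_real (branch_zero k0) \<noteq> 0" using branch_zero_bounds[OF k] by simp
    then have "t\<^sup>2 = 1" using t True by (simp add: blaschke_def)
    then have "t = 1 \<or> t = -1" by (simp add: power2_eq_1_iff)
    then show ?thesis using True by (auto simp: surf_pt_def Gam_def Sig_def Proj_def Rdot_def)
  next
    case False
    have "e * Im \<xi> = 0" unfolding \<xi>_def surf_pt_half[OF e False] using w1 by simp
    then have "\<xi> = of_real (Re \<xi>)" using e by (auto simp: complex_eq_iff)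
    then have "Some \<xi> \<in> Rdot" unfolding Rdot_def by blast
    then show ?thesis using surf_pt_curve[OF k e False w t \<xi>_def] False
      by (auto simp: Gam_def Sig_def Proj_def surf_pt_def \<xi>_def[symmetric])
  qed
  with in_half w show "surf_pt k0 e w t \<in> Sig_half k0 (half e) \<union> Gam k0" by (cases "norm w = 1") auto
qed

definition disc_curve :: "real \<Rightarrow> (complex \<times> complex) set" where
  "disc_curve k0 = {(w, t). norm w \<le> 1 \<and> t\<^sup>2 = blaschke k0 w}"

lemma surf_pt_continuous:
  assumes k: "k0 > 1" and e: "e \<in> {1, -1}"
    and F: "surf_continuous_on (Sig_half k0 (half e) \<union> Gam k0) F"
  shows "continuous_on (disc_curve k0) (\<lambda>(w, t). F (surf_pt k0 e w t))"
proof -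
  let ?S = "Sig_half k0 (half e) \<union> Gam k0"
  let ?f = "\<lambda>(w, t). F (surf_pt k0 e w t)"
  let ?A = "disc_curve k0 \<inter> {p. fst p \<noteq> 1}" and ?B = "disc_curve k0 \<inter> {p. fst p \<noteq> -1}"
  let ?\<xi> = "\<lambda>p. of_real e * \<i> * (fst p + 1) / (fst p - 1)"
  let ?\<zeta> = "\<lambda>p. (fst p - 1) / (of_real e * \<i> * (fst p + 1))"
  have cf: "continuous_on (chart_fin -` ?S) (F \<circ> chart_fin)" "continuous_on (chart_inf -` ?S) (F \<circ> chart_inf)"
    using F by (auto simp: surf_continuous_on_def)
  have mem: "surf_pt k0 e (fst p) (snd p) \<in> ?S" if "p \<in> disc_curve k0" for p
    using surf_pt_mem(1)[OF k e, of "fst p" "snd p"] that unfolding disc_curve_def by (cases p) simp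
  have A: "continuous_on ?A ?f"
  proof -
    have eq: "chart_fin (?\<xi> p, snd p * pole_poly k0 e (?\<xi> p)) = surf_pt k0 e (fst p) (snd p)" if "p \<in> ?A" for p
      using that by (auto simp: chart_fin_def surf_pt_def Let_def)
    have "continuous_on ?A ((F \<circ> chart_fin) \<circ> (\<lambda>p. (?\<xi> p, snd p * pole_poly k0 e (?\<xi> p))))"
    proof (rule continuous_on_compose[OF _ continuous_on_subset[OF cf(1)]])
      show "continuous_on ?A (\<lambda>p. (?\<xi> p, snd p * pole_poly k0 e (?\<xi> p)))"
        unfolding pole_poly_def by (intro continuous_intros) auto
      show "(\<lambda>p. (?\<xi> p, snd p * pole_poly k0 e (?\<xi> p))) ` ?A \<subseteq> chart_fin -` ?S"
      proof (rule image_subsetI)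
        fix p assume p: "p \<in> ?A"
        then show "(?\<xi> p, snd p * pole_poly k0 e (?\<xi> p)) \<in> chart_fin -` ?S" unfolding vimage_def mem_Collect_eq eq[OF p] by (intro mem) simp
      qed
    qed
    then show ?thesis
    proof (rule continuous_on_eq)
      fix p assume "p \<in> ?A"
      from eq[OF this] show "((F \<circ> chart_fin) \<circ> (\<lambda>p. (?\<xi> p, snd p * pole_poly k0 e (?\<xi> p)))) p = ?f p"
        by (simp only: o_def case_prod_beta)
    qed
  qed
  have B: "continuous_on ?B ?f"
  proof -
    let ?\<omega> = "\<lambda>p. snd p * ((1 - of_real e * \<i> * ?\<zeta> p) * (1 - of_real e * \<i> * of_real k0 * ?\<zeta> p))"
    have eq: "chart_inf (?\<zeta> p, ?\<omega> p) = surf_pt k0 e (fst p) (snd p)" if p: "p \<in> ?B" for p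
    proof (cases "fst p = 1")
      case True then show ?thesis by (simp add: chart_inf_def surf_pt_def)
    next
      case False
      define w t where "w = fst p" and "t = snd p"
      define j where "j = of_real e * \<i>"
      have j: "j \<noteq> 0" using e by (auto simp: j_def)
      define z where "z = (w - 1) / (j * (w + 1))"
      have "w + 1 \<noteq> 0" using p by (auto simp: w_def add_eq_0_iff2)
      then have z: "z \<noteq> 0" "1 / z = j * (w + 1) / (w - 1)" using False j by (auto simp: z_def w_def)
      have "1 / z - j = (1 - j * z) / z" "1 / z - j * of_real k0 = (1 - j * of_real k0 * z) / z"
        using z by (simp_all add: diff_divide_distrib)
      then have "pole_poly k0 e (1 / z) = (1 - j * z) / z * ((1 - j * of_real k0 * z) / z)"
        unfolding pole_poly_def j_def[symmetric] by simp
      then have tz: "t * pole_poly k0 e (1 / z) = t * ((1 - j * z) * (1 - j * of_real k0 * z)) / z\<^sup>2"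
        by (simp add: power2_eq_square)
      have "surf_pt k0 e w t = Pt (1 / z) (t * pole_poly k0 e (1 / z))"
        using False unfolding surf_pt_def Let_def z(2) by (simp add: w_def j_def)
      moreover have "chart_inf (z, t * ((1 - j * z) * (1 - j * of_real k0 * z))) = Pt (1 / z) (t * ((1 - j * z) * (1 - j * of_real k0 * z)) / z\<^sup>2)"
        using z(1) by (simp add: chart_inf_def)
      ultimately show ?thesis unfolding tz by (simp only: w_def t_def z_def j_def)
    qed
    have "continuous_on ?B ((F \<circ> chart_inf) \<circ> (\<lambda>p. (?\<zeta> p, ?\<omega> p)))"
    proof (rule continuous_on_compose[OF _ continuous_on_subset[OF cf(2)]])
      show "continuous_on ?B (\<lambda>p. (?\<zeta> p, ?\<omega> p))"
        using e by (intro continuous_intros) (auto simp: add_eq_0_iff2)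
      show "(\<lambda>p. (?\<zeta> p, ?\<omega> p)) ` ?B \<subseteq> chart_inf -` ?S"
      proof (rule image_subsetI)
        fix p assume p: "p \<in> ?B"
        then show "(?\<zeta> p, ?\<omega> p) \<in> chart_inf -` ?S" unfolding vimage_def mem_Collect_eq eq[OF p] by (intro mem) simp
      qed
    qed
    then show ?thesis
    proof (rule continuous_on_eq)
      fix p assume "p \<in> ?B"
      from eq[OF this] show "((F \<circ> chart_inf) \<circ> (\<lambda>p. (?\<zeta> p, ?\<omega> p))) p = ?f p"
        by (simp only: o_def case_prod_beta)
    qed
  qed
  have U: "?A \<union> ?B = disc_curve k0" by auto
  have o: "open {p::complex \<times> complex. fst p \<noteq> c}" for c
    by (intro open_Collect_neq continuous_intros)
  have "openin (top_of_set (?A \<union> ?B)) ?A" "openin (top_of_set (?A \<union> ?B)) ?B"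
    unfolding U by (auto intro!: openin_open_Int o)
  from continuous_on_Un_local_open[OF this A B] show ?thesis unfolding U .
qed

text \<open>At a point that is not a branch point, an analytic function is analytic in any continuous
  local branch of \<open>t\<close>, because \<open>\<xi>\<close> is a local coordinate there.\<close>

lemma surf_analytic_branch:
  assumes k: "k0 > 1" and e: "e \<in> {1, -1}"
    and F: "surf_analytic_on k0 (Sig_half k0 (half e)) F"
    and V: "open V" "w1 \<in> V" "V \<subseteq> ball 0 1" and s: "continuous_on V s" "\<And>w. w \<in> V \<Longrightarrow> (s w)\<^sup>2 = blaschke k0 w"
    and nz: "blaschke k0 w1 \<noteq> 0"
  shows "(\<lambda>w. F (surf_pt k0 e w (s w))) field_differentiable at w1"
proof -
  let ?\<xi> = "\<lambda>w. of_real e * \<i> * (w + 1) / (w - 1)"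
  define \<xi>1 \<tau>1 where "\<xi>1 = ?\<xi> w1" and "\<tau>1 = s w1 * pole_poly k0 e \<xi>1"
  have w1: "norm w < 1" "w \<noteq> 1" if "w \<in> V" for w using V(3) that by auto
  note k1 = of_real_k0_neq[OF k]
  have P1: "pole_poly k0 e \<xi>1 \<noteq> 0"
    unfolding \<xi>1_def surf_pt_pole_poly[OF e w1(2)[OF V(2)] k]
    using blaschke_denominator[OF k, of w1] w1[OF V(2)] k1 by simp
  have "s w1 \<noteq> 0" using s(2)[OF V(2)] nz by auto
  then have \<tau>1: "\<tau>1 \<noteq> 0" using P1 by (simp add: \<tau>1_def)
  have "surf_pt k0 e w1 (s w1) \<in> Sig_half k0 (half e)"
    using surf_pt_mem(2)[OF k e _ s(2)[OF V(2)]] w1[OF V(2)] by simp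
  moreover have "surf_pt k0 e w1 (s w1) = Pt \<xi>1 \<tau>1" using w1[OF V(2)] by (simp add: surf_pt_def \<tau>1_def \<xi>1_def Let_def)
  ultimately obtain x t where lp: "local_param k0 \<xi>1 \<tau>1 x t" and an: "(\<lambda>z. F (Pt (x z) (t z))) analytic_on {0}"
    using F unfolding surf_analytic_on_def by metis
  have x: "x analytic_on {0}" "t analytic_on {0}" "x 0 = \<xi>1" "t 0 = \<tau>1" "deriv x 0 \<noteq> 0 \<or> deriv t 0 \<noteq> 0"
    "\<forall>\<^sub>F z in nhds 0. (t z)\<^sup>2 = p_poly k0 (x z)" using lp by (auto simp: local_param_def)
  obtain N where N: "open N" "0 \<in> N" "\<And>z. z \<in> N \<Longrightarrow> (t z)\<^sup>2 = p_poly k0 (x z)" using x(6) unfolding eventually_nhds by blast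
  obtain N1 where N1: "open N1" "0 \<in> N1" "x holomorphic_on N1" using x(1) by (auto simp: analytic_at)
  obtain N2 where N2: "open N2" "0 \<in> N2" "t holomorphic_on N2" using x(2) by (auto simp: analytic_at)
  obtain N3 where N3: "open N3" "0 \<in> N3" "(\<lambda>z. F (Pt (x z) (t z))) holomorphic_on N3" using an by (auto simp: analytic_at)
  define W where "W = N \<inter> N1 \<inter> N2 \<inter> N3"
  have W: "open W" "0 \<in> W" "x holomorphic_on W" "t holomorphic_on W" "(\<lambda>z. F (Pt (x z) (t z))) holomorphic_on W"
    using N N1 N2 N3 by (auto simp: W_def elim: holomorphic_on_subset)
  have dx: "deriv x 0 \<noteq> 0"
  proof
    assume d0: "deriv x 0 = 0"
    have Dx: "(x has_field_derivative 0) (at 0)" using holomorphic_derivI[OF W(3,1,2)] d0 by simp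
    have Dt: "(t has_field_derivative deriv t 0) (at 0)" using holomorphic_derivI[OF W(4,1,2)] .
    have "((\<lambda>z. (t z)\<^sup>2) has_field_derivative 2 * t 0 * deriv t 0) (at 0)"
      using Dt by (auto intro!: derivative_eq_intros)
    moreover have "((\<lambda>z. p_poly k0 (x z)) has_field_derivative 0) (at 0)"
      unfolding p_poly_def using Dx by (auto intro!: derivative_eq_intros)
    then have "((\<lambda>z. (t z)\<^sup>2) has_field_derivative 0) (at 0)"
      by (rule has_field_derivative_transform_within_open[OF _ N(1,2)]) (simp add: N(3))
    ultimately have "2 * t 0 * deriv t 0 = 0" by (rule DERIV_unique)
    then show False using x(4,5) \<tau>1 d0 by simp
  qed
  obtain r where r: "r > 0" "ball 0 r \<subseteq> W" "open (x ` ball 0 r)" "inj_on x (ball 0 r)"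
    using has_complex_derivative_locally_invertible[OF W(3,2,1) dx] by blast
  obtain y where y: "y holomorphic_on (x ` ball 0 r)" "\<And>z. z \<in> ball 0 r \<Longrightarrow> y (x z) = z"
    by (rule holomorphic_has_inverse[OF holomorphic_on_subset[OF W(3) r(2)] open_ball r(4)]) (rule that; assumption)
  define Y where "Y = V \<inter> ?\<xi> -` (x ` ball 0 r)"
  have hol\<xi>: "?\<xi> holomorphic_on V" using w1(2) by (intro holomorphic_intros) auto
  have "open (?\<xi> -` (x ` ball 0 r) \<inter> V)"
    using continuous_on_open_vimage[OF V(1), THEN iffD1, OF holomorphic_on_imp_continuous_on[OF hol\<xi>]] r(3) by blast
  then have Y: "open Y" by (simp add: Y_def Int_commute)
  have Y1: "w1 \<in> Y" using r(1) x(3) V(2) by (auto simp: Y_def \<xi>1_def image_iff intro!: bexI[of _ 0])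
  note Y = Y Y1
  have holy: "(\<lambda>w. y (?\<xi> w)) holomorphic_on Y"
    by (rule holomorphic_on_compose_gen[OF holomorphic_on_subset[OF hol\<xi>] y(1), unfolded o_def]) (auto simp: Y_def)
  have yr: "y (?\<xi> w) \<in> ball 0 r" "x (y (?\<xi> w)) = ?\<xi> w" if "w \<in> Y" for w
    using that y(2) by (auto simp: Y_def)
  have y1: "y (?\<xi> w1) = 0" using y(2)[of 0] r(1) x(3) by (simp add: \<xi>1_def)
  let ?T = "\<lambda>w. t (y (?\<xi> w))" and ?U = "\<lambda>w. s w * pole_poly k0 e (?\<xi> w)"
  have holT: "?T holomorphic_on Y"
    by (rule holomorphic_on_compose_gen[OF holy holomorphic_on_subset[OF W(4) r(2)], unfolded o_def]) (use yr in auto)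
  have contU: "continuous_on Y ?U"
    unfolding pole_poly_def using w1(2) by (intro continuous_intros continuous_on_subset[OF s(1)]) (auto simp: Y_def)
  have "((\<lambda>w. ?T w + ?U w) \<longlongrightarrow> ?T w1 + ?U w1) (at w1)"
    using holomorphic_on_imp_continuous_on[OF holT] contU Y by (intro tendsto_add) (auto simp: continuous_on_eq_continuous_at isCont_def)
  moreover have "?T w1 + ?U w1 \<noteq> 0" using \<tau>1 y1 x(4) by (simp add: \<tau>1_def \<xi>1_def)
  ultimately have "\<forall>\<^sub>F w in at w1. ?T w + ?U w \<noteq> 0" by (rule tendsto_imp_eventually_ne)
  moreover have "\<forall>\<^sub>F w in at w1. w \<in> Y" using Y by (rule eventually_at_in_open')
  ultimately have "\<forall>\<^sub>F w in at w1. F (surf_pt k0 e w (s w)) = F (Pt (x (y (?\<xi> w))) (t (y (?\<xi> w))))"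
  proof eventually_elim
    case (elim w)
    have wV: "w \<in> V" using elim by (simp add: Y_def)
    have "(?T w)\<^sup>2 = p_poly k0 (?\<xi> w)" using N(3)[of "y (?\<xi> w)"] yr[OF elim(2)] r(2) by (auto simp: W_def)
    moreover have "(?U w)\<^sup>2 = p_poly k0 (?\<xi> w)" using surf_pt_curve[OF k e _ _ s(2)[OF wV] refl] w1[OF wV] by simp
    ultimately have "(?T w - ?U w) * (?T w + ?U w) = 0" by (simp add: algebra_simps power2_eq_square)
    then have "?T w = ?U w" using elim(1) by simp
    then show ?case using yr(2)[OF elim(2)] w1(2)[OF wV] by (simp add: surf_pt_def Let_def)
  qed
  moreover have "F (surf_pt k0 e w1 (s w1)) = F (Pt (x (y (?\<xi> w1))) (t (y (?\<xi> w1))))"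
    using y1 x(3,4) w1(2)[OF V(2)] by (simp add: surf_pt_def Let_def \<tau>1_def \<xi>1_def)
  ultimately have ev: "\<forall>\<^sub>F w in nhds w1. F (surf_pt k0 e w (s w)) = F (Pt (x (y (?\<xi> w))) (t (y (?\<xi> w))))"
    by (simp add: eventually_nhds_conv_at)
  have "(\<lambda>w. F (Pt (x (y (?\<xi> w))) (t (y (?\<xi> w))))) holomorphic_on Y"
    by (rule holomorphic_on_compose_gen[OF holy holomorphic_on_subset[OF W(5) r(2)], unfolded o_def]) (use yr in auto)
  then have "(\<lambda>w. F (Pt (x (y (?\<xi> w))) (t (y (?\<xi> w))))) field_differentiable at w1"
    using Y holomorphic_on_imp_differentiable_at by blast
  then obtain D where "((\<lambda>w. F (Pt (x (y (?\<xi> w))) (t (y (?\<xi> w))))) has_field_derivative D) (at w1)" by (auto simp: field_differentiable_def)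
  then have "((\<lambda>w. F (surf_pt k0 e w (s w))) has_field_derivative D) (at w1)"
    using DERIV_cong_ev[OF refl ev refl] by simp
  then show ?thesis by (auto simp: field_differentiable_def)
qed

text \<open>A function on the closed half surface that takes equal values on the two sheets descends to
  the disc. At the branch points it is only known to be continuous, and the singularities there
  are removable.\<close>

lemma even_disc_function:
  assumes k: "k0 > 1" and cont: "continuous_on (disc_curve k0) (\<lambda>(w, t). \<Theta> w t)"
    and even: "\<And>w t. \<Theta> w (- t) = \<Theta> w t"
    and branch: "\<And>V w1 s. open V \<Longrightarrow> w1 \<in> V \<Longrightarrow> V \<subseteq> ball 0 1 \<Longrightarrow> s holomorphic_on V \<Longrightarrow>
      (\<And>w. w \<in> V \<Longrightarrow> (s w)\<^sup>2 = blaschke k0 w) \<Longrightarrow> blaschke k0 w1 \<noteq> 0 \<Longrightarrow> (\<lambda>w. \<Theta> w (s w)) field_differentiable at w1"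
  shows "(\<lambda>w. \<Theta> w (csqrt (blaschke k0 w))) \<in> disc_functions"
proof -
  let ?b = "blaschke k0" and ?G = "\<lambda>w. \<Theta> w (csqrt (blaschke k0 w))"
  have G: "?G w = \<Theta> w t" if "t\<^sup>2 = ?b w" for w t
  proof -
    have "t\<^sup>2 = (csqrt (?b w))\<^sup>2" using that by simp
    then have "t = csqrt (?b w) \<or> t = - csqrt (?b w)" by (simp only: power2_eq_iff)
    then show ?thesis using even by auto
  qed
  have bc: "(?b \<longlongrightarrow> ?b w1) (at w1 within cball 0 1)" if "norm w1 \<le> 1" for w1
    using blaschke_continuous[OF k] that by (auto simp: continuous_on)
  have lim: "(?G \<longlongrightarrow> ?G w1) (at w1 within cball 0 1)"
    if w1: "norm w1 \<le> 1" and s: "(s \<longlongrightarrow> s w1) (at w1 within cball 0 1)" "\<And>w. (s w)\<^sup>2 = ?b w" for w1 s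
  proof -
    have "((\<lambda>w. (\<lambda>(w, t). \<Theta> w t) (w, s w)) \<longlongrightarrow> (\<lambda>(w, t). \<Theta> w t) (w1, s w1)) (at w1 within cball 0 1)"
    proof (rule continuous_on_tendsto_compose[OF cont])
      show "((\<lambda>w. (w, s w)) \<longlongrightarrow> (w1, s w1)) (at w1 within cball 0 1)" by (intro tendsto_intros s)
      show "(w1, s w1) \<in> disc_curve k0" using w1 s(2) by (simp add: disc_curve_def)
      show "\<forall>\<^sub>F w in at w1 within cball 0 1. (w, s w) \<in> disc_curve k0"
        using s(2) by (auto simp: eventually_at_filter disc_curve_def)
    qed
    then show ?thesis using G[OF s(2)] by simp
  qed
  define br where "br w1 w = csqrt (?b w / ?b w1) * csqrt (?b w1)" for w1 w
  have br: "(br w1 w)\<^sup>2 = ?b w" if "?b w1 \<noteq> 0" for w1 w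
    using that by (simp add: br_def power_mult_distrib)
  have "continuous_on (cball 0 1) ?G"
    unfolding continuous_on
  proof
    fix w1 :: complex assume "w1 \<in> cball 0 1"
    then have w1: "norm w1 \<le> 1" by simp
    show "(?G \<longlongrightarrow> ?G w1) (at w1 within cball 0 1)"
    proof (cases "?b w1 = 0")
      case True
      have "((\<lambda>w. sqrt (norm (?b w))) \<longlongrightarrow> sqrt (norm (?b w1))) (at w1 within cball 0 1)"
        by (intro tendsto_intros bc[OF w1])
      then have "((\<lambda>w. norm (csqrt (?b w))) \<longlongrightarrow> 0) (at w1 within cball 0 1)"
        using True by (simp add: norm_csqrt)
      from tendsto_norm_zero_cancel[OF this]
      have "((\<lambda>w. csqrt (?b w)) \<longlongrightarrow> csqrt (?b w1)) (at w1 within cball 0 1)" using True by simp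
      then show ?thesis by (rule lim[OF w1]) simp
    next
      case False
      have "((\<lambda>w. ?b w / ?b w1) \<longlongrightarrow> ?b w1 / ?b w1) (at w1 within cball 0 1)"
        using False by (intro tendsto_intros bc[OF w1])
      moreover have "isCont csqrt (?b w1 / ?b w1)" using False by (intro continuous_at_csqrt) simp
      ultimately have "((\<lambda>w. csqrt (?b w / ?b w1)) \<longlongrightarrow> csqrt (?b w1 / ?b w1)) (at w1 within cball 0 1)"
        by (rule isCont_tendsto_compose[rotated])
      then have "(br w1 \<longlongrightarrow> br w1 w1) (at w1 within cball 0 1)" unfolding br_def by (intro tendsto_intros)
      then show ?thesis by (rule lim[OF w1 _ br[OF False]])
    qed
  qed
  moreover have "?G holomorphic_on ball 0 1"
  proof (rule no_isolated_singularity)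
    show "continuous_on (ball 0 1) ?G" using calculation by (rule continuous_on_subset) auto
    show "finite {0, complex_of_real (branch_zero k0)}" by simp
    have "?G field_differentiable at w1" if w1: "norm w1 < 1" "?b w1 \<noteq> 0" for w1
    proof -
      define V where "V = ball 0 1 \<inter> (\<lambda>w. ?b w / ?b w1) -` {z. Re z > 0}"
      have bh: "(\<lambda>w. ?b w / ?b w1) holomorphic_on ball 0 1" using w1 by (intro holomorphic_intros blaschke_holomorphic[OF k]) auto
      have "open V" unfolding V_def
        by (rule continuous_open_preimage[OF holomorphic_on_imp_continuous_on[OF bh] open_ball open_halfspace_Re_gt])
      then have V: "open V" "w1 \<in> V" "V \<subseteq> ball 0 1" using w1 by (auto simp: V_def)
      have "br w1 holomorphic_on V" unfolding br_def
      proof (rule holomorphic_on_mult[OF holomorphic_on_csqrt' holomorphic_on_const])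
        show "(\<lambda>w. ?b w / ?b w1) holomorphic_on V" by (rule holomorphic_on_subset[OF bh V(3)])
        fix w assume that: "w \<in> V" then show "?b w / ?b w1 \<notin> \<real>\<^sub>\<le>\<^sub>0"
          using that by (auto simp: V_def complex_nonpos_Reals_iff)
      qed
      then have "(\<lambda>w. \<Theta> w (br w1 w)) field_differentiable at w1"
        using branch[OF V _ br[OF w1(2)] w1(2)] by blast
      then show ?thesis using G[OF br[OF w1(2)]] by simp
    qed
    note diff = this
    show "?G holomorphic_on ball 0 1 - {0, complex_of_real (branch_zero k0)}"
      unfolding holomorphic_on_def
    proof
      fix w assume "w \<in> ball 0 1 - {0, complex_of_real (branch_zero k0)}"
      then have "norm w < 1" "?b w \<noteq> 0" using blaschke_zero_iff[OF k, of w] by auto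
      then show "?G field_differentiable at w within ball 0 1 - {0, complex_of_real (branch_zero k0)}"
        by (rule field_differentiable_at_within[OF diff])
    qed
  qed auto
  ultimately show ?thesis by (simp add: disc_functions_def)
qed

text \<open>The components are half the sum and half the difference of the values on the two sheets. The
  difference, multiplied by \<open>t\<close>, descends to the disc and vanishes at both branch points, so that it
  may be divided by \<open>t\<^sup>2\<close>.\<close>

lemma surface_function_components:
  assumes k: "k0 > 1" and e: "e \<in> {1, -1}" and \<mu>: "0 < \<mu>" "\<mu> \<le> 1"
    and g: "g \<in> C_mu_Gam_half k0 \<mu> (half e)"
  obtains u v where "u \<in> disc_alg \<mu> e" "v \<in> disc_alg \<mu> e"
    "\<And>x \<sigma>. x \<in> Rdot \<Longrightarrow> \<sigma> \<in> {1, -1} \<Longrightarrow> g (Gam_lift k0 \<sigma> x) = u x + \<sigma> * t_line k0 e x * v x"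
proof -
  obtain F where F: "\<And>P. P \<in> Gam k0 \<Longrightarrow> F P = g P" "surf_continuous_on (Sig_half k0 (half e) \<union> Gam k0) F"
    "surf_analytic_on k0 (Sig_half k0 (half e)) F" using g by (auto simp: C_mu_Gam_half_def)
  have gC: "(\<lambda>x. g (Gam_lift k0 1 x)) \<in> C_mu \<mu>" "(\<lambda>x. g (Gam_lift k0 (-1) x)) \<in> C_mu \<mu>"
    using g by (auto simp: C_mu_Gam_half_def C_mu_Gam_def)
  let ?\<Phi> = "\<lambda>w t. F (surf_pt k0 e w t)"
  let ?\<Theta>1 = "\<lambda>w t. (?\<Phi> w t + ?\<Phi> w (- t)) / 2"
  let ?\<Theta>2 = "\<lambda>w t. t * (?\<Phi> w t - ?\<Phi> w (- t)) / 2"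
  have c1: "continuous_on (disc_curve k0) (\<lambda>p. ?\<Phi> (fst p) (snd p))"
    using surf_pt_continuous[OF k e F(2)] by (simp add: case_prod_beta)
  have c2: "continuous_on (disc_curve k0) (\<lambda>p. ?\<Phi> (fst p) (- snd p))"
  proof -
    have "continuous_on (disc_curve k0) (\<lambda>p. (\<lambda>p. ?\<Phi> (fst p) (snd p)) (fst p, - snd p))"
      by (rule continuous_on_compose2[OF c1]) (auto intro!: continuous_intros simp: disc_curve_def)
    then show ?thesis by simp
  qed
  have d: "(\<lambda>w. ?\<Phi> w (s w)) field_differentiable at w1"
    if "open V" "w1 \<in> V" "V \<subseteq> ball 0 1" "s holomorphic_on V" "\<And>w. w \<in> V \<Longrightarrow> (s w)\<^sup>2 = blaschke k0 w" "blaschke k0 w1 \<noteq> 0" for V w1 s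
    by (rule surf_analytic_branch[OF k e F(3) that(1-3) holomorphic_on_imp_continuous_on[OF that(4)] that(5,6)])
  have dm: "(\<lambda>w. ?\<Phi> w (- s w)) field_differentiable at w1"
    if "open V" "w1 \<in> V" "V \<subseteq> ball 0 1" "s holomorphic_on V" "\<And>w. w \<in> V \<Longrightarrow> (s w)\<^sup>2 = blaschke k0 w" "blaschke k0 w1 \<noteq> 0" for V w1 s
    using d[OF that(1-3) holomorphic_on_minus[OF that(4)] _ that(6)] that(5) by simp
  define G1 where "G1 w = ?\<Theta>1 w (csqrt (blaschke k0 w))" for w
  define G2 where "G2 w = ?\<Theta>2 w (csqrt (blaschke k0 w))" for w
  have G1: "G1 \<in> disc_functions"
    unfolding G1_def
  proof (rule even_disc_function[OF k])
    show "continuous_on (disc_curve k0) (\<lambda>(w, t). ?\<Theta>1 w t)"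
      unfolding case_prod_beta by (intro continuous_intros c1 c2) auto
    fix V w1 s assume "open V" "w1 \<in> V" "V \<subseteq> ball 0 1" "s holomorphic_on V" "\<And>w. w \<in> V \<Longrightarrow> (s w)\<^sup>2 = blaschke k0 w" "blaschke k0 w1 \<noteq> 0"
    then show "(\<lambda>w. ?\<Theta>1 w (s w)) field_differentiable at w1"
      by (intro derivative_intros d[of V] dm[of V]) auto
  qed (simp add: add.commute)
  have G2: "G2 \<in> disc_functions"
    unfolding G2_def
  proof (rule even_disc_function[OF k])
    show "continuous_on (disc_curve k0) (\<lambda>(w, t). ?\<Theta>2 w t)"
      unfolding case_prod_beta by (intro continuous_intros c1 c2) auto
    show "?\<Theta>2 w (- t) = ?\<Theta>2 w t" for w t by (simp add: algebra_simps)
    fix V w1 s assume a: "open V" "w1 \<in> V" "V \<subseteq> ball 0 1" "s holomorphic_on V" "\<And>w. w \<in> V \<Longrightarrow> (s w)\<^sup>2 = blaschke k0 w" "blaschke k0 w1 \<noteq> 0"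
    then have "s field_differentiable at w1" using holomorphic_on_imp_differentiable_at by blast
    with a show "(\<lambda>w. ?\<Theta>2 w (s w)) field_differentiable at w1"
      by (intro derivative_intros d[of V] dm[of V]) auto
  qed
  have \<Phi>: "?\<Phi> (disc_coord e x) (\<sigma> * t_line k0 e x) = g (Gam_lift k0 \<sigma> x)" if "x \<in> Rdot" "\<sigma> \<in> {1, -1}" for x \<sigma>
    using surf_pt_lift[OF k e that(1)] F(1) Gam_lift_image[OF k] that by auto
  have cs: "csqrt (blaschke k0 (disc_coord e x)) = t_line k0 e x \<or> csqrt (blaschke k0 (disc_coord e x)) = - t_line k0 e x" if "x \<in> Rdot" for x
  proof -
    have "(csqrt (blaschke k0 (disc_coord e x)))\<^sup>2 = (t_line k0 e x)\<^sup>2" using t_line_square[OF k e that] by simp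
    then show ?thesis by (simp only: power2_eq_iff)
  qed
  have G1x: "G1 (disc_coord e x) = (g (Gam_lift k0 1 x) + g (Gam_lift k0 (-1) x)) / 2"
    and G2x: "G2 (disc_coord e x) = t_line k0 e x * (g (Gam_lift k0 1 x) - g (Gam_lift k0 (-1) x)) / 2" if x: "x \<in> Rdot" for x
    using cs[OF x] \<Phi>[OF x, of 1] \<Phi>[OF x, of "-1"] by (auto simp: G1_def G2_def field_simps)
  define u where "u x = (g (Gam_lift k0 1 x) + g (Gam_lift k0 (-1) x)) / 2" for x
  define v2 where "v2 x = t_line k0 e x * (g (Gam_lift k0 1 x) - g (Gam_lift k0 (-1) x)) / 2" for x
  have uC: "u \<in> C_mu \<mu>" and v2C: "v2 \<in> C_mu \<mu>"
    using C_mu_mult[OF C_mu_const[of "1/2"] C_mu_add[OF gC] \<mu>(1)]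
      C_mu_mult[OF C_mu_const[of "1/2"] C_mu_mult[OF t_line_C_mu[OF k e \<mu>] C_mu_diff[OF gC] \<mu>(1)] \<mu>(1)]
    by (auto simp: u_def[abs_def] v2_def[abs_def])
  have u: "u \<in> disc_alg \<mu> e" using G1x by (intro disc_algI[OF uC G1]) (simp add: u_def)
  have v2: "v2 x = G2 (disc_coord e x)" if "x \<in> Rdot" for x using G2x[OF that] by (simp add: v2_def)
  let ?a = "complex_of_real (branch_zero k0)"
  have a: "norm ?a < 1" "?a \<noteq> 0" using branch_zero_bounds[OF k] by auto
  have G2z: "G2 0 = 0" "G2 ?a = 0" by (auto simp: G2_def blaschke_def)
  obtain H where H: "H \<in> disc_functions" "(\<lambda>x. v2 x / (disc_coord e x - 0)) \<in> C_mu \<mu>"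
    "\<And>x. x \<in> Rdot \<Longrightarrow> v2 x / (disc_coord e x - 0) = H (disc_coord e x)" "\<And>z. norm z \<le> 1 \<Longrightarrow> G2 z = (z - 0) * H z"
    by (rule disc_alg_divide_zero[OF e \<mu> v2C G2 _ _ G2z(1)]) (erule v2, simp, (rule that; assumption))
  have "H ?a = 0" using H(4)[of ?a] G2z(2) a by simp
  then obtain K where K: "K \<in> disc_functions" "(\<lambda>x. v2 x / (disc_coord e x - 0) / (disc_coord e x - ?a)) \<in> C_mu \<mu>"
    "\<And>x. x \<in> Rdot \<Longrightarrow> v2 x / (disc_coord e x - 0) / (disc_coord e x - ?a) = K (disc_coord e x)"
    using disc_alg_divide_zero[OF e \<mu> H(2,1,3) a(1)] by (metis (no_types, lifting))
  have K': "(\<lambda>x. v2 x / (disc_coord e x - 0) / (disc_coord e x - ?a)) \<in> disc_alg \<mu> e"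
    by (rule disc_algI[OF K(2,1,3)])
  define v where "v x = (1 - ?a * disc_coord e x) * (v2 x / (disc_coord e x - 0) / (disc_coord e x - ?a))" for x
  have v: "v \<in> disc_alg \<mu> e" unfolding v_def
    by (intro disc_alg_mult disc_alg_diff disc_alg_const disc_coord_disc_alg e \<mu> K')
  have "g (Gam_lift k0 \<sigma> x) = u x + \<sigma> * t_line k0 e x * v x" if x: "x \<in> Rdot" and \<sigma>: "\<sigma> \<in> {1, -1}" for x \<sigma>
  proof -
    let ?w = "disc_coord e x" and ?t = "t_line k0 e x"
    have nz: "?t \<noteq> 0" using norm_t_line[OF k e x] by auto
    have w: "norm ?w = 1" by (rule norm_disc_coord[OF e x])
    then have n: "?w \<noteq> 0" "?w - ?a \<noteq> 0" "1 - ?a * ?w \<noteq> 0" using a blaschke_denominator[OF k, of ?w] by auto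
    have "?t * v x = ?t * v2 x / blaschke k0 ?w" using n by (simp add: v_def blaschke_def)
    also have "\<dots> = v2 x / ?t" using nz by (simp add: t_line_square[OF k e x, symmetric] power2_eq_square)
    also have "\<dots> = (g (Gam_lift k0 1 x) - g (Gam_lift k0 (-1) x)) / 2" using nz by (simp add: v2_def)
    finally have "?t * v x = (g (Gam_lift k0 1 x) - g (Gam_lift k0 (-1) x)) / 2" .
    then show ?thesis using \<sigma> by (auto simp: u_def mult.assoc field_simps)
  qed
  with u v show ?thesis by (rule that)
qed

text \<open>Where \<open>\<tau> \<noteq> 0\<close> the parameter is \<open>\<xi>\<close>. At a branch point it is \<open>\<tau>\<close>, because the zeros of the polynomial
  are simple.\<close>

lemma local_param_exists:
  assumes k: "k0 > 1" and p: "\<tau>\<^sup>2 = p_poly k0 \<xi>" obtains x t where "local_param k0 \<xi> \<tau> x t"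
proof (cases "\<tau> = 0")
  case False
  then have p0: "p_poly k0 \<xi> \<noteq> 0" using p by auto
  let ?x = "\<lambda>z. \<xi> + z" and ?t = "\<lambda>z. \<tau> * csqrt (p_poly k0 (\<xi> + z) / p_poly k0 \<xi>)"
  have an: "(\<lambda>z. p_poly k0 (\<xi> + z) / p_poly k0 \<xi>) analytic_on {0}"
    unfolding p_poly_def using p0 by (intro analytic_intros) (auto simp: p_poly_def)
  have "local_param k0 \<xi> \<tau> ?x ?t"
    unfolding local_param_def
  proof (intro conjI)
    show "?x analytic_on {0}" by (intro analytic_intros)
    show "?t analytic_on {0}" by (intro analytic_intros an) (use p0 in auto)
    have "deriv ?x 0 = 1" by (rule DERIV_imp_deriv) (auto intro!: derivative_eq_intros)
    then show "deriv ?x 0 \<noteq> 0 \<or> deriv ?t 0 \<noteq> 0" by simp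
    show "\<forall>\<^sub>F z in nhds 0. (?t z)\<^sup>2 = p_poly k0 (?x z)"
      using p p0 by (intro always_eventually allI) (simp add: power_mult_distrib)
  qed (use p0 in auto)
  then show ?thesis by (rule that)
next
  case True
  let ?p = "p_poly k0"
  have p0: "?p \<xi> = 0" using p True by simp
  have hol: "?p holomorphic_on UNIV" unfolding p_poly_def by (intro holomorphic_intros)
  have "(?p has_field_derivative 2 * \<xi> * (1 + (complex_of_real k0)\<^sup>2 + 2 * \<xi>\<^sup>2)) (at \<xi>)"
    unfolding p_poly_def by (auto intro!: derivative_eq_intros simp: algebra_simps power2_eq_square)
  then have dp: "deriv ?p \<xi> = 2 * \<xi> * (1 + (complex_of_real k0)\<^sup>2 + 2 * \<xi>\<^sup>2)" by (rule DERIV_imp_deriv)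
  have k2: "1 < k0\<^sup>2" using k by (simp add: one_less_power)
  have k1: "(complex_of_real k0)\<^sup>2 \<noteq> 1" using k2 by (simp flip: of_real_power)
  have cases: "\<xi>\<^sup>2 = -1 \<or> \<xi>\<^sup>2 = - (complex_of_real k0)\<^sup>2" using p0 by (auto simp: p_poly_def add_eq_0_iff)
  have dnz: "deriv ?p \<xi> \<noteq> 0"
  proof
    assume "deriv ?p \<xi> = 0"
    then have "\<xi> = 0 \<or> 1 + (complex_of_real k0)\<^sup>2 + 2 * \<xi>\<^sup>2 = 0" unfolding dp by simp
    then show False using cases k1 k by (auto simp: algebra_simps)
  qed
  obtain r where r: "r > 0" "open (?p ` ball \<xi> r)" "inj_on ?p (ball \<xi> r)"
    by (rule has_complex_derivative_locally_invertible[OF hol UNIV_I open_UNIV dnz]) (rule that; assumption)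
  obtain y where y: "y holomorphic_on (?p ` ball \<xi> r)" "\<And>z. z \<in> ball \<xi> r \<Longrightarrow> y (?p z) = z"
    by (rule holomorphic_has_inverse[OF holomorphic_on_subset[OF hol subset_UNIV] open_ball r(3)]) (rule that; assumption)
  let ?U = "(\<lambda>z::complex. z\<^sup>2) -` (?p ` ball \<xi> r)"
  have U: "open ?U" "0 \<in> ?U" using r p0 by (auto intro!: open_vimage continuous_intros simp: image_iff intro: bexI[of _ \<xi>])
  let ?x = "\<lambda>z. y (z\<^sup>2)" and ?t = "\<lambda>z::complex. z"
  have hx: "?x holomorphic_on ?U"
    by (rule holomorphic_on_compose_gen[OF _ y(1), unfolded o_def]) (auto intro!: holomorphic_intros)
  have "local_param k0 \<xi> \<tau> ?x ?t"
    unfolding local_param_def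
  proof (intro conjI)
    show "?x analytic_on {0}" unfolding analytic_at using U hx by blast
    show "?t analytic_on {0}" by (intro analytic_intros)
    show "y (0\<^sup>2) = \<xi>" using y(2)[of \<xi>] r(1) p0 by simp
    show "deriv ?x 0 \<noteq> 0 \<or> deriv ?t 0 \<noteq> 0" by simp
    have "\<forall>\<^sub>F z in nhds 0. z \<in> ?U" using U by (auto simp: eventually_nhds)
    then show "\<forall>\<^sub>F z in nhds 0. (?t z)\<^sup>2 = ?p (?x z)"
      by (rule eventually_mono) (use y(2) in auto)
  qed (use True in auto)
  then show ?thesis by (rule that)
qed

lemma surface_function_from_components:
  assumes k: "k0 > 1" and e: "e \<in> {1, -1}" and \<mu>: "0 < \<mu>" "\<mu> \<le> 1"
    and u: "u \<in> disc_alg \<mu> e" and v: "v \<in> disc_alg \<mu> e"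
  shows "(\<lambda>P. u (Proj P) + t_coord k0 e P * v (Proj P)) \<in> C_mu_Gam_half k0 \<mu> (half e)" (is "?g \<in> _")
proof -
  obtain U where U: "U \<in> disc_functions" "\<And>x. x \<in> Rdot \<Longrightarrow> u x = U (disc_coord e x)" by (rule disc_algE[OF u]) (rule that; assumption)
  obtain V where V: "V \<in> disc_functions" "\<And>x. x \<in> Rdot \<Longrightarrow> v x = V (disc_coord e x)" by (rule disc_algE[OF v]) (rule that; assumption)
  have cU: "continuous_on (cball 0 1) U" "U holomorphic_on ball 0 1" and cV: "continuous_on (cball 0 1) V" "V holomorphic_on ball 0 1"
    using U V by (auto simp: disc_functions_def)
  define F where "F P = U (disc_coord e (Proj P)) + t_coord k0 e P * V (disc_coord e (Proj P))" for P
  let ?S = "Sig_half k0 (half e) \<union> Gam k0"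
  define j where "j = of_real e * \<i>"
  have j: "j \<noteq> 0" using e by (auto simp: j_def)
  have eIm: "e * Im \<xi> \<le> 0" if "Pt \<xi> \<tau> \<in> ?S" for \<xi> \<tau>
    using that by (auto simp: Sig_half_def Gam_def Proj_def half_def Rdot_def)
  have fin: "\<xi> - j \<noteq> 0 \<and> \<xi> - j * of_real k0 \<noteq> 0 \<and> norm ((\<xi> + j) / (\<xi> - j)) \<le> 1" if h: "e * Im \<xi> \<le> 0" for \<xi>
  proof -
    have n: "\<xi> - j \<noteq> 0" "\<xi> - j * of_real k0 \<noteq> 0" using e h k by (auto simp: j_def complex_eq_iff)
    have "(norm (\<xi> - j))\<^sup>2 - (norm (\<xi> + j))\<^sup>2 = - 4 * (e * Im \<xi>)"
      unfolding cmod_power2 j_def by (simp add: power2_eq_square algebra_simps)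
    then have "(norm (\<xi> + j))\<^sup>2 \<le> (norm (\<xi> - j))\<^sup>2" using h by linarith
    then have "norm (\<xi> + j) \<le> norm (\<xi> - j)" by (rule power2_le_imp_le) simp
    then show ?thesis using n by (simp add: norm_divide divide_le_eq)
  qed
  have "\<forall>P\<in>Gam k0. F P = ?g P"
    using U(2) V(2) by (auto simp: F_def Gam_def)
  moreover have "surf_continuous_on ?S F"
    unfolding surf_continuous_on_def
  proof
    have eq: "(F \<circ> chart_fin) p = U ((fst p + j) / (fst p - j)) + snd p / ((fst p - j) * (fst p - j * of_real k0)) * V ((fst p + j) / (fst p - j))" for p
      by (simp add: F_def chart_fin_def Proj_def disc_coord_def t_coord_def pole_poly_def j_def case_prod_beta)
    have in1: "fst p - j \<noteq> 0 \<and> fst p - j * of_real k0 \<noteq> 0 \<and> norm ((fst p + j) / (fst p - j)) \<le> 1" if "p \<in> chart_fin -` ?S" for p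
    proof (rule fin, rule eIm)
      show "Pt (fst p) (snd p) \<in> ?S" using that by (simp add: chart_fin_def case_prod_beta)
    qed
    show "continuous_on (chart_fin -` ?S) (F \<circ> chart_fin)"
    proof -
      have cw: "continuous_on (chart_fin -` ?S) (\<lambda>p. (fst p + j) / (fst p - j))"
        using in1 by (intro continuous_intros) blast
      have sub: "(\<lambda>p. (fst p + j) / (fst p - j)) ` (chart_fin -` ?S) \<subseteq> cball 0 1"
        by (rule image_subsetI) (use in1 in \<open>simp only: mem_cball dist_0_norm\<close>)
      note UV = continuous_on_compose2[OF cU(1) cw sub] continuous_on_compose2[OF cV(1) cw sub]
      have nz: "\<forall>p\<in>chart_fin -` ?S. (fst p - j) * (fst p - j * of_real k0) \<noteq> 0"
        using in1 by (intro ballI no_zero_divisors) blast+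
      have "continuous_on (chart_fin -` ?S) (\<lambda>p. U ((fst p + j) / (fst p - j)) + snd p / ((fst p - j) * (fst p - j * of_real k0)) * V ((fst p + j) / (fst p - j)))"
        by (intro continuous_intros UV nz)
      then show ?thesis by (rule continuous_on_eq) (rule eq[symmetric])
    qed
    have eq2: "(F \<circ> chart_inf) p = U ((1 + j * fst p) / (1 - j * fst p)) + snd p / ((1 - j * fst p) * (1 - j * of_real k0 * fst p)) * V ((1 + j * fst p) / (1 - j * fst p))" for p
    proof (cases "fst p = 0")
      case True
      then show ?thesis by (simp add: F_def chart_inf_def Proj_def disc_coord_def t_coord_def case_prod_beta)
    next
      case False
      have "1 / fst p + j = (1 + j * fst p) / fst p" "1 / fst p - j = (1 - j * fst p) / fst p" "1 / fst p - j * of_real k0 = (1 - j * of_real k0 * fst p) / fst p"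
        using False by (simp_all add: add_divide_distrib diff_divide_distrib)
      then show ?thesis using False
        by (simp add: F_def chart_inf_def Proj_def disc_coord_def t_coord_def pole_poly_def j_def[symmetric] case_prod_beta power2_eq_square)
    qed
    have in2: "1 - j * fst p \<noteq> 0 \<and> 1 - j * of_real k0 * fst p \<noteq> 0 \<and> norm ((1 + j * fst p) / (1 - j * fst p)) \<le> 1" if p: "p \<in> chart_inf -` ?S" for p
    proof (cases "fst p = 0")
      case False
      have "Pt (1 / fst p) (snd p / (fst p)\<^sup>2) \<in> ?S" using p False by (simp add: chart_inf_def case_prod_beta)
      from fin[OF eIm[OF this]]
      have f: "1 / fst p - j \<noteq> 0 \<and> 1 / fst p - j * of_real k0 \<noteq> 0 \<and> norm ((1 / fst p + j) / (1 / fst p - j)) \<le> 1" .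
      have "1 / fst p + j = (1 + j * fst p) / fst p" "1 / fst p - j = (1 - j * fst p) / fst p" "1 / fst p - j * of_real k0 = (1 - j * of_real k0 * fst p) / fst p"
        using False by (simp_all add: add_divide_distrib diff_divide_distrib)
      with f False show ?thesis by simp
    qed simp
    show "continuous_on (chart_inf -` ?S) (F \<circ> chart_inf)"
    proof -
      have cw: "continuous_on (chart_inf -` ?S) (\<lambda>p. (1 + j * fst p) / (1 - j * fst p))"
        using in2 by (intro continuous_intros) blast
      have sub: "(\<lambda>p. (1 + j * fst p) / (1 - j * fst p)) ` (chart_inf -` ?S) \<subseteq> cball 0 1"
        by (rule image_subsetI) (use in2 in \<open>simp only: mem_cball dist_0_norm\<close>)
      note UV = continuous_on_compose2[OF cU(1) cw sub] continuous_on_compose2[OF cV(1) cw sub]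
      have nz: "\<forall>p\<in>chart_inf -` ?S. (1 - j * fst p) * (1 - j * of_real k0 * fst p) \<noteq> 0"
        using in2 by (intro ballI no_zero_divisors) blast+
      have "continuous_on (chart_inf -` ?S) (\<lambda>p. U ((1 + j * fst p) / (1 - j * fst p)) + snd p / ((1 - j * fst p) * (1 - j * of_real k0 * fst p)) * V ((1 + j * fst p) / (1 - j * fst p)))"
        by (intro continuous_intros UV nz)
      then show ?thesis by (rule continuous_on_eq) (rule eq2[symmetric])
    qed
  qed
  moreover have "surf_analytic_on k0 (Sig_half k0 (half e)) F"
    unfolding surf_analytic_on_def
  proof (intro allI impI)
    fix \<xi> \<tau> assume P: "Pt \<xi> \<tau> \<in> Sig_half k0 (half e)"
    then have \<xi>: "\<xi> \<in> half e" and "\<tau>\<^sup>2 = p_poly k0 \<xi>" by (auto simp: Sig_half_def Sig_def Proj_def)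
    then obtain x t where lp: "local_param k0 \<xi> \<tau> x t" using local_param_exists[OF k] by blast
    then have xt: "x analytic_on {0}" "t analytic_on {0}" "x 0 = \<xi>" by (auto simp: local_param_def)
    have hw: "(\<lambda>z. (z + j) / (z - j)) holomorphic_on half e"
      using disc_coord_half(1)[OF e] by (intro holomorphic_intros) (auto simp: j_def)
    have hUV: "(\<lambda>z. U ((z + j) / (z - j))) holomorphic_on half e" "(\<lambda>z. V ((z + j) / (z - j))) holomorphic_on half e"
      by (rule holomorphic_on_compose_gen[OF hw cU(2), unfolded o_def] holomorphic_on_compose_gen[OF hw cV(2), unfolded o_def];
          use disc_coord_half(2)[OF e] in \<open>auto simp: disc_coord_def j_def\<close>)+
    have an: "(\<lambda>z. U ((x z + j) / (x z - j))) analytic_on {0}" "(\<lambda>z. V ((x z + j) / (x z - j))) analytic_on {0}"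
      using analytic_on_compose_gen[OF xt(1) hUV(1)[folded analytic_on_open[OF half_open]]]
        analytic_on_compose_gen[OF xt(1) hUV(2)[folded analytic_on_open[OF half_open]]] xt(3) \<xi> by (auto simp: o_def)
    have "e * Im \<xi> \<le> 0" using \<xi> by (simp add: half_def)
    from fin[OF this] have n: "(\<xi> - j) * (\<xi> - j * of_real k0) \<noteq> 0" by simp
    have "(\<lambda>z. U ((x z + j) / (x z - j)) + t z / ((x z - j) * (x z - j * of_real k0)) * V ((x z + j) / (x z - j))) analytic_on {0}"
      using n by (intro analytic_intros an xt) (auto simp: xt(3))
    then have "(\<lambda>z. F (Pt (x z) (t z))) analytic_on {0}"
      by (simp add: F_def Proj_def disc_coord_def t_coord_def pole_poly_def j_def)
    with lp show "\<exists>x t. local_param k0 \<xi> \<tau> x t \<and> (\<lambda>z. F (Pt (x z) (t z))) analytic_on {0}" by blast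
  qed
  moreover have "?g \<in> C_mu_Gam k0 \<mu>"
    unfolding C_mu_Gam_def
  proof (intro CollectI ballI)
    fix \<sigma> :: complex assume "\<sigma> \<in> {1, -1}"
    have "(\<lambda>x. u x + \<sigma> * t_line k0 e x * v x) \<in> C_mu \<mu>"
      by (intro C_mu_add C_mu_mult C_mu_const t_line_C_mu k e \<mu> disc_alg_C_mu[OF u] disc_alg_C_mu[OF v])
    then show "(\<lambda>z. ?g (Gam_lift k0 \<sigma> z)) \<in> C_mu \<mu>"
      by (rule C_mu_cong) (auto simp: t_coord_lift, auto simp: Gam_lift_def Proj_def Rdot_def)
  qed
  ultimately show ?thesis unfolding C_mu_Gam_half_def by blast
qed

section \<open>Factorization of matrix functions\<close>

abbreviation mat2 :: "complex \<Rightarrow> complex \<Rightarrow> complex \<Rightarrow> complex \<Rightarrow> complex^2^2" where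
  "mat2 a b c d \<equiv> vector [vector [a, b], vector [c, d]]"

lemma mat2_eq_iff: "X = mat2 a b c d \<longleftrightarrow> X $ 1 $ 1 = a \<and> X $ 1 $ 2 = b \<and> X $ 2 $ 1 = c \<and> X $ 2 $ 2 = d"
  by (auto simp: vec_eq_iff forall_2)

lemma mat2_entries: "X = mat2 (X $ 1 $ 1) (X $ 1 $ 2) (X $ 2 $ 1) (X $ 2 $ 2)"
  by (simp add: mat2_eq_iff)

lemma mat2_mult: "mat2 a b c d ** mat2 a' b' c' d' = mat2 (a*a' + b*c') (a*b' + b*d') (c*a' + d*c') (c*b' + d*d')"
  by (simp add: mat2_eq_iff matrix_matrix_mult_def sum_2)

lemma mat2_one: "mat 1 = mat2 1 0 0 1"
  by (simp add: mat2_eq_iff mat_def)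

lemma mat2_det: "det (mat2 a b c d) = a * d - b * c"
  by (simp add: det_2)

lemma mat2_over_iff:
  "G \<in> mat2_over A \<longleftrightarrow> (\<lambda>x. G x $ 1 $ 1) \<in> A \<and> (\<lambda>x. G x $ 1 $ 2) \<in> A \<and> (\<lambda>x. G x $ 2 $ 1) \<in> A \<and> (\<lambda>x. G x $ 2 $ 2) \<in> A"
  by (auto simp: mat2_over_def forall_2)

lemma mat2_overI:
  "a \<in> A \<Longrightarrow> b \<in> A \<Longrightarrow> c \<in> A \<Longrightarrow> d \<in> A \<Longrightarrow> (\<lambda>x. mat2 (a x) (b x) (c x) (d x)) \<in> mat2_over A"
  by (simp add: mat2_over_iff)

lemma mat2_over_mult:
  assumes "X \<in> mat2_over (disc_alg \<mu> e)" "Y \<in> mat2_over (disc_alg \<mu> e)" "0 < \<mu>"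
  shows "(\<lambda>x. X x ** Y x) \<in> mat2_over (disc_alg \<mu> e)"
proof -
  have "(X x ** Y x) $ i $ j = X x $ i $ 1 * Y x $ 1 $ j + X x $ i $ 2 * Y x $ 2 $ j" for x i j
    by (simp add: matrix_matrix_mult_def sum_2)
  then show ?thesis using assms by (auto simp: mat2_over_def intro!: disc_alg_add disc_alg_mult)
qed

lemma mat2_over_det:
  "X \<in> mat2_over (disc_alg \<mu> e) \<Longrightarrow> 0 < \<mu> \<Longrightarrow> (\<lambda>x. det (X x)) \<in> disc_alg \<mu> e"
  by (auto simp: det_2 mat2_over_def intro!: disc_alg_diff disc_alg_mult)

lemma mat2_unitI:
  assumes X: "X \<in> mat2_over (disc_alg \<mu> e)" and d: "d \<in> disc_alg \<mu> e" "\<And>x. x \<in> Rdot \<Longrightarrow> det (X x) * d x = 1" and \<mu>: "0 < \<mu>"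
  shows "X \<in> mat2_units_on Rdot (disc_alg \<mu> e)"
proof -
  let ?H = "\<lambda>x. mat2 (d x * X x $ 2 $ 2) (- (d x * X x $ 1 $ 2)) (- (d x * X x $ 2 $ 1)) (d x * X x $ 1 $ 1)"
  have "?H \<in> mat2_over (disc_alg \<mu> e)"
    using X d \<mu> by (intro mat2_overI disc_alg_mult disc_alg_uminus) (auto simp: mat2_over_iff)
  moreover have "X x ** ?H x = mat 1 \<and> ?H x ** X x = mat 1" if "x \<in> Rdot" for x
  proof -
    define a b c e' where "a = X x $ 1 $ 1" and "b = X x $ 1 $ 2" and "c = X x $ 2 $ 1" and "e' = X x $ 2 $ 2"
    have X: "X x = mat2 a b c e'" unfolding a_def b_def c_def e'_def by (rule mat2_entries)
    have "(a * e' - b * c) * d x = 1" using d(2)[OF that] by (simp add: X mat2_det)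
    then have 1: "a * (d x * e') - b * (d x * c) = 1" by (simp add: algebra_simps)
    show ?thesis unfolding X mat2_mult mat2_one by (simp add: mat2_eq_iff) (use 1 in \<open>simp add: algebra_simps\<close>)
  qed
  ultimately show ?thesis using X by (auto simp: mat2_units_on_def intro!: bexI[of _ ?H])
qed

lemma mat2_unitE:
  assumes "X \<in> mat2_units_on Rdot (disc_alg \<mu> e)"
  obtains Y where "X \<in> mat2_over (disc_alg \<mu> e)" "Y \<in> mat2_units_on Rdot (disc_alg \<mu> e)" "Y \<in> mat2_over (disc_alg \<mu> e)"
    "\<And>x. x \<in> Rdot \<Longrightarrow> X x ** Y x = mat 1" "\<And>x. x \<in> Rdot \<Longrightarrow> Y x ** X x = mat 1"
  using assms that unfolding mat2_units_on_def by blast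

lemma mat2_unit_det:
  assumes "X \<in> mat2_units_on Rdot (disc_alg \<mu> e)" "0 < \<mu>"
  shows "(\<lambda>x. det (X x)) \<in> units_on Rdot (disc_alg \<mu> e)"
proof -
  obtain Y where Y: "X \<in> mat2_over (disc_alg \<mu> e)" "Y \<in> mat2_over (disc_alg \<mu> e)" "\<And>x. x \<in> Rdot \<Longrightarrow> X x ** Y x = mat 1"
    by (rule mat2_unitE[OF assms(1)]) (rule that; assumption)
  have "det (X x) * det (Y x) = 1" if "x \<in> Rdot" for x using Y(3)[OF that] by (metis det_I det_mul)
  then show ?thesis using mat2_over_det[OF Y(1) assms(2)] mat2_over_det[OF Y(2) assms(2)]
    by (auto simp: units_on_def intro!: bexI[of _ "\<lambda>x. det (Y x)"])
qed

lemma mat2_unit_mult: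
  assumes X: "X \<in> mat2_units_on Rdot (disc_alg \<mu> e)" and Y: "Y \<in> mat2_units_on Rdot (disc_alg \<mu> e)" and \<mu>: "0 < \<mu>"
  shows "(\<lambda>x. X x ** Y x) \<in> mat2_units_on Rdot (disc_alg \<mu> e)"
proof -
  obtain c where c: "c \<in> disc_alg \<mu> e" "\<And>x. x \<in> Rdot \<Longrightarrow> det (X x) * c x = 1"
    using mat2_unit_det[OF X \<mu>] by (auto simp: units_on_def)
  obtain d where d: "d \<in> disc_alg \<mu> e" "\<And>x. x \<in> Rdot \<Longrightarrow> det (Y x) * d x = 1"
    using mat2_unit_det[OF Y \<mu>] by (auto simp: units_on_def)
  show ?thesis
  proof (rule mat2_unitI[OF _ disc_alg_mult[OF c(1) d(1) \<mu>] _ \<mu>])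
    show "(\<lambda>x. X x ** Y x) \<in> mat2_over (disc_alg \<mu> e)"
      using X Y by (intro mat2_over_mult \<mu>) (auto simp: mat2_units_on_def)
    show "det (X x ** Y x) * (c x * d x) = 1" if "x \<in> Rdot" for x
      using c(2)[OF that] d(2)[OF that] by (simp add: det_mul algebra_simps)
  qed
qed

lemma mat2_unit_const:
  assumes "a * d - b * c \<noteq> 0" "0 < \<mu>"
  shows "(\<lambda>x. mat2 a b c d) \<in> mat2_units_on Rdot (disc_alg \<mu> e)"
  by (rule mat2_unitI[where d="\<lambda>_. 1 / (a * d - b * c)"]) (use assms in \<open>auto simp: mat2_det intro!: mat2_overI\<close>)

lemma bounded_factorization_iff:
  assumes "0 < \<mu>" "\<mu> < 1"
  shows "bounded_factorization \<mu> G k1 k2 \<longleftrightarrow>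
    (\<exists>Gm\<in>mat2_units_on Rdot (disc_alg \<mu> 1). \<exists>Gp\<in>mat2_units_on Rdot (disc_alg \<mu> (-1)).
       \<forall>x\<in>Rdot. G x = Gm x ** D_mat k1 k2 x ** Gp x)"
  unfolding bounded_factorization_def
  using C_mu_half_eq_disc_alg[OF assms, of 1] C_mu_half_eq_disc_alg[OF assms, of "-1"] by (simp add: half_lower half_upper)

lemma bounded_factorizationI:
  assumes "0 < \<mu>" "\<mu> < 1" "Gm \<in> mat2_units_on Rdot (disc_alg \<mu> 1)" "Gp \<in> mat2_units_on Rdot (disc_alg \<mu> (-1))"
    "\<And>x. x \<in> Rdot \<Longrightarrow> G x = Gm x ** D_mat k1 k2 x ** Gp x"
  shows "bounded_factorization \<mu> G k1 k2"
  using assms bounded_factorization_iff by blast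

lemma bounded_factorizationE:
  assumes "bounded_factorization \<mu> G k1 k2" "0 < \<mu>" "\<mu> < 1"
  obtains Gm Gp where "Gm \<in> mat2_units_on Rdot (disc_alg \<mu> 1)" "Gp \<in> mat2_units_on Rdot (disc_alg \<mu> (-1))"
    "\<And>x. x \<in> Rdot \<Longrightarrow> G x = Gm x ** D_mat k1 k2 x ** Gp x"
  using assms bounded_factorization_iff by blast

lemma bounded_factorization_mult:
  assumes "bounded_factorization \<mu> G k1 k2" and \<mu>: "0 < \<mu>" "\<mu> < 1"
    and L: "L \<in> mat2_units_on Rdot (disc_alg \<mu> 1)" and R: "R \<in> mat2_units_on Rdot (disc_alg \<mu> (-1))"
    and eq: "\<And>x. x \<in> Rdot \<Longrightarrow> K x = L x ** G x ** R x"
  shows "bounded_factorization \<mu> K k1 k2"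
proof -
  obtain Gm Gp where G: "Gm \<in> mat2_units_on Rdot (disc_alg \<mu> 1)" "Gp \<in> mat2_units_on Rdot (disc_alg \<mu> (-1))"
    "\<And>x. x \<in> Rdot \<Longrightarrow> G x = Gm x ** D_mat k1 k2 x ** Gp x" by (rule bounded_factorizationE[OF assms(1) \<mu>]) (rule that; assumption)
  show ?thesis
    by (rule bounded_factorizationI[OF \<mu> mat2_unit_mult[OF L G(1) \<mu>(1)] mat2_unit_mult[OF G(2) R \<mu>(1)]])
      (simp add: eq G(3) matrix_mul_assoc)
qed

lemma mat2_unit_one: "0 < \<mu> \<Longrightarrow> (\<lambda>x. mat 1) \<in> mat2_units_on Rdot (disc_alg \<mu> e)"
  unfolding mat2_one by (rule mat2_unit_const) auto

lemma bounded_factorization_swap: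
  assumes "bounded_factorization \<mu> G k1 k2" and \<mu>: "0 < \<mu>" "\<mu> < 1"
  shows "bounded_factorization \<mu> G k2 k1"
proof -
  obtain Gm Gp where G: "Gm \<in> mat2_units_on Rdot (disc_alg \<mu> 1)" "Gp \<in> mat2_units_on Rdot (disc_alg \<mu> (-1))"
    "\<And>x. x \<in> Rdot \<Longrightarrow> G x = Gm x ** D_mat k1 k2 x ** Gp x" by (rule bounded_factorizationE[OF assms]) (rule that; assumption)
  have J: "(\<lambda>x. mat2 0 1 1 0) \<in> mat2_units_on Rdot (disc_alg \<mu> e)" for e by (rule mat2_unit_const) (use \<mu> in auto)
  have D: "D_mat k1 k2 x = mat2 0 1 1 0 ** D_mat k2 k1 x ** mat2 0 1 1 0" for x by (simp add: D_mat_def mat2_mult)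
  show ?thesis
    by (rule bounded_factorizationI[OF \<mu> mat2_unit_mult[OF G(1) J \<mu>(1)] mat2_unit_mult[OF J G(2) \<mu>(1)]])
      (simp add: G(3) D matrix_mul_assoc)
qed

lemma bounded_factorization_shift:
  assumes "bounded_factorization \<mu> G k1 k2" and \<mu>: "0 < \<mu>" "\<mu> < 1"
  shows "bounded_factorization \<mu> (\<lambda>x. mat2 (cay x powi n) 0 0 (cay x powi n) ** G x) (k1 + n) (k2 + n)"
proof -
  obtain Gm Gp where G: "Gm \<in> mat2_units_on Rdot (disc_alg \<mu> 1)" "Gp \<in> mat2_units_on Rdot (disc_alg \<mu> (-1))"
    "\<And>x. x \<in> Rdot \<Longrightarrow> G x = Gm x ** D_mat k1 k2 x ** Gp x" by (rule bounded_factorizationE[OF assms]) (rule that; assumption)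
  show ?thesis
  proof (rule bounded_factorizationI[OF \<mu> G(1,2)])
    fix x assume x: "x \<in> Rdot"
    let ?s = "cay x powi n"
    have "mat2 ?s 0 0 ?s ** Gm x = Gm x ** mat2 ?s 0 0 ?s"
      by (subst (1 2) mat2_entries[of "Gm x"]) (simp only: mat2_mult mult.commute mult_zero_left mult_zero_right add_0_left add_0_right)
    moreover have "D_mat (k1 + n) (k2 + n) x = mat2 ?s 0 0 ?s ** D_mat k1 k2 x"
      using cay_nonzero[OF x] by (simp add: D_mat_def mat2_mult power_int_add mult.commute)
    ultimately show "mat2 ?s 0 0 ?s ** G x = Gm x ** D_mat (k1 + n) (k2 + n) x ** Gp x"
      by (simp add: G(3)[OF x] matrix_mul_assoc)
  qed
qed

text \<open>Multiplying one row of the left factor by \<open>cay\<close> creates a pole at the point \<open>- \<i>\<close>, where \<open>1 / cay\<close>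
  vanishes. After a constant column operation only one column has the pole, and \<open>cay\<close> can be taken out
  of it. The operation passes through the diagonal factor because it adds a multiple of the column with
  the smaller index to the other one.\<close>

lemma bounded_factorization_row_cay:
  assumes fac: "bounded_factorization \<mu> G k1 k2" and \<mu>: "0 < \<mu>" "\<mu> < 1"
  shows "\<exists>l1 l2. bounded_factorization \<mu> (\<lambda>x. mat2 (cay x) 0 0 1 ** G x) l1 l2"
proof -
  obtain k1 k2 where k: "k1 \<ge> k2" and fac: "bounded_factorization \<mu> G k1 k2"
    using fac bounded_factorization_swap[OF fac \<mu>] by (metis nle_le)
  obtain Gm Gp where G: "Gm \<in> mat2_units_on Rdot (disc_alg \<mu> 1)" "Gp \<in> mat2_units_on Rdot (disc_alg \<mu> (-1))"
    "\<And>x. x \<in> Rdot \<Longrightarrow> G x = Gm x ** D_mat k1 k2 x ** Gp x" by (rule bounded_factorizationE[OF fac \<mu>]) (rule that; assumption)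
  define a b c d where "a x = Gm x $ 1 $ 1" and "b x = Gm x $ 1 $ 2" and "c x = Gm x $ 2 $ 1" and "d x = Gm x $ 2 $ 2" for x
  have Gm: "Gm x = mat2 (a x) (b x) (c x) (d x)" for x unfolding a_def b_def c_def d_def by (rule mat2_entries)
  have A: "a \<in> disc_alg \<mu> 1" "b \<in> disc_alg \<mu> 1" "c \<in> disc_alg \<mu> 1" "d \<in> disc_alg \<mu> 1"
    using G(1) by (auto simp: mat2_units_on_def mat2_over_iff a_def[abs_def] b_def[abs_def] c_def[abs_def] d_def[abs_def])
  obtain D where D: "D \<in> disc_alg \<mu> 1" "\<And>x. x \<in> Rdot \<Longrightarrow> (a x * d x - b x * c x) * D x = 1"
    using mat2_unit_det[OF G(1) \<mu>(1)] by (auto simp: units_on_def Gm mat2_det)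
  obtain Fa where Fa: "Fa \<in> disc_functions" "\<And>x. x \<in> Rdot \<Longrightarrow> a x = Fa (disc_coord 1 x)" by (rule disc_algE[OF A(1)]) (rule that; assumption)
  obtain Fb where Fb: "Fb \<in> disc_functions" "\<And>x. x \<in> Rdot \<Longrightarrow> b x = Fb (disc_coord 1 x)" by (rule disc_algE[OF A(2)]) (rule that; assumption)
  have e1: "(1::real) \<in> {1, -1}" by simp
  have \<mu>': "\<mu> \<le> 1" using \<mu> by simp
  have v: "disc_coord 1 \<in> disc_alg \<mu> 1" by (rule disc_coord_disc_alg[OF e1 \<mu>(1) \<mu>'])
  have divide: "\<exists>g\<in>disc_alg \<mu> 1. \<forall>x\<in>Rdot. cay x * f x = g x"
    if f: "f \<in> disc_alg \<mu> 1" "F \<in> disc_functions" "\<And>x. x \<in> Rdot \<Longrightarrow> f x = F (disc_coord 1 x)" "F 0 = 0" for f F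
  proof -
    have n0: "norm (0::complex) < 1" by simp
    obtain H where H: "H \<in> disc_functions" "(\<lambda>x. f x / (disc_coord 1 x - 0)) \<in> C_mu \<mu>"
      "\<And>x. x \<in> Rdot \<Longrightarrow> f x / (disc_coord 1 x - 0) = H (disc_coord 1 x)"
      by (rule disc_alg_divide_zero[OF e1 \<mu>(1) \<mu>' disc_alg_C_mu[OF f(1)] f(2) _ n0 f(4)]) (erule f(3), (rule that; assumption))
    have "(\<lambda>x. f x / (disc_coord 1 x - 0)) \<in> disc_alg \<mu> 1" by (rule disc_algI[OF H(2,1,3)])
    then show ?thesis
      by (intro bexI[of _ "\<lambda>x. f x / (disc_coord 1 x - 0)"]) (auto simp: disc_coord_lower mult.commute)
  qed
  show ?thesis
  proof (cases "Fb 0 = 0")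
    case True
    obtain b' where b': "b' \<in> disc_alg \<mu> 1" "\<And>x. x \<in> Rdot \<Longrightarrow> cay x * b x = b' x" using divide[OF A(2) Fb True] by blast
    let ?L = "\<lambda>x. mat2 (a x) (b' x) (disc_coord 1 x * c x) (d x)"
    have "?L \<in> mat2_units_on Rdot (disc_alg \<mu> 1)"
    proof (rule mat2_unitI[OF _ D(1) _ \<mu>(1)])
      show "?L \<in> mat2_over (disc_alg \<mu> 1)" by (intro mat2_overI disc_alg_mult A b' v \<mu>)
      fix x assume x: "x \<in> Rdot"
      have "b' x * (disc_coord 1 x * c x) = b x * c x" using b'(2)[OF x] cay_nonzero[OF x] by (simp add: disc_coord_lower flip: b'(2)[OF x])
      then have "det (?L x) = a x * d x - b x * c x" by (simp only: mat2_det)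
      then show "det (?L x) * D x = 1" using D(2)[OF x] by simp
    qed
    then have "bounded_factorization \<mu> (\<lambda>x. mat2 (cay x) 0 0 1 ** G x) (k1 + 1) k2"
    proof (rule bounded_factorizationI[OF \<mu> _ G(2)])
      fix x assume x: "x \<in> Rdot"
      have "mat2 (cay x) 0 0 1 ** Gm x ** D_mat k1 k2 x = ?L x ** D_mat (k1 + 1) k2 x"
        using b'(2)[OF x] cay_nonzero[OF x]
        by (simp add: Gm D_mat_def mat2_mult mat2_eq_iff power_int_add disc_coord_lower mult.commute mult.left_commute flip: b'(2)[OF x])
      then show "mat2 (cay x) 0 0 1 ** G x = ?L x ** D_mat (k1 + 1) k2 x ** Gp x"
        by (simp add: G(3)[OF x] matrix_mul_assoc)
    qed
    then show ?thesis by blast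
  next
    case False
    define \<kappa> where "\<kappa> = Fa 0 / Fb 0"
    have "(\<lambda>x. a x - \<kappa> * b x) \<in> disc_alg \<mu> 1" by (intro disc_alg_diff disc_alg_mult disc_alg_const A \<mu>)
    moreover have "(\<lambda>z. Fa z - \<kappa> * Fb z) \<in> disc_functions"
      using Fa(1) Fb(1) by (auto simp: disc_functions_def intro!: continuous_intros holomorphic_intros)
    ultimately obtain \<beta> where \<beta>: "\<beta> \<in> disc_alg \<mu> 1" "\<And>x. x \<in> Rdot \<Longrightarrow> cay x * (a x - \<kappa> * b x) = \<beta> x"
      using divide[of "\<lambda>x. a x - \<kappa> * b x" "\<lambda>z. Fa z - \<kappa> * Fb z"] Fa(2) Fb(2) False by (auto simp: \<kappa>_def)
    let ?L = "\<lambda>x. mat2 (\<beta> x) (b x) (c x - \<kappa> * d x) (disc_coord 1 x * d x)"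
    let ?R = "\<lambda>x. mat2 1 0 (\<kappa> * cay x ^ nat (k1 - k2)) 1"
    have L: "?L \<in> mat2_units_on Rdot (disc_alg \<mu> 1)"
    proof (rule mat2_unitI[OF _ D(1) _ \<mu>(1)])
      show "?L \<in> mat2_over (disc_alg \<mu> 1)" by (intro mat2_overI disc_alg_mult disc_alg_diff disc_alg_const A \<beta> v \<mu>)
      fix x assume x: "x \<in> Rdot"
      have "\<beta> x * (disc_coord 1 x * d x) = (a x - \<kappa> * b x) * d x"
        using cay_nonzero[OF x] by (simp add: disc_coord_lower flip: \<beta>(2)[OF x])
      then have "det (?L x) = a x * d x - b x * c x" by (simp add: mat2_det algebra_simps)
      then show "det (?L x) * D x = 1" using D(2)[OF x] by simp
    qed
    have cay_pow: "(\<lambda>x. cay x ^ n) \<in> disc_alg \<mu> (-1)" for n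
    proof (induction n)
      case (Suc n)
      have "cay \<in> disc_alg \<mu> (-1)" by (rule disc_alg_cong[OF disc_coord_disc_alg[of "-1"]]) (use \<mu> in \<open>auto simp: disc_coord_upper\<close>)
      then show ?case using disc_alg_mult[OF _ Suc \<mu>(1)] by simp
    qed simp
    have R: "?R \<in> mat2_units_on Rdot (disc_alg \<mu> (-1))"
      by (rule mat2_unitI[where d="\<lambda>_. 1"]) (use \<mu> in \<open>auto simp: mat2_det intro!: mat2_overI disc_alg_mult cay_pow\<close>)
    have "bounded_factorization \<mu> (\<lambda>x. mat2 (cay x) 0 0 1 ** G x) k1 (k2 + 1)"
    proof (rule bounded_factorizationI[OF \<mu> L mat2_unit_mult[OF R G(2) \<mu>(1)]])
      fix x assume x: "x \<in> Rdot"
      have pw: "cay x powi k1 = cay x powi k2 * cay x ^ nat (k1 - k2)"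
        using cay_nonzero[OF x] k by (simp flip: power_int_add power_int_of_nat)
      have ca: "cay x * a x = \<beta> x + \<kappa> * (cay x * b x)" by (simp flip: \<beta>(2)[OF x]) (simp add: algebra_simps)
      have "mat2 (cay x) 0 0 1 ** Gm x ** D_mat k1 k2 x = mat2 (cay x * a x * cay x powi k1) (cay x * b x * cay x powi k2) (c x * cay x powi k1) (d x * cay x powi k2)"
        by (simp add: Gm D_mat_def mat2_mult)
      also have "\<dots> = ?L x ** D_mat k1 (k2 + 1) x ** ?R x"
        using cay_nonzero[OF x] by (simp add: ca D_mat_def mat2_mult mat2_eq_iff power_int_add disc_coord_lower pw) (simp add: algebra_simps)
      finally show "mat2 (cay x) 0 0 1 ** G x = ?L x ** D_mat k1 (k2 + 1) x ** (?R x ** Gp x)"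
        by (simp add: G(3)[OF x] matrix_mul_assoc)
    qed
    then show ?thesis by blast
  qed
qed

lemma disc_alg_poly:
  assumes "0 < \<mu>" "\<mu> \<le> 1" shows "(\<lambda>x. poly p (cay x)) \<in> disc_alg \<mu> (-1)"
proof (induction p)
  case (pCons a p)
  have "cay \<in> disc_alg \<mu> (-1)" by (rule disc_alg_cong[OF disc_coord_disc_alg[of "-1"]]) (use assms in \<open>auto simp: disc_coord_upper\<close>)
  then show ?case using pCons by (auto intro!: disc_alg_add disc_alg_mult assms)
qed simp

text \<open>The zeros of the determinant inside the disc are removed one at a time: at a zero, a constant
  combination of the rows vanishes, so that a factor \<open>w - z\<^sub>0\<close>, which is \<open>w\<close> times an invertible
  function on the other side, can be taken out of a row. A polynomial matrix whose determinant
  has no zeros in the closed disc is itself a right factor.\<close>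

lemma polynomial_matrix_factorization:
  fixes K11 K12 K21 K22 :: "complex poly"
  assumes \<mu>: "0 < \<mu>" "\<mu> < 1"
  shows "(\<And>w. norm w = 1 \<Longrightarrow> poly (K11 * K22 - K12 * K21) w \<noteq> 0) \<Longrightarrow>
    \<exists>k1 k2. bounded_factorization \<mu> (\<lambda>x. mat2 (poly K11 (cay x)) (poly K12 (cay x)) (poly K21 (cay x)) (poly K22 (cay x))) k1 k2"
proof (induction "degree (K11 * K22 - K12 * K21)" arbitrary: K11 K12 K21 K22 rule: less_induct)
  case less
  let ?d = "K11 * K22 - K12 * K21"
  let ?K = "\<lambda>x. mat2 (poly K11 (cay x)) (poly K12 (cay x)) (poly K21 (cay x)) (poly K22 (cay x))"
  have \<mu>': "\<mu> \<le> 1" using \<mu> by simp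
  show ?case
  proof (cases "\<exists>z. norm z < 1 \<and> poly ?d z = 0")
    case False
    have nz: "poly ?d z \<noteq> 0" if "norm z \<le> 1" for z using False less.prems that by (cases "norm z = 1") auto
    have dp: "poly ?d \<in> disc_functions"
      unfolding disc_functions_def by (intro CollectI conjI continuous_on_poly continuous_on_id) (auto intro!: holomorphic_intros)
    have "(\<lambda>x. 1 / poly ?d (cay x)) \<in> disc_alg \<mu> (-1)"
      by (rule disc_alg_inverse[OF _ disc_alg_C_mu[OF disc_alg_poly[OF \<mu>(1) \<mu>']] dp _ nz])
        (simp_all only: disc_coord_upper insert_iff simp_thms)
    then have "?K \<in> mat2_units_on Rdot (disc_alg \<mu> (-1))"
      by (rule mat2_unitI[rotated])
        (use nz norm_cay \<mu> in \<open>auto simp: mat2_det intro!: mat2_overI disc_alg_poly\<close>)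
    then have "bounded_factorization \<mu> ?K 0 0"
      by (rule bounded_factorizationI[OF \<mu> mat2_unit_one[OF \<mu>(1)]]) (simp add: D_mat_def flip: mat2_one)
    then show ?thesis by blast
  next
    case True
    then obtain z0 where z0: "norm z0 < 1" "poly ?d z0 = 0" by blast
    let ?a = "poly K11 z0" and ?b = "poly K12 z0" and ?c = "poly K21 z0" and ?e = "poly K22 z0"
    have det0: "?a * ?e = ?b * ?c" using z0(2) by simp
    have "\<exists>p q. (p \<noteq> 0 \<or> q \<noteq> 0) \<and> p * ?a + q * ?c = 0 \<and> p * ?b + q * ?e = 0"
    proof (cases "?a = 0 \<and> ?c = 0")
      case False
      then show ?thesis using det0 by (intro exI[of _ ?c] exI[of _ "- ?a"]) (auto simp: algebra_simps)
    next
      case ac: True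
      show ?thesis
      proof (cases "?b = 0 \<and> ?e = 0")
        case False
        then show ?thesis using ac by (intro exI[of _ ?e] exI[of _ "- ?b"]) (auto simp: algebra_simps)
      next
        case True
        then show ?thesis using ac by (intro exI[of _ 1] exI[of _ 0]) auto
      qed
    qed
    then obtain p q where pq: "p \<noteq> 0 \<or> q \<noteq> 0" "p * ?a + q * ?c = 0" "p * ?b + q * ?e = 0" by blast
    obtain r s where rs: "p * s - q * r \<noteq> 0" using pq(1) by (metis diff_0 diff_zero mult_1_right mult_zero_right neg_equal_0_iff_equal)
    define \<Delta> where "\<Delta> = p * s - q * r"
    have "poly (smult p K11 + smult q K21) z0 = 0" "poly (smult p K12 + smult q K22) z0 = 0" using pq by auto
    then obtain R1 R2 where R: "smult p K11 + smult q K21 = [:- z0, 1:] * R1" "smult p K12 + smult q K22 = [:- z0, 1:] * R2"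
      by (metis poly_eq_0_iff_dvd dvdE)
    let ?S1 = "smult r K11 + smult s K21" and ?S2 = "smult r K12 + smult s K22"
    have detK': "[:- z0, 1:] * (R1 * ?S2 - R2 * ?S1) = smult \<Delta> ?d"
    proof -
      have "[:- z0, 1:] * (R1 * ?S2 - R2 * ?S1) = ([:- z0, 1:] * R1) * ?S2 - ([:- z0, 1:] * R2) * ?S1" by (simp only: right_diff_distrib mult.assoc)
      also have "\<dots> = smult \<Delta> ?d" unfolding R[symmetric] \<Delta>_def by (simp add: algebra_simps smult_diff_left smult_add_right smult_diff_right)
      finally show ?thesis .
    qed
    have dnz: "?d \<noteq> 0" using less.prems[of 1] by (metis norm_one poly_0)
    have "degree ([:- z0, 1:] * (R1 * ?S2 - R2 * ?S1)) = degree ?d" unfolding detK' using rs by (simp add: \<Delta>_def)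
    moreover have "R1 * ?S2 - R2 * ?S1 \<noteq> 0" using detK' dnz rs by (auto simp: \<Delta>_def)
    ultimately have deg: "degree (R1 * ?S2 - R2 * ?S1) < degree ?d" by (subst (asm) degree_mult_eq) auto
    have "poly (R1 * ?S2 - R2 * ?S1) w \<noteq> 0" if w: "norm w = 1" for w
    proof
      assume "poly (R1 * ?S2 - R2 * ?S1) w = 0"
      then have "poly ([:- z0, 1:] * (R1 * ?S2 - R2 * ?S1)) w = 0" by (simp only: poly_mult mult_zero_right)
      then show False unfolding detK' using less.prems[OF w] rs by (simp add: \<Delta>_def)
    qed
    then obtain l1 l2 where "bounded_factorization \<mu> (\<lambda>x. mat2 (poly R1 (cay x)) (poly R2 (cay x)) (poly ?S1 (cay x)) (poly ?S2 (cay x))) l1 l2"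
      using less.hyps[OF deg] by blast
    then obtain k1 k2 where fac: "bounded_factorization \<mu> (\<lambda>x. mat2 (cay x) 0 0 1 ** mat2 (poly R1 (cay x)) (poly R2 (cay x)) (poly ?S1 (cay x)) (poly ?S2 (cay x))) k1 k2"
      using bounded_factorization_row_cay[OF _ \<mu>] by blast
    let ?m = "\<lambda>x. 1 - z0 * disc_coord 1 x"
    let ?L = "\<lambda>x. mat2 (s / \<Delta> * ?m x) (- q / \<Delta>) (- r / \<Delta> * ?m x) (p / \<Delta>)"
    have m: "?m \<in> disc_alg \<mu> 1" using \<mu> \<mu>' by (intro disc_alg_diff disc_alg_mult disc_alg_const disc_coord_disc_alg) auto
    have mF: "(\<lambda>z. 1 - z0 * z) \<in> disc_functions" by (auto simp: disc_functions_def intro!: continuous_intros holomorphic_intros)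
    have mnz: "1 - z0 * z \<noteq> 0" if "norm z \<le> 1" for z
    proof
      assume "1 - z0 * z = 0"
      then have "norm (z0 * z) = 1" by simp
      moreover have "norm (z0 * z) \<le> norm z0" using that by (simp add: norm_mult mult_left_le)
      ultimately show False using z0(1) by simp
    qed
    have minv: "(\<lambda>x. 1 / ?m x) \<in> disc_alg \<mu> 1"
      by (rule disc_alg_inverse[OF _ disc_alg_C_mu[OF m] mF]) (use mnz in auto)
    have L: "?L \<in> mat2_units_on Rdot (disc_alg \<mu> 1)"
    proof (rule mat2_unitI[OF _ disc_alg_mult[OF disc_alg_const[of \<Delta>] minv \<mu>(1)] _ \<mu>(1)])
      show "?L \<in> mat2_over (disc_alg \<mu> 1)" by (intro mat2_overI disc_alg_mult disc_alg_const m \<mu>)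
      fix x assume x: "x \<in> Rdot"
      have n: "?m x \<noteq> 0" using mnz norm_disc_coord[OF _ x, of 1] by simp
      have "s / \<Delta> * y * (p / \<Delta>) - (- q / \<Delta>) * (- r / \<Delta> * y) = y * (p * s - q * r) / (\<Delta> * \<Delta>)" for y
        by (simp add: diff_divide_distrib right_diff_distrib ac_simps)
      then have "det (?L x) = ?m x * (p * s - q * r) / (\<Delta> * \<Delta>)" by (simp only: mat2_det)
      then show "det (?L x) * (\<Delta> * (1 / ?m x)) = 1" using n rs by (simp add: \<Delta>_def)
    qed
    have "bounded_factorization \<mu> ?K k1 k2"
    proof (rule bounded_factorization_mult[OF fac \<mu> L mat2_unit_one[OF \<mu>(1)]])
      fix x assume x: "x \<in> Rdot"
      have mc: "?m x * cay x = cay x - z0" using cay_nonzero[OF x] by (simp add: disc_coord_lower field_simps)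
      have R': "(cay x - z0) * poly R1 (cay x) = p * poly K11 (cay x) + q * poly K21 (cay x)"
        "(cay x - z0) * poly R2 (cay x) = p * poly K12 (cay x) + q * poly K22 (cay x)"
        using arg_cong[OF R(1), of "\<lambda>P. poly P (cay x)"] arg_cong[OF R(2), of "\<lambda>P. poly P (cay x)"] by (simp_all add: algebra_simps)
      have \<Delta>: "\<Delta> \<noteq> 0" using rs by (simp add: \<Delta>_def)
      have e: "s / \<Delta> * ?m x * (cay x * y) = s * ((cay x - z0) * y) / \<Delta>" "- r / \<Delta> * ?m x * (cay x * y) = - r * ((cay x - z0) * y) / \<Delta>" for y
        by (simp_all flip: mc)
      have "?L x ** (mat2 (cay x) 0 0 1 ** mat2 (poly R1 (cay x)) (poly R2 (cay x)) (poly ?S1 (cay x)) (poly ?S2 (cay x))) = ?K x"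
        unfolding mat2_mult e R' mult_zero_left add_0_right add_0_left mult_1_left poly_add poly_smult
        using \<Delta> by (simp add: mat2_eq_iff divide_simps) (simp add: \<Delta>_def algebra_simps)
      then show "?K x = ?L x ** (mat2 (cay x) 0 0 1 ** mat2 (poly R1 (cay x)) (poly R2 (cay x)) (poly ?S1 (cay x)) (poly ?S2 (cay x))) ** mat 1"
        by simp
    qed
    then show ?thesis by blast
  qed
qed

section \<open>Matrices with given values of the symbol\<close>

text \<open>The matrix of the class under consideration whose symbol takes the values \<open>g1\<close> and \<open>g2\<close> on the
  two curves over the line, where \<open>t\<close> and \<open>- t\<close> are the values of \<open>\<tau> / p\<^sub>2\<close>.\<close>

definition symb :: "complex \<Rightarrow> complex \<Rightarrow> complex \<Rightarrow> complex^2^2" where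
  "symb t g1 g2 = mat2 ((g1 + g2) / 2) ((g1 - g2) / (2 * t)) (t * (g1 - g2) / 2) ((g1 + g2) / 2)"

lemma symb_mult: "t \<noteq> 0 \<Longrightarrow> symb t g1 g2 ** symb t h1 h2 = symb t (g1 * h1) (g2 * h2)"
  by (simp add: symb_def mat2_mult mat2_eq_iff) (simp add: field_simps)

lemma symb_components: "t \<noteq> 0 \<Longrightarrow> symb t (a + t * d) (a - t * d) = mat2 a d (t\<^sup>2 * d) a"
  by (simp add: symb_def mat2_eq_iff) (simp add: field_simps power2_eq_square)

lemma symb_det: "t \<noteq> 0 \<Longrightarrow> det (symb t g1 g2) = g1 * g2"
  by (simp add: symb_def mat2_det) (simp add: field_simps)

lemma C_Q_symb:
  assumes "G \<in> C_Q k0 \<mu>" "k0 > 1" "x \<in> Rdot"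
  shows "G x = symb (t_line k0 1 x) (G x $ 1 $ 1 + t_line k0 1 x * G x $ 1 $ 2) (G x $ 1 $ 1 - t_line k0 1 x * G x $ 1 $ 2)"
proof -
  have "t_line k0 1 x \<noteq> 0" using norm_t_line[OF assms(2) _ assms(3), of 1] by auto
  then show ?thesis
    using C_Q_form[OF assms] q_fun_t_line[OF assms(2,3)] by (subst symb_components) auto
qed


subsection \<open>Exponentials\<close>

text \<open>The entire functions with \<open>cosh z = cosh_sqrt (z\<^sup>2)\<close> and \<open>sinh z = z * sinhc_sqrt (z\<^sup>2)\<close>.\<close>

definition cosh_sqrt :: "complex \<Rightarrow> complex" where
  "cosh_sqrt w = cosh (csqrt w)"

definition sinhc_sqrt :: "complex \<Rightarrow> complex" where
  "sinhc_sqrt w = (if w = 0 then 1 else sinh (csqrt w) / csqrt w)"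

lemma csqrt_square_cases: "csqrt (z\<^sup>2) = z \<or> csqrt (z\<^sup>2) = - z"
proof -
  have "(csqrt (z\<^sup>2))\<^sup>2 = z\<^sup>2" by simp
  then show ?thesis by (simp only: power2_eq_iff)
qed

lemma cosh_sqrt_square: "cosh_sqrt (z\<^sup>2) = cosh z"
  using csqrt_square_cases[of z] by (auto simp: cosh_sqrt_def)

lemma sinhc_sqrt_square: "z * sinhc_sqrt (z\<^sup>2) = sinh z"
  using csqrt_square_cases[of z] by (auto simp: sinhc_sqrt_def)

lemma holomorphic_on_UNIV_if_power_series:
  assumes "\<And>w. (\<lambda>n. a n * w ^ n) sums f w" shows "f holomorphic_on UNIV"
proof -
  have "f holomorphic_on ball 0 r" for r by (rule power_series_holomorphic[where a=a]) (use assms in simp)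
  then have "f field_differentiable at w" for w
    using holomorphic_on_imp_differentiable_at[of f "ball 0 (norm w + 1)" w] by auto
  then show ?thesis by (auto simp: holomorphic_on_def intro: field_differentiable_at_within)
qed

lemma cosh_sqrt_entire: "cosh_sqrt holomorphic_on UNIV"
proof (rule holomorphic_on_UNIV_if_power_series)
  fix w :: complex
  have "(\<lambda>n. (\<lambda>n. if even n then csqrt w ^ n /\<^sub>R fact n else 0) (2 * n)) sums cosh (csqrt w)"
    by (subst sums_mono_reindex) (auto simp: strict_mono_def cosh_converges elim!: evenE)
  then show "(\<lambda>n. of_real (inverse (fact (2 * n))) * w ^ n) sums cosh_sqrt w"
    by (simp add: cosh_sqrt_def power_mult scaleR_conv_of_real)
qed

lemma sinhc_sqrt_entire: "sinhc_sqrt holomorphic_on UNIV"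
proof (rule holomorphic_on_UNIV_if_power_series)
  fix w :: complex
  show "(\<lambda>n. of_real (inverse (fact (2 * n + 1))) * w ^ n) sums sinhc_sqrt w"
  proof (cases "w = 0")
    case True
    show ?thesis using powser_sums_zero[of "\<lambda>n. complex_of_real (inverse (fact (2 * n + 1)))"] by (simp add: True sinhc_sqrt_def)
  next
    case False
    have "(\<lambda>n. (\<lambda>n. if even n then 0 else csqrt w ^ n /\<^sub>R fact n) (2 * n + 1)) sums sinh (csqrt w)"
      by (subst sums_mono_reindex) (auto simp: strict_mono_def sinh_converges elim!: oddE)
    then have "(\<lambda>n. csqrt w ^ (2 * n + 1) /\<^sub>R fact (2 * n + 1) / csqrt w) sums (sinh (csqrt w) / csqrt w)"
      by (intro sums_divide) simp
    moreover have "csqrt w ^ (2 * n + 1) /\<^sub>R fact (2 * n + 1) / csqrt w = of_real (inverse (fact (2 * n + 1))) * w ^ n" for n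
      using False by (simp add: power_mult scaleR_conv_of_real del: fact_Suc of_real_inverse)
    ultimately show ?thesis using False by (simp only: sinhc_sqrt_def if_False)
  qed
qed

lemma symb_exp:
  assumes "t \<noteq> 0"
  shows "symb t (exp (a + t * d)) (exp (a - t * d)) =
    mat2 (exp a * cosh_sqrt (t\<^sup>2 * d * d)) (exp a * (d * sinhc_sqrt (t\<^sup>2 * d * d)))
         (exp a * (t\<^sup>2 * d * sinhc_sqrt (t\<^sup>2 * d * d))) (exp a * cosh_sqrt (t\<^sup>2 * d * d))"
proof -
  have td: "t\<^sup>2 * d * d = (t * d)\<^sup>2" by (simp add: power2_eq_square)
  have c: "exp (a + t * d) + exp (a - t * d) = 2 * (exp a * cosh_sqrt (t\<^sup>2 * d * d))"
    unfolding td cosh_sqrt_square by (simp add: exp_add exp_diff cosh_def exp_minus scaleR_conv_of_real) (simp add: field_simps)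
  have "exp (a + t * d) - exp (a - t * d) = 2 * (exp a * sinh (t * d))"
    by (simp add: exp_add exp_diff sinh_def exp_minus scaleR_conv_of_real) (simp add: field_simps)
  also have "sinh (t * d) = t * d * sinhc_sqrt (t\<^sup>2 * d * d)" unfolding td sinhc_sqrt_square ..
  finally have s: "exp (a + t * d) - exp (a - t * d) = 2 * (exp a * (t * d * sinhc_sqrt (t\<^sup>2 * d * d)))" .
  show ?thesis unfolding symb_def c s using assms by (simp add: mat2_eq_iff power2_eq_square)
qed

lemma mat2_over_cong:
  assumes "X \<in> mat2_over (disc_alg \<mu> e)" and "\<And>x. x \<in> Rdot \<Longrightarrow> Y x = X x"
  shows "Y \<in> mat2_over (disc_alg \<mu> e)"
  unfolding mat2_over_def
proof (intro CollectI allI)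
  fix i j
  have "(\<lambda>x. X x $ i $ j) \<in> disc_alg \<mu> e" using assms(1) by (simp add: mat2_over_def)
  then show "(\<lambda>x. Y x $ i $ j) \<in> disc_alg \<mu> e" by (rule disc_alg_cong) (simp add: assms(2))
qed

text \<open>The square root \<open>t\<close> does not extend analytically, but the entries only involve its square.\<close>

lemma symb_exp_unit:
  assumes k: "k0 > 1" and \<mu>: "0 < \<mu>" and A: "a \<in> disc_alg \<mu> e" "d \<in> disc_alg \<mu> e" "v \<in> disc_alg \<mu> e"
    and v: "\<And>x. x \<in> Rdot \<Longrightarrow> v x = (t_line k0 1 x)\<^sup>2 * d x"
  shows "(\<lambda>x. symb (t_line k0 1 x) (exp (a x + t_line k0 1 x * d x)) (exp (a x - t_line k0 1 x * d x)))
      \<in> mat2_units_on Rdot (disc_alg \<mu> e)" (is "?X \<in> _")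
proof (rule mat2_unitI[where d="\<lambda>x. exp (- 2 * a x)", OF _ _ _ \<mu>])
  have t: "t_line k0 1 x \<noteq> 0" if "x \<in> Rdot" for x using norm_t_line[OF k _ that, of 1] by auto
  have vd: "(\<lambda>x. v x * d x) \<in> disc_alg \<mu> e" by (intro disc_alg_mult A \<mu>)
  have ex: "(\<lambda>x. exp (a x)) \<in> disc_alg \<mu> e" by (rule disc_alg_entire[OF A(1) \<mu>]) (intro holomorphic_intros)
  have "(\<lambda>x. mat2 (exp (a x) * cosh_sqrt (v x * d x)) (exp (a x) * (d x * sinhc_sqrt (v x * d x)))
      (exp (a x) * (v x * sinhc_sqrt (v x * d x))) (exp (a x) * cosh_sqrt (v x * d x))) \<in> mat2_over (disc_alg \<mu> e)"
    by (intro mat2_overI disc_alg_mult ex A disc_alg_entire[OF vd \<mu> cosh_sqrt_entire] disc_alg_entire[OF vd \<mu> sinhc_sqrt_entire] \<mu>)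
  then show "?X \<in> mat2_over (disc_alg \<mu> e)"
    by (rule mat2_over_cong) (simp only: symb_exp[OF t] v)
  show "(\<lambda>x. exp (- 2 * a x)) \<in> disc_alg \<mu> e"
    by (rule disc_alg_entire[OF A(1) \<mu>, where \<phi>="\<lambda>z. exp (- 2 * z)"]) (intro holomorphic_intros)
  show "det (?X x) * exp (- 2 * a x) = 1" if "x \<in> Rdot" for x
    by (simp add: symb_det[OF t[OF that]] flip: exp_add)
qed

lemma t_line_square_disc_alg:
  assumes k: "k0 > 1" and e: "e \<in> {1, -1}" and \<mu>: "0 < \<mu>" "\<mu> \<le> 1"
  shows "(\<lambda>x. (t_line k0 e x)\<^sup>2) \<in> disc_alg \<mu> e"
proof (rule disc_algI[where F="blaschke k0"])
  show "(\<lambda>x. (t_line k0 e x)\<^sup>2) \<in> C_mu \<mu>"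
    unfolding power2_eq_square by (intro C_mu_mult t_line_C_mu k e \<mu>)
  show "blaschke k0 \<in> disc_functions" using blaschke_continuous[OF k] blaschke_holomorphic[OF k] by (simp add: disc_functions_def)
qed (use t_line_square[OF k e] in auto)

lemma t_line_square_cay:
  assumes k: "k0 > 1" and x: "x \<in> Rdot"
  shows "cay x - of_real (branch_zero k0) \<noteq> 0"
    and "(t_line k0 1 x)\<^sup>2 = (1 - of_real (branch_zero k0) * cay x) / (cay x * (cay x - of_real (branch_zero k0)))"
proof -
  let ?a = "complex_of_real (branch_zero k0)"
  have "norm ?a < norm (cay x)" using branch_zero_bounds[OF k] norm_cay[OF x] by simp
  then show "cay x - ?a \<noteq> 0" by auto
  have c0: "cay x \<noteq> 0" by (rule cay_nonzero[OF x])
  have "1 - ?a * (1 / cay x) = (cay x - ?a) / cay x" "1 / cay x - ?a = (1 - ?a * cay x) / cay x"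
    using c0 by (simp_all add: diff_divide_distrib)
  then have "blaschke k0 (1 / cay x) = (1 - ?a * cay x) / (cay x * (cay x - ?a))"
    unfolding blaschke_def using c0 by simp
  then show "(t_line k0 1 x)\<^sup>2 = (1 - ?a * cay x) / (cay x * (cay x - ?a))"
    using t_line_square[OF k _ x, of 1] by (simp add: disc_coord_lower)
qed


section \<open>The obstruction to an additive splitting\<close>

text \<open>For a right factor the odd part of the logarithm must vanish at both zeros of \<open>1 / q\<close> in the upper
  half-plane, and only a constant can be moved between the two factors. This functional
  measures the failure. Up to a constant factor it is the integral of the odd function \<open>t f\<close> on the
  surface against the holomorphic differential \<open>d\<xi> / \<tau>\<close>.\<close>

definition obstruction :: "real \<Rightarrow> (complex option \<Rightarrow> complex) \<Rightarrow> complex" where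
  "obstruction k0 f = integral {0..1} (\<lambda>x. on_circle f (circ x) * (circ x / (circ x - of_real (branch_zero k0)) - 1))"

lemma on_circle_continuous: "f \<in> C_mu \<mu> \<Longrightarrow> 0 < \<mu> \<Longrightarrow> continuous_on (sphere 0 1) (on_circle f)"
  using on_circle_hoelder hoelder_circle_continuous by metis

lemma obstruction_integrable:
  assumes k: "k0 > 1" and f: "f \<in> C_mu \<mu>" "0 < \<mu>"
  shows "(\<lambda>x. on_circle f (circ x) * (circ x / (circ x - of_real (branch_zero k0)) - 1)) integrable_on {0..1}"
proof -
  have "norm (complex_of_real (branch_zero k0)) < 1" using branch_zero_bounds[OF k] by simp
  from circ_minus_nonzero[OF this] show ?thesis
    using continuous_on_circ_comp[OF on_circle_continuous[OF f]]
    by (intro integrable_continuous_interval continuous_intros) auto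
qed

lemma obstruction_cauchy_int:
  assumes k: "k0 > 1" and f: "f \<in> C_mu \<mu>" "0 < \<mu>"
  shows "obstruction k0 f = cauchy_int (on_circle f) (of_real (branch_zero k0)) - cauchy_int (on_circle f) 0"
proof -
  have b: "norm (complex_of_real (branch_zero k0)) < 1" using branch_zero_bounds[OF k] by simp
  note i = cauchy_int_integrable[OF on_circle_continuous[OF f] b]
  have z: "norm (0::complex) < 1" by simp
  note i0 = cauchy_int_integrable[OF on_circle_continuous[OF f] z]
  show ?thesis
    unfolding obstruction_def cauchy_int_def integral_diff[OF i i0, symmetric]
    by (rule integral_cong) (simp add: right_diff_distrib)
qed

lemma obstruction_diff:
  assumes k: "k0 > 1" and f: "f \<in> C_mu \<mu>" "g \<in> C_mu \<mu>" "0 < \<mu>"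
  shows "obstruction k0 (\<lambda>x. f x - g x) = obstruction k0 f - obstruction k0 g"
proof -
  have "on_circle (\<lambda>x. f x - g x) w = on_circle f w - on_circle g w" for w by (simp add: on_circle_def)
  then show ?thesis
    unfolding obstruction_def
    using obstruction_integrable[OF k f(1,3)] obstruction_integrable[OF k f(2,3)]
    by (subst integral_diff[symmetric]) (auto simp: left_diff_distrib)
qed

lemma obstruction_bound:
  assumes k: "k0 > 1" and f: "f \<in> C_mu \<mu>" "0 < \<mu>" and B: "\<And>x. x \<in> Rdot \<Longrightarrow> norm (f x) \<le> B"
  shows "norm (obstruction k0 f) \<le> B * (1 + 1 / (1 - branch_zero k0))"
proof -
  let ?b = "complex_of_real (branch_zero k0)"
  have b: "0 < branch_zero k0" "branch_zero k0 < 1" using branch_zero_bounds[OF k] by auto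
  have B0: "B \<ge> 0" using order_trans[OF norm_ge_zero B[of None]] by (simp add: Rdot_def)
  have "norm (obstruction k0 f) \<le> integral {0..1} (\<lambda>x::real. B * (1 + 1 / (1 - branch_zero k0)))"
    unfolding obstruction_def
  proof (rule integral_norm_bound_integral[OF obstruction_integrable[OF k f]])
    fix x :: real
    obtain y where "y \<in> Rdot" "on_circle f (circ x) = f y" by (rule on_circle_some[OF norm_circ]) (rule that; assumption)
    then have 1: "norm (on_circle f (circ x)) \<le> B" using B by simp
    have d: "norm (circ x - ?b) \<ge> 1 - branch_zero k0" using norm_triangle_ineq2[of "circ x" ?b] b by simp
    have "norm (circ x / (circ x - ?b) - 1) \<le> norm (circ x / (circ x - ?b)) + norm (1::complex)" by (rule norm_triangle_ineq4)
    also have "norm (circ x / (circ x - ?b)) \<le> 1 / (1 - branch_zero k0)"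
      unfolding norm_divide norm_circ using d b by (intro divide_left_mono mult_pos_pos) auto
    finally have 2: "norm (circ x / (circ x - ?b) - 1) \<le> 1 + 1 / (1 - branch_zero k0)" by simp
    show "norm (on_circle f (circ x) * (circ x / (circ x - ?b) - 1)) \<le> B * (1 + 1 / (1 - branch_zero k0))"
      unfolding norm_mult using 1 2 B0 by (intro mult_mono) auto
  qed (rule integrable_const_ivl)
  then show ?thesis by simp
qed

text \<open>If the obstruction vanishes, the logarithm splits, and the exponentials of its two parts are a left
  and a right factor.\<close>

lemma exponential_splitting:
  assumes k: "k0 > 1" and \<mu>: "0 < \<mu>" "\<mu> < 1" and a: "a \<in> C_mu \<mu>" and d: "d \<in> C_mu \<mu>" "obstruction k0 d = 0"
  obtains am dm ap dp where
    "(\<lambda>x. symb (t_line k0 1 x) (exp (am x + t_line k0 1 x * dm x)) (exp (am x - t_line k0 1 x * dm x))) \<in> mat2_units_on Rdot (disc_alg \<mu> 1)"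
    "(\<lambda>x. symb (t_line k0 1 x) (exp (ap x + t_line k0 1 x * dp x)) (exp (ap x - t_line k0 1 x * dp x))) \<in> mat2_units_on Rdot (disc_alg \<mu> (-1))"
    "\<And>x. x \<in> Rdot \<Longrightarrow> a x = am x + ap x" "\<And>x. x \<in> Rdot \<Longrightarrow> d x = dm x + dp x"
proof -
  have \<mu>': "\<mu> \<le> 1" using \<mu> by simp
  let ?b = "complex_of_real (branch_zero k0)"
  have b: "norm ?b < 1" "?b \<noteq> 0" using branch_zero_bounds[OF k] by auto
  have e: "(-1::real) \<in> {1, -1}" by simp
  obtain A am where A: "A \<in> disc_functions" "(\<lambda>x. A (cay x)) \<in> C_mu \<mu>" "am \<in> disc_alg \<mu> 1" "\<And>x. x \<in> Rdot \<Longrightarrow> a x = A (cay x) + am x"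
    by (rule C_mu_splitting[OF a \<mu>]) (rule that; assumption)
  have ap: "(\<lambda>x. A (cay x)) \<in> disc_alg \<mu> (-1)" by (rule disc_algI[OF A(2,1)]) (simp add: disc_coord_upper)
  obtain H hm where H: "H \<in> disc_functions" "\<And>z. norm z < 1 \<Longrightarrow> H z = cauchy_int (on_circle d) z"
    "(\<lambda>x. H (cay x)) \<in> C_mu \<mu>" "hm \<in> disc_alg \<mu> 1" "\<And>x. x \<in> Rdot \<Longrightarrow> d x = H (cay x) + hm x"
    by (rule C_mu_splitting[OF d(1) \<mu>]) (rule that; assumption)
  have H0: "H ?b = H 0" using d(2) obstruction_cauchy_int[OF k d(1) \<mu>(1)] H(2)[OF b(1)] H(2)[of 0] by simp
  define P where "P z = H z - H 0" for z
  define dp where "dp x = P (cay x)" for x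
  define dm where "dm x = hm x + H 0" for x
  have P: "P \<in> disc_functions" "P 0 = 0" "P ?b = 0"
    using H(1) H0 by (auto simp: P_def[abs_def] disc_functions_def intro!: continuous_intros holomorphic_intros)
  have dpC: "dp \<in> C_mu \<mu>" unfolding dp_def P_def by (intro C_mu_diff H C_mu_const)
  have dp: "dp \<in> disc_alg \<mu> (-1)" by (rule disc_algI[OF dpC P(1)]) (simp add: dp_def disc_coord_upper)
  have dpP: "dp x = P (disc_coord (-1) x)" for x by (simp add: dp_def disc_coord_upper)
  have dm: "dm \<in> disc_alg \<mu> 1" unfolding dm_def by (intro disc_alg_add H disc_alg_const)
  have n0: "norm (0::complex) < 1" by simp
  obtain P1 where P1: "P1 \<in> disc_functions" "(\<lambda>x. dp x / (disc_coord (-1) x - 0)) \<in> C_mu \<mu>"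
    "\<And>x. x \<in> Rdot \<Longrightarrow> dp x / (disc_coord (-1) x - 0) = P1 (disc_coord (-1) x)" "\<And>z. norm z \<le> 1 \<Longrightarrow> P z = (z - 0) * P1 z"
    by (rule disc_alg_divide_zero[OF e \<mu>(1) \<mu>' dpC P(1) dpP n0 P(2)]) (rule that; assumption)
  have "P1 ?b = 0" using P1(4)[of ?b] P(3) b by simp
  then obtain P2 where P2: "P2 \<in> disc_functions" "(\<lambda>x. dp x / (disc_coord (-1) x - 0) / (disc_coord (-1) x - ?b)) \<in> C_mu \<mu>"
    "\<And>x. x \<in> Rdot \<Longrightarrow> dp x / (disc_coord (-1) x - 0) / (disc_coord (-1) x - ?b) = P2 (disc_coord (-1) x)"
    using disc_alg_divide_zero[OF e \<mu>(1) \<mu>' P1(2,1,3) b(1)] by (metis (no_types, lifting))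
  define v where "v x = (1 - ?b * disc_coord (-1) x) * (dp x / (disc_coord (-1) x - 0) / (disc_coord (-1) x - ?b))" for x
  have v: "v \<in> disc_alg \<mu> (-1)"
    unfolding v_def by (intro disc_alg_mult disc_alg_diff disc_alg_const disc_coord_disc_alg e \<mu> \<mu>' disc_algI[OF P2(2,1,3)])
  have vq: "v x = (t_line k0 1 x)\<^sup>2 * dp x" if x: "x \<in> Rdot" for x
    by (simp add: v_def t_line_square_cay[OF k x] disc_coord_upper)
  have dmq: "(\<lambda>x. (t_line k0 1 x)\<^sup>2 * dm x) \<in> disc_alg \<mu> 1" by (intro disc_alg_mult t_line_square_disc_alg k dm \<mu> \<mu>') simp
  show ?thesis
    by (rule that[OF symb_exp_unit[OF k \<mu>(1) A(3) dm dmq refl] symb_exp_unit[OF k \<mu>(1) ap dp v vq]])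
      (simp_all add: A(4) H(5) dm_def dp_def P_def)
qed

text \<open>The family \<open>1 + s r\<^sub>0\<close>: its obstruction is an analytic function of \<open>s\<close> with nonzero derivative at \<open>0\<close>,
  so by the open mapping theorem every small value is attained. This takes the place of Jacobi
  inversion.\<close>

definition r0_log :: "real \<Rightarrow> complex \<Rightarrow> complex option \<Rightarrow> complex" where
  "r0_log k0 s x = (Ln (1 + s * (cay x * t_line k0 1 x)) - Ln (1 - s * (cay x * t_line k0 1 x))) / (2 * t_line k0 1 x)"

lemma Ln_C_mu:
  assumes f: "f \<in> C_mu \<mu>" and n: "\<And>x. x \<in> Rdot \<Longrightarrow> norm (f x - 1) \<le> 1/2"
  shows "(\<lambda>x. Ln (f x)) \<in> C_mu \<mu>"
proof (rule C_mu_comp_holomorphic[OF f, where S="{z. Re z > 0}" and K="cball 1 (1/2)"])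
  show "Ln holomorphic_on {z. 0 < Re z}" by (intro holomorphic_intros) (auto simp: complex_nonpos_Reals_iff)
  show "open {z::complex. 0 < Re z}" by (rule open_halfspace_Re_gt)
  show "cball 1 (1/2) \<subseteq> {z. 0 < Re z}"
  proof
    fix z :: complex assume "z \<in> cball 1 (1/2)"
    then have "norm (1 - z) \<le> 1/2" by (simp add: dist_norm)
    then show "z \<in> {z. 0 < Re z}" using complex_Re_le_cmod[of "1 - z"] by simp
  qed
  show "f x \<in> cball 1 (1/2)" if "x \<in> Rdot" for x using n[OF that] by (simp add: dist_norm norm_minus_commute)
qed auto

lemma C_mu_divide_t_line:
  assumes "k0 > 1" "0 < \<mu>" "\<mu> \<le> 1" "f \<in> C_mu \<mu>"
  shows "(\<lambda>x. f x / (2 * t_line k0 1 x)) \<in> C_mu \<mu>"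
proof -
  have "(\<lambda>x. f x * (1 / 2 * t_line k0 (-1) x)) \<in> C_mu \<mu>" by (intro C_mu_mult C_mu_const t_line_C_mu assms) auto
  then show ?thesis
  proof (rule C_mu_cong)
    fix x assume x: "x \<in> Rdot"
    have "t_line k0 1 x * t_line k0 (-1) x = 1" using t_line_mult[OF assms(1) _ x, of 1] by simp
    then have "t_line k0 (-1) x = 1 / t_line k0 1 x" by (metis mult_eq_0_iff nonzero_mult_div_cancel_left one_neq_zero)
    then show "f x / (2 * t_line k0 1 x) = f x * (1 / 2 * t_line k0 (-1) x)" by simp
  qed
qed

lemma norm_r0_line: "k0 > 1 \<Longrightarrow> x \<in> Rdot \<Longrightarrow> norm (cay x * t_line k0 1 x) = 1"
  using norm_t_line[of k0 1 x] norm_cay by (simp add: norm_mult)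

lemma r0_log_C_mu:
  assumes k: "k0 > 1" and \<mu>: "0 < \<mu>" "\<mu> \<le> 1" and s: "norm s \<le> 1/2"
  shows "r0_log k0 s \<in> C_mu \<mu>"
  unfolding r0_log_def
proof (rule C_mu_divide_t_line[OF k \<mu>], rule C_mu_diff; rule Ln_C_mu)
  have r: "(\<lambda>x. s * (cay x * t_line k0 1 x)) \<in> C_mu \<mu>" by (intro C_mu_mult C_mu_const C_mu_cay t_line_C_mu k \<mu>) auto
  show "(\<lambda>x. 1 + s * (cay x * t_line k0 1 x)) \<in> C_mu \<mu>" "(\<lambda>x. 1 - s * (cay x * t_line k0 1 x)) \<in> C_mu \<mu>"
    by (intro C_mu_add C_mu_diff C_mu_const r)+
  fix x assume x: "x \<in> Rdot"
  have "norm (s * (cay x * t_line k0 1 x)) \<le> 1/2" using s norm_r0_line[OF k x] by (subst norm_mult) simp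
  then show "norm (1 + s * (cay x * t_line k0 1 x) - 1) \<le> 1/2" "norm (1 - s * (cay x * t_line k0 1 x) - 1) \<le> 1/2" by simp_all
qed

lemma r0_log_obstruction_surj:
  assumes k: "k0 > 1"
  obtains \<eta> where "\<eta> > 0" "\<And>\<kappa>. norm \<kappa> < \<eta> \<Longrightarrow> \<exists>s. norm s < 1/2 \<and> obstruction k0 (r0_log k0 s) = \<kappa>"
proof -
  let ?b = "complex_of_real (branch_zero k0)"
  have b: "norm ?b < 1" "?b \<noteq> 0" using branch_zero_bounds[OF k] by auto
  define t where "t x = on_circle (t_line k0 1) (circ x)" for x
  define \<rho> where "\<rho> x = on_circle (\<lambda>x. cay x * t_line k0 1 x) (circ x)" for x
  define ker where "ker x = circ x / (circ x - ?b) - 1" for x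
  have tC: "t_line k0 1 \<in> C_mu (1/2)" and rC: "(\<lambda>x. cay x * t_line k0 1 x) \<in> C_mu (1/2)"
    by (intro C_mu_mult C_mu_cay t_line_C_mu k; simp)+
  have ct: "continuous_on {0..1} t" unfolding t_def by (intro continuous_on_circ_comp on_circle_continuous[OF tC]) simp
  have c\<rho>: "continuous_on {0..1} \<rho>" unfolding \<rho>_def by (intro continuous_on_circ_comp on_circle_continuous[OF rC]) simp
  have cker: "continuous_on {0..1} ker" unfolding ker_def using circ_minus_nonzero[OF b(1)] by (intro continuous_intros) auto
  have pt: "t x \<noteq> 0 \<and> norm (\<rho> x) = 1 \<and> \<rho> x = circ x * t x" for x
  proof -
    have "\<exists>y. y \<in> Rdot \<and> cay y = circ x" using disc_coord_onto_circle[of "-1" "circ x"] by (auto simp: disc_coord_upper)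
    then have "(SOME y. y \<in> Rdot \<and> cay y = circ x) \<in> Rdot \<and> cay (SOME y. y \<in> Rdot \<and> cay y = circ x) = circ x" by (rule someI_ex)
    then obtain y where "y \<in> Rdot" "cay y = circ x" "t x = t_line k0 1 y" "\<rho> x = cay y * t_line k0 1 y" by (auto simp: t_def \<rho>_def on_circle_def)
    then show ?thesis using norm_r0_line[OF k] norm_t_line[OF k, of 1] by fastforce
  qed
  define f where "f s x = (Ln (1 + s * \<rho> x) - Ln (1 - s * \<rho> x)) / (2 * t x) * ker x" for s x
  define fs where "fs s x = (\<rho> x / (1 + s * \<rho> x) + \<rho> x / (1 - s * \<rho> x)) / (2 * t x) * ker x" for s x
  have obs: "obstruction k0 (r0_log k0 s) = integral (cbox 0 1) (f s)" for s
    by (simp add: obstruction_def r0_log_def f_def[abs_def] ker_def t_def \<rho>_def on_circle_def)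
  have nz: "Re (1 + s * \<rho> x) > 0" "Re (1 - s * \<rho> x) > 0" if "norm s < 1" for s x
  proof -
    have "norm (s * \<rho> x) < 1" using that conjunct1[OF conjunct2[OF pt[of x]]] by (simp only: norm_mult mult_1_right)
    then show "Re (1 + s * \<rho> x) > 0" "Re (1 - s * \<rho> x) > 0"
      using complex_Re_le_cmod[of "s * \<rho> x"] complex_Re_le_cmod[of "- (s * \<rho> x)"] by auto
  qed
  have pos: "z \<noteq> 0 \<and> z \<notin> \<real>\<^sub>\<le>\<^sub>0" if "Re z > 0" for z
    using that by (auto simp: complex_nonpos_Reals_iff)
  have nz': "1 + s * \<rho> x \<noteq> 0" "1 - s * \<rho> x \<noteq> 0" "1 + s * \<rho> x \<notin> \<real>\<^sub>\<le>\<^sub>0" "1 - s * \<rho> x \<notin> \<real>\<^sub>\<le>\<^sub>0" if "norm s < 1" for s x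
    using pos[OF nz(1)[OF that, of x]] pos[OF nz(2)[OF that, of x]] by blast+
  have df: "((\<lambda>s. f s x) has_field_derivative fs s x) (at s within ball 0 1)" if "s \<in> ball 0 1" for s x
  proof -
    have "((\<lambda>s. Ln (1 + s * \<rho> x) - Ln (1 - s * \<rho> x)) has_field_derivative (\<rho> x / (1 + s * \<rho> x) + \<rho> x / (1 - s * \<rho> x))) (at s within ball 0 1)"
      using nz'[of s x] that by (auto intro!: derivative_eq_intros simp: field_simps)
    then show ?thesis unfolding f_def fs_def by (intro DERIV_cmult_right DERIV_cdivide)
  qed
  have fi: "f s integrable_on cbox 0 1" if "s \<in> ball 0 1" for s
    unfolding f_def using nz'[of s] that pt
    by (intro integrable_continuous continuous_intros continuous_on_subset[OF ct] continuous_on_subset[OF c\<rho>] continuous_on_subset[OF cker]) auto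
  have c2: "continuous_on (ball 0 1 \<times> cbox 0 1) (\<lambda>p. g (snd p))" if "continuous_on {0..1} g" for g :: "real \<Rightarrow> complex"
    by (rule continuous_on_compose2[OF that]) (auto intro!: continuous_intros)
  have fsc: "continuous_on (ball 0 1 \<times> cbox 0 1) (\<lambda>(s, x). fs s x)"
    unfolding fs_def case_prod_beta using nz' pt
    by (intro continuous_intros c2[OF ct] c2[OF c\<rho>] c2[OF cker]) auto
  define K where "K s = integral (cbox 0 1) (f s)" for s
  have hol: "K holomorphic_on ball 0 1"
    unfolding K_def by (rule leibniz_rule_holomorphic[OF df fi fsc]) auto
  have "(K has_field_derivative integral (cbox 0 1) (fs 0)) (at 0 within ball 0 1)"
    unfolding K_def by (rule leibniz_rule_field_derivative[OF df fi fsc]) auto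
  moreover have "integral (cbox 0 1) (fs 0) = ?b"
  proof -
    have "fs 0 x = ?b * (1 * circ x / (circ x - ?b))" for x
    proof -
      have "ker x = ?b / (circ x - ?b)" using circ_minus_nonzero[OF b(1), of x] by (simp add: ker_def field_simps)
      then show ?thesis using pt[of x] by (simp add: fs_def)
    qed
    then have "integral (cbox 0 1) (fs 0) = integral {0..1} (\<lambda>x. ?b * (1 * circ x / (circ x - ?b)))" by (auto intro!: arg_cong[where f="integral _"])
    also have "\<dots> = ?b * cauchy_int (\<lambda>_. 1) ?b" unfolding cauchy_int_def by (rule integral_mult_right)
    finally show ?thesis by (simp only: cauchy_int_const[OF b(1)] mult_1_right)
  qed
  moreover have "at (0::complex) within ball 0 1 = at 0" by (rule at_within_open) auto
  ultimately have dK: "(K has_field_derivative ?b) (at 0)" by (simp only:)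
  have nc: "\<not> K constant_on ball 0 1"
  proof
    assume "K constant_on ball 0 1"
    then obtain c where c: "\<And>s. s \<in> ball 0 1 \<Longrightarrow> K s = c" by (auto simp: constant_on_def)
    have "(K has_field_derivative 0) (at 0)"
      by (rule has_field_derivative_transform_within_open[where S="ball 0 1" and f="\<lambda>_. c"]) (auto simp: c)
    then show False using DERIV_unique[OF dK] b(2) by simp
  qed
  have "open (K ` ball 0 (1/2))"
    by (rule open_mapping_thm[OF hol _ _ _ _ nc]) (auto intro: subset_ball)
  moreover have "K 0 = 0" by (simp add: K_def f_def[abs_def])
  then have "0 \<in> K ` ball 0 (1/2)" by (intro image_eqI[of _ _ 0]) auto
  ultimately obtain \<eta> where \<eta>: "\<eta> > 0" "ball 0 \<eta> \<subseteq> K ` ball 0 (1/2)" by (auto simp: open_contains_ball)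
  show ?thesis
  proof (rule that[OF \<eta>(1)])
    fix \<kappa> :: complex assume "norm \<kappa> < \<eta>"
    then have "\<kappa> \<in> K ` ball 0 (1/2)" using \<eta>(2) by auto
    then show "\<exists>s. norm s < 1/2 \<and> obstruction k0 (r0_log k0 s) = \<kappa>" by (auto simp: obs K_def)
  qed
qed

section \<open>Existence of a factorization\<close>

text \<open>On the unit circle the real polynomials in two variables are the Laurent polynomials, so the
  Weierstrass approximation theorem applies.\<close>

lemma real_polynomial_function_laurent:
  fixes f :: "complex \<Rightarrow> real"
  assumes "real_polynomial_function f"
  shows "\<exists>p N. \<forall>w. norm w = 1 \<longrightarrow> of_real (f w) = poly p w / w ^ N"
  using assms
proof (induction rule: real_polynomial_function.induct)
  case (linear f)
  show ?case
  proof (intro exI allI impI)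
    fix w :: complex assume w: "norm w = 1"
    then have w0: "w \<noteq> 0" by auto
    have "w * cnj w = 1" using w by (metis complex_norm_square of_real_1 power_one)
    then have cw: "cnj w = 1 / w" using w0 by (simp add: field_simps)
    have "w = Re w *\<^sub>R 1 + Im w *\<^sub>R \<i>" by (simp add: complex_eq_iff)
    then have "f w = f (Re w *\<^sub>R 1 + Im w *\<^sub>R \<i>)" by simp
    also have "\<dots> = Re w * f 1 + Im w * f \<i>"
      by (simp only: linear_simps[OF linear] real_scaleR_def)
    finally have "complex_of_real (f w) = of_real (Re w) * of_real (f 1) + of_real (Im w) * of_real (f \<i>)" by simp
    also have "of_real (Re w) = (w + 1 / w) / 2" using complex_add_cnj[of w] cw by simp
    also have "of_real (Im w) = (w - 1 / w) / (2 * \<i>)" using complex_diff_cnj[of w] cw by (simp add: field_simps)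
    also have "(w + 1 / w) / 2 * of_real (f 1) + (w - 1 / w) / (2 * \<i>) * of_real (f \<i>) =
        poly [:(of_real (f 1) + \<i> * of_real (f \<i>)) / 2, 0, (of_real (f 1) - \<i> * of_real (f \<i>)) / 2:] w / w ^ 1"
      using w0 by (simp add: field_simps)
    finally show "complex_of_real (f w) = poly [:(of_real (f 1) + \<i> * of_real (f \<i>)) / 2, 0, (of_real (f 1) - \<i> * of_real (f \<i>)) / 2:] w / w ^ 1" .
  qed
next
  case (const c)
  show ?case by (intro exI[of _ "[:of_real c:]"] exI[of _ 0]) simp
next
  case (add f g)
  then obtain p N q M where pq: "\<And>w. norm w = 1 \<Longrightarrow> of_real (f w) = poly p w / w ^ N" "\<And>w. norm w = 1 \<Longrightarrow> of_real (g w) = poly q w / w ^ M" by blast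
  show ?case
  proof (intro exI allI impI)
    fix w :: complex assume w: "norm w = 1"
    then have "w \<noteq> 0" by auto
    then show "of_real (f w + g w) = poly (p * monom 1 M + q * monom 1 N) w / w ^ (N + M)"
      using pq[OF w] by (simp add: poly_monom power_add add_divide_distrib)
  qed
next
  case (mult f g)
  then obtain p N q M where "\<And>w. norm w = 1 \<Longrightarrow> of_real (f w) = poly p w / w ^ N" "\<And>w. norm w = 1 \<Longrightarrow> of_real (g w) = poly q w / w ^ M" by blast
  then show ?case
    by (intro exI[of _ "p * q"] exI[of _ "N + M"]) (auto simp: power_add)
qed

lemma C_mu_laurent_approximation:
  assumes f: "f \<in> C_mu \<mu>" "0 < \<mu>" and \<epsilon>: "\<epsilon> > 0"
  obtains p N where "\<And>x M. x \<in> Rdot \<Longrightarrow> M \<ge> N \<Longrightarrow> norm (f x - poly (p * monom 1 (M - N)) (cay x) / cay x ^ M) < \<epsilon>"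
proof -
  obtain g where g: "polynomial_function g" "\<And>w. w \<in> sphere 0 1 \<Longrightarrow> norm (on_circle f w - g w) < \<epsilon>"
    using Stone_Weierstrass_polynomial_function[OF compact_sphere on_circle_continuous[OF f] \<epsilon>] by blast
  have "real_polynomial_function (Re \<circ> g)" "real_polynomial_function (Im \<circ> g)"
    using g(1) bounded_linear_Re bounded_linear_Im by (auto simp: polynomial_function_def)
  then obtain p N q M where pq: "\<And>w. norm w = 1 \<Longrightarrow> of_real ((Re \<circ> g) w) = poly p w / w ^ N" "\<And>w. norm w = 1 \<Longrightarrow> of_real ((Im \<circ> g) w) = poly q w / w ^ M"
    using real_polynomial_function_laurent by metis
  show ?thesis
  proof (rule that[where p="p * monom 1 M + smult \<i> (q * monom 1 N)" and N="N + M"])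
    fix x L assume x: "x \<in> Rdot" and L: "N + M \<le> L"
    let ?w = "cay x"
    have w: "norm ?w = 1" "?w \<noteq> 0" using norm_cay[OF x] by auto
    have "g ?w = of_real (Re (g ?w)) + \<i> * of_real (Im (g ?w))" by (simp add: complex_eq_iff)
    also have "\<dots> = poly p ?w / ?w ^ N + \<i> * (poly q ?w / ?w ^ M)" using pq[OF w(1)] by simp
    also have "\<dots> = poly (p * monom 1 M + smult \<i> (q * monom 1 N)) ?w / ?w ^ (N + M)"
      using w(2) by (simp add: poly_monom power_add add_divide_distrib)
    also have "\<dots> = poly ((p * monom 1 M + smult \<i> (q * monom 1 N)) * monom 1 (L - (N + M))) ?w / ?w ^ L"
    proof -
      have "?w ^ L = ?w ^ (N + M) * ?w ^ (L - (N + M))" using L by (simp flip: power_add)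
      then show ?thesis using w(2) by (simp add: poly_monom)
    qed
    finally show "norm (f x - poly ((p * monom 1 M + smult \<i> (q * monom 1 N)) * monom 1 (L - (N + M))) ?w / ?w ^ L) < \<epsilon>"
      using g(2)[of ?w] w(1) on_circle_cay[OF f(1) x] by simp
  qed
qed

text \<open>The square of \<open>t\<close> is a rational function of \<open>cay\<close> with the denominator \<open>cay (cay - b)\<close>. Multiplied by the
  square of this denominator and a power of \<open>cay\<close>, the matrix becomes a polynomial in \<open>cay\<close>.\<close>

lemma rational_symbol_factorization:
  assumes k: "k0 > 1" and \<mu>: "0 < \<mu>" "\<mu> < 1"
    and al: "\<And>x. x \<in> Rdot \<Longrightarrow> \<alpha> x = poly A (cay x) / cay x ^ N" and de: "\<And>x. x \<in> Rdot \<Longrightarrow> \<delta> x = poly B (cay x) / cay x ^ N"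
    and r: "\<And>x. r1 x = (\<alpha> x + t_line k0 1 x * \<delta> x) * (1 + s * (cay x * t_line k0 1 x))"
      "\<And>x. r2 x = (\<alpha> x - t_line k0 1 x * \<delta> x) * (1 - s * (cay x * t_line k0 1 x))"
    and nz: "\<And>x. x \<in> Rdot \<Longrightarrow> r1 x \<noteq> 0 \<and> r2 x \<noteq> 0"
  shows "\<exists>k1 k2. bounded_factorization \<mu> (\<lambda>x. symb (t_line k0 1 x) (r1 x) (r2 x)) k1 k2"
proof -
  have \<mu>': "\<mu> \<le> 1" using \<mu> by simp
  define b where "b = complex_of_real (branch_zero k0)"
  have b: "norm b < 1" using branch_zero_bounds[OF k] by (simp add: b_def)
  define P where "P = [:0, 1:] * [:- b, 1:]"
  define T where "T = [:1, - b:]"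
  define X where "X = [:0, s:]"
  define K11 K12 K21 K22 where "K11 = P * A * P + P * B * (X * T)" and "K12 = P * A * (X * P) + P * B * P"
    and "K21 = T * B * P + P * A * (X * T)" and "K22 = T * B * (X * P) + P * A * P"
  define c where "c x = cay x ^ N * (cay x * (cay x - b))\<^sup>2" for x
  have cnz: "c x \<noteq> 0" if "x \<in> Rdot" for x
    using t_line_square_cay(1)[OF k that] cay_nonzero[OF that] by (simp add: c_def b_def)
  let ?K = "\<lambda>x. mat2 (poly K11 (cay x)) (poly K12 (cay x)) (poly K21 (cay x)) (poly K22 (cay x))"
  have K: "?K x = mat2 (c x) 0 0 (c x) ** symb (t_line k0 1 x) (r1 x) (r2 x)" if x: "x \<in> Rdot" for x
  proof -
    let ?t = "t_line k0 1 x" and ?w = "cay x"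
    have t: "?t \<noteq> 0" using norm_t_line[OF k _ x, of 1] by auto
    have w: "?w \<noteq> 0" "?w - b \<noteq> 0" using cay_nonzero[OF x] t_line_square_cay(1)[OF k x] by (auto simp: b_def)
    define y where "y = ?w * (?w - b)"
    have y: "y \<noteq> 0" using w by (simp add: y_def)
    have q: "y * ?t\<^sup>2 = 1 - b * ?w" unfolding t_line_square_cay(2)[OF k x] using w by (simp add: y_def b_def)
    have "symb ?t (r1 x) (r2 x) = symb ?t (\<alpha> x + ?t * \<delta> x) (\<alpha> x - ?t * \<delta> x) ** symb ?t (1 + ?t * (s * ?w)) (1 - ?t * (s * ?w))"
      unfolding symb_mult[OF t] r by (simp add: ac_simps)
    also have "\<dots> = mat2 (\<alpha> x) (\<delta> x) (?t\<^sup>2 * \<delta> x) (\<alpha> x) ** mat2 1 (s * ?w) (?t\<^sup>2 * (s * ?w)) 1"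
      using symb_components[OF t] by simp
    finally have S: "symb ?t (r1 x) (r2 x) = mat2 (\<alpha> x) (\<delta> x) (?t\<^sup>2 * \<delta> x) (\<alpha> x) ** mat2 1 (s * ?w) (?t\<^sup>2 * (s * ?w)) 1" .
    have a: "?w ^ N * \<alpha> x = poly A ?w" "?w ^ N * \<delta> x = poly B ?w" using al[OF x] de[OF x] w by auto
    have ev: "poly P ?w = y" "poly T ?w = y * ?t\<^sup>2" "poly X ?w = s * ?w"
      unfolding q by (simp_all add: P_def T_def X_def y_def algebra_simps)
    show ?thesis
      unfolding S mat2_mult K11_def K12_def K21_def K22_def poly_add poly_mult ev c_def y_def[symmetric] a[symmetric]
      by (simp add: mat2_eq_iff) (simp add: algebra_simps power2_eq_square)
  qed
  have detnz: "poly (K11 * K22 - K12 * K21) w \<noteq> 0" if w: "norm w = 1" for w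
  proof -
    obtain x where x: "x \<in> Rdot" "cay x = w" using disc_coord_onto_circle[of "-1" w] w by (auto simp: disc_coord_upper)
    have t: "t_line k0 1 x \<noteq> 0" using norm_t_line[OF k _ x(1), of 1] by auto
    have "poly (K11 * K22 - K12 * K21) w = det (?K x)" by (simp add: mat2_det x(2))
    also have "\<dots> = (c x * c x) * (r1 x * r2 x)" unfolding K[OF x(1)] det_mul symb_det[OF t] by (simp add: mat2_det)
    finally show ?thesis using cnz[OF x(1)] nz[OF x(1)] by simp
  qed
  \<comment> \<open>The scalar \<open>c x\<close> is \<open>cay x ^ (N + 4)\<close> times the square of the left unit \<open>1 - b / cay x\<close>.\<close>
  obtain l1 l2 where "bounded_factorization \<mu> ?K l1 l2" using polynomial_matrix_factorization[OF \<mu> detnz] by blast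
  from bounded_factorization_shift[OF this \<mu>, of "- int (N + 4)"]
  have fac: "bounded_factorization \<mu> (\<lambda>x. mat2 (cay x powi (- int (N + 4))) 0 0 (cay x powi (- int (N + 4))) ** ?K x) (l1 + - int (N + 4)) (l2 + - int (N + 4))" .
  let ?m = "\<lambda>x. 1 - b * disc_coord 1 x"
  have m: "?m \<in> disc_alg \<mu> 1" using \<mu> \<mu>' by (intro disc_alg_diff disc_alg_mult disc_alg_const disc_coord_disc_alg) auto
  have mF: "(\<lambda>z. 1 - b * z) \<in> disc_functions" by (auto simp: disc_functions_def intro!: continuous_intros holomorphic_intros)
  have mnz: "1 - b * z \<noteq> 0" if "norm z \<le> 1" for z using blaschke_denominator[OF k that] by (simp add: b_def)
  have minv: "(\<lambda>x. 1 / ?m x) \<in> disc_alg \<mu> 1" by (rule disc_alg_inverse[OF _ disc_alg_C_mu[OF m] mF]) (use mnz in auto)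
  let ?L = "\<lambda>x. mat2 (1 / ?m x * (1 / ?m x)) 0 0 (1 / ?m x * (1 / ?m x))"
  have mx: "?m x \<noteq> 0" if "x \<in> Rdot" for x using mnz norm_disc_coord[OF _ that, of 1] by simp
  have L: "?L \<in> mat2_units_on Rdot (disc_alg \<mu> 1)"
  proof (rule mat2_unitI[OF _ disc_alg_mult[OF disc_alg_mult[OF m m \<mu>(1)] disc_alg_mult[OF m m \<mu>(1)] \<mu>(1)] _ \<mu>(1)])
    show "?L \<in> mat2_over (disc_alg \<mu> 1)" by (intro mat2_overI disc_alg_mult disc_alg_const minv \<mu>)
    show "det (?L x) * (?m x * ?m x * (?m x * ?m x)) = 1" if "x \<in> Rdot" for x using mx[OF that] by (simp add: mat2_det)
  qed
  have "bounded_factorization \<mu> (\<lambda>x. symb (t_line k0 1 x) (r1 x) (r2 x)) (l1 + - int (N + 4)) (l2 + - int (N + 4))"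
  proof (rule bounded_factorization_mult[OF fac \<mu> L mat2_unit_one[OF \<mu>(1)]])
    fix x assume x: "x \<in> Rdot"
    have w: "cay x \<noteq> 0" by (rule cay_nonzero[OF x])
    have "cay x - b = cay x * ?m x" using w by (simp add: disc_coord_lower field_simps)
    then have "c x = cay x ^ (N + 4) * (?m x * ?m x)" by (simp add: c_def power2_eq_square power_add power4_eq_xxxx ac_simps)
    moreover have "cay x powi (- int (N + 4)) = 1 / cay x ^ (N + 4)" by (simp only: power_int_minus power_int_of_nat divide_inverse mult_1)
    ultimately have one: "1 / ?m x * (1 / ?m x) * cay x powi (- int (N + 4)) * c x = 1" using w mx[OF x] by simp
    have "?L x ** (mat2 (cay x powi (- int (N + 4))) 0 0 (cay x powi (- int (N + 4))) ** ?K x)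
        = mat2 (1 / ?m x * (1 / ?m x) * cay x powi (- int (N + 4)) * c x) 0 0 (1 / ?m x * (1 / ?m x) * cay x powi (- int (N + 4)) * c x) ** symb (t_line k0 1 x) (r1 x) (r2 x)"
      unfolding K[OF x] matrix_mul_assoc by (simp add: mat2_mult mult.assoc)
    then show "symb (t_line k0 1 x) (r1 x) (r2 x) = ?L x ** (mat2 (cay x powi (- int (N + 4))) 0 0 (cay x powi (- int (N + 4))) ** ?K x) ** mat 1"
      unfolding one by (simp flip: mat2_one)
  qed
  then show ?thesis by blast
qed

text \<open>The symbol is written as a small perturbation \<open>h e\<^sup>\<phi>\<close> of an algebraic function, and the parameter \<open>s\<close> in
  \<open>h (1 + s r\<^sub>0)\<close> is chosen such that the logarithm of what remains has no obstruction.\<close>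

lemma C_Q_factorization_exists:
  assumes k: "k0 > 1" and \<mu>: "0 < \<mu>" "\<mu> < 1" and G: "G \<in> C_Q k0 \<mu>"
  shows "\<exists>k1 k2. bounded_factorization \<mu> G k1 k2"
proof -
  have \<mu>': "\<mu> \<le> 1" using \<mu> by simp
  let ?t = "t_line k0 1" and ?R = "\<lambda>x. cay x * t_line k0 1 x"
  define \<alpha> \<delta> where "\<alpha> x = G x $ 1 $ 1" and "\<delta> x = G x $ 1 $ 2" for x
  define g1 g2 where "g1 x = \<alpha> x + ?t x * \<delta> x" and "g2 x = \<alpha> x - ?t x * \<delta> x" for x
  have tn: "norm (?t x) = 1" "?t x \<noteq> 0" if "x \<in> Rdot" for x using norm_t_line[OF k _ that, of 1] by auto
  have Gs: "G x = symb (?t x) (g1 x) (g2 x)" if "x \<in> Rdot" for x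
    using C_Q_symb[OF G k that] by (simp add: g1_def g2_def \<alpha>_def \<delta>_def)
  have GU: "G \<in> mat2_units_on Rdot (C_mu \<mu>)" using G by (simp add: C_Q_def)
  then have AC: "\<alpha> \<in> C_mu \<mu>" "\<delta> \<in> C_mu \<mu>" by (auto simp: mat2_units_on_def mat2_over_iff \<alpha>_def[abs_def] \<delta>_def[abs_def])
  have tC: "?t \<in> C_mu \<mu>" by (rule t_line_C_mu[OF k _ \<mu>(1) \<mu>']) simp
  have gC: "g1 \<in> C_mu \<mu>" "g2 \<in> C_mu \<mu>" unfolding g1_def g2_def by (intro C_mu_add C_mu_diff C_mu_mult AC tC \<mu>)+
  obtain c where c: "c > 0" "\<And>x. x \<in> Rdot \<Longrightarrow> norm (g1 x) \<ge> c \<and> norm (g2 x) \<ge> c"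
  proof -
    obtain H where H: "H \<in> mat2_over (C_mu \<mu>)" "\<And>x. x \<in> Rdot \<Longrightarrow> G x ** H x = mat 1" using GU by (auto simp: mat2_units_on_def)
    have HC: "(\<lambda>x. det (H x)) \<in> C_mu \<mu>" unfolding det_2 using H(1) by (intro C_mu_diff C_mu_mult \<mu>) (auto simp: mat2_over_iff)
    have "(\<lambda>x. g1 x * g2 x) \<in> units_on Rdot (C_mu \<mu>)"
      unfolding units_on_def
    proof (intro CollectI conjI bexI[OF _ HC] ballI)
      show "(\<lambda>x. g1 x * g2 x) \<in> C_mu \<mu>" by (intro C_mu_mult gC \<mu>)
      fix x assume x: "x \<in> Rdot"
      have "det (G x) * det (H x) = 1" using H(2)[OF x] by (metis det_I det_mul)
      then show "g1 x * g2 x * det (H x) = 1" by (simp add: Gs[OF x] symb_det[OF tn(2)[OF x]])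
    qed
    then obtain c where c: "c > 0" "\<And>x. x \<in> Rdot \<Longrightarrow> norm (g1 x * g2 x) \<ge> c" by (rule C_mu_unit_bounded_below[OF _ \<mu>(1)]) (rule that; assumption)
    obtain B1 where B1: "B1 > 0" "\<And>x. x \<in> Rdot \<Longrightarrow> norm (g1 x) \<le> B1" by (rule C_mu_bounded[OF gC(1) \<mu>(1)]) (rule that; assumption)
    obtain B2 where B2: "B2 > 0" "\<And>x. x \<in> Rdot \<Longrightarrow> norm (g2 x) \<le> B2" by (rule C_mu_bounded[OF gC(2) \<mu>(1)]) (rule that; assumption)
    define B where "B = max B1 B2"
    have B: "B > 0" "\<And>x. x \<in> Rdot \<Longrightarrow> norm (g1 x) \<le> B \<and> norm (g2 x) \<le> B"
      using B1 B2 by (auto simp: B_def le_max_iff_disj)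
    show ?thesis
    proof (rule that[of "c / B"])
      fix x assume x: "x \<in> Rdot"
      have "c \<le> norm (g1 x) * norm (g2 x)" using c(2)[OF x] by (simp add: norm_mult)
      moreover have "norm (g1 x) * norm (g2 x) \<le> norm (g1 x) * B" "norm (g1 x) * norm (g2 x) \<le> B * norm (g2 x)"
        using B(2)[OF x] by (auto intro: mult_left_mono mult_right_mono)
      ultimately show "c / B \<le> norm (g1 x) \<and> c / B \<le> norm (g2 x)" using B(1) by (simp add: divide_le_eq mult.commute)
    qed (use c B in simp)
  qed
  obtain \<eta> where \<eta>: "\<eta> > 0" "\<And>\<kappa>. norm \<kappa> < \<eta> \<Longrightarrow> \<exists>s. norm s < 1/2 \<and> obstruction k0 (r0_log k0 s) = \<kappa>"
    by (rule r0_log_obstruction_surj[OF k]) (rule that; assumption)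
  define C where "C = 1 + 1 / (1 - branch_zero k0)"
  have C: "C > 0" using branch_zero_bounds[OF k] by (simp add: C_def add_pos_pos)
  \<comment> \<open>The relative error \<open>\<theta>\<close> of the approximation makes the logarithms at most \<open>2 \<theta>\<close>, and hence
    the obstruction at most \<open>2 \<theta> C < \<eta>\<close>.\<close>
  define \<theta> where "\<theta> = min (1/4) (\<eta> / (4 * C))"
  have \<theta>: "\<theta> > 0" "\<theta> \<le> 1/4" "2 * \<theta> * C < \<eta>"
  proof -
    show "\<theta> > 0" "\<theta> \<le> 1/4" using \<eta>(1) C by (auto simp: \<theta>_def)
    have "\<theta> \<le> \<eta> / (4 * C)" by (simp add: \<theta>_def)
    then have "2 * \<theta> * C \<le> 2 * (\<eta> / (4 * C)) * C" using C by (intro mult_right_mono) auto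
    also have "\<dots> = \<eta> / 2" using C by simp
    finally show "2 * \<theta> * C < \<eta>" using \<eta>(1) by simp
  qed
  define \<epsilon> where "\<epsilon> = \<theta> * c / 4"
  have \<epsilon>: "\<epsilon> > 0" using \<theta> c by (simp add: \<epsilon>_def)
  obtain p N where pN: "\<And>x M. x \<in> Rdot \<Longrightarrow> M \<ge> N \<Longrightarrow> norm (\<alpha> x - poly (p * monom 1 (M - N)) (cay x) / cay x ^ M) < \<epsilon>"
    by (rule C_mu_laurent_approximation[OF AC(1) \<mu>(1) \<epsilon>]) (rule that; assumption)
  obtain q M where qM: "\<And>x L. x \<in> Rdot \<Longrightarrow> L \<ge> M \<Longrightarrow> norm (\<delta> x - poly (q * monom 1 (L - M)) (cay x) / cay x ^ L) < \<epsilon>"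
    by (rule C_mu_laurent_approximation[OF AC(2) \<mu>(1) \<epsilon>]) (rule that; assumption)
  define A B where "A = p * monom 1 (max N M - N)" and "B = q * monom 1 (max N M - M)"
  define \<alpha>' \<delta>' where "\<alpha>' x = poly A (cay x) / cay x ^ max N M" and "\<delta>' x = poly B (cay x) / cay x ^ max N M" for x
  have ap: "norm (\<alpha> x - \<alpha>' x) < \<epsilon>" "norm (\<delta> x - \<delta>' x) < \<epsilon>" if "x \<in> Rdot" for x
    using pN[OF that, of "max N M"] qM[OF that, of "max N M"] by (auto simp: \<alpha>'_def \<delta>'_def A_def B_def)
  define h1 h2 where "h1 x = \<alpha>' x + ?t x * \<delta>' x" and "h2 x = \<alpha>' x - ?t x * \<delta>' x" for x
  have gh: "norm (g1 x - h1 x) \<le> 2 * \<epsilon> \<and> norm (g2 x - h2 x) \<le> 2 * \<epsilon>" if x: "x \<in> Rdot" for x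
  proof -
    have "g1 x - h1 x = (\<alpha> x - \<alpha>' x) + ?t x * (\<delta> x - \<delta>' x)" "g2 x - h2 x = (\<alpha> x - \<alpha>' x) - ?t x * (\<delta> x - \<delta>' x)"
      by (simp_all add: g1_def g2_def h1_def h2_def algebra_simps)
    moreover have "norm (?t x * (\<delta> x - \<delta>' x)) \<le> \<epsilon>" using ap(2)[OF x] tn[OF x] by (simp add: norm_mult)
    ultimately show ?thesis
      using ap(1)[OF x] norm_triangle_ineq[of "\<alpha> x - \<alpha>' x" "?t x * (\<delta> x - \<delta>' x)"] norm_triangle_ineq4[of "\<alpha> x - \<alpha>' x" "?t x * (\<delta> x - \<delta>' x)"] by simp
  qed
  have rel: "norm h \<ge> c / 2 \<and> norm (g / h - 1) \<le> \<theta>" if "norm (g - h) \<le> 2 * \<epsilon>" "norm g \<ge> c" for g h :: complex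
  proof -
    have "2 * \<epsilon> = \<theta> * c / 2" by (simp add: \<epsilon>_def)
    also have "\<dots> \<le> c / 2" using \<theta> c(1) by (simp add: mult_left_le_one_le)
    finally have h: "norm h \<ge> c / 2" using that norm_triangle_ineq2[of g h] by linarith
    then have "h \<noteq> 0" using c(1) by auto
    then have "g / h - 1 = (g - h) / h" by (simp add: diff_divide_distrib)
    then have "norm (g / h - 1) = norm (g - h) / norm h" by (simp add: norm_divide)
    also have "\<dots> \<le> (2 * \<epsilon>) / (c / 2)" using that h c(1) \<epsilon> by (intro frac_le) auto
    also have "\<dots> = \<theta>" using c(1) by (simp add: \<epsilon>_def)
    finally show ?thesis using h by simp
  qed
  have hn: "norm (h1 x) \<ge> c / 2" "norm (h2 x) \<ge> c / 2" "norm (g1 x / h1 x - 1) \<le> \<theta>" "norm (g2 x / h2 x - 1) \<le> \<theta>" if "x \<in> Rdot" for x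
    using rel[of "g1 x" "h1 x"] rel[of "g2 x" "h2 x"] gh[OF that] c(2)[OF that] by auto
  have hnz: "h1 x \<noteq> 0" "h2 x \<noteq> 0" if "x \<in> Rdot" for x using hn(1,2)[OF that] c(1) by auto
  have pol: "(\<lambda>x. poly Q (cay x) / cay x ^ n) \<in> C_mu \<mu>" for Q n
  proof -
    have pc: "(\<lambda>x. poly Q (cay x)) \<in> C_mu \<mu>" for Q by (rule disc_alg_C_mu[OF disc_alg_poly[OF \<mu>(1) \<mu>']])
    have "(\<lambda>x. poly (monom 1 n) (cay x)) \<in> C_mu \<mu>" by (rule pc)
    then have "(\<lambda>x. 1 / poly (monom 1 n) (cay x)) \<in> C_mu \<mu>" by (rule C_mu_inverse[where c=1]) (auto simp: poly_monom norm_power norm_cay)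
    from C_mu_mult[OF pc[of Q] this \<mu>(1)] show ?thesis by (simp add: poly_monom)
  qed
  have hC: "h1 \<in> C_mu \<mu>" "h2 \<in> C_mu \<mu>" unfolding h1_def h2_def \<alpha>'_def \<delta>'_def by (intro C_mu_add C_mu_diff C_mu_mult tC pol \<mu>)+
  define L1 L2 where "L1 x = Ln (g1 x / h1 x)" and "L2 x = Ln (g2 x / h2 x)" for x
  have ghC: "(\<lambda>x. g1 x / h1 x) \<in> C_mu \<mu>" "(\<lambda>x. g2 x / h2 x) \<in> C_mu \<mu>"
    using C_mu_mult[OF gC(1) C_mu_inverse[OF hC(1), of "c/2"] \<mu>(1)] C_mu_mult[OF gC(2) C_mu_inverse[OF hC(2), of "c/2"] \<mu>(1)] hn(1,2) c(1) by simp_all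
  have LC: "L1 \<in> C_mu \<mu>" "L2 \<in> C_mu \<mu>"
    unfolding L1_def L2_def using hn(3,4) \<theta>(2) by (intro Ln_C_mu ghC; fastforce)+
  have Lb: "norm (L1 x) \<le> 2 * \<theta> \<and> norm (L2 x) \<le> 2 * \<theta>" if x: "x \<in> Rdot" for x
    using norm_Ln_le[of "g1 x / h1 x - 1"] norm_Ln_le[of "g2 x / h2 x - 1"] hn(3,4)[OF x] \<theta>(2) by (auto simp: L1_def L2_def)
  define d0 where "d0 x = (L1 x - L2 x) / (2 * ?t x)" for x
  have d0: "d0 \<in> C_mu \<mu>" unfolding d0_def by (rule C_mu_divide_t_line[OF k \<mu>(1) \<mu>' C_mu_diff[OF LC]])
  have "norm (d0 x) \<le> 2 * \<theta>" if x: "x \<in> Rdot" for x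
    using norm_triangle_ineq4[of "L1 x" "L2 x"] Lb[OF x] tn(1)[OF x] by (simp add: d0_def norm_divide norm_mult)
  then have "norm (obstruction k0 d0) \<le> 2 * \<theta> * C" unfolding C_def by (rule obstruction_bound[OF k d0 \<mu>(1)])
  then obtain s where s: "norm s < 1/2" "obstruction k0 (r0_log k0 s) = obstruction k0 d0" using \<eta>(2)[of "obstruction k0 d0"] \<theta>(3) by auto
  define S1 S2 where "S1 x = 1 + s * ?R x" and "S2 x = 1 - s * ?R x" for x
  have sR: "norm (s * ?R x) < 1/2" if "x \<in> Rdot" for x using s(1) norm_r0_line[OF k that] by (subst norm_mult) simp
  have Snz: "S1 x \<noteq> 0" "S2 x \<noteq> 0" if "x \<in> Rdot" for x
  proof -
    have "norm (- (s * ?R x)) \<noteq> norm (1::complex)" "norm (s * ?R x) \<noteq> norm (1::complex)" using sR[OF that] by auto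
    then show "S1 x \<noteq> 0" "S2 x \<noteq> 0" unfolding S1_def S2_def by (metis add_eq_0_iff2 norm_minus_cancel, metis eq_iff_diff_eq_0)
  qed
  define r1 r2 where "r1 x = h1 x * S1 x" and "r2 x = h2 x * S2 x" for x
  obtain k1 k2 where fac: "bounded_factorization \<mu> (\<lambda>x. symb (?t x) (r1 x) (r2 x)) k1 k2"
    using rational_symbol_factorization[OF k \<mu>, of \<alpha>' A "max N M" \<delta>' B r1 s r2] hnz Snz
    by (auto simp: \<alpha>'_def \<delta>'_def r1_def r2_def h1_def h2_def S1_def S2_def)
  define a where "a x = ((L1 x - Ln (S1 x)) + (L2 x - Ln (S2 x))) / 2" for x
  define d where "d x = d0 x - r0_log k0 s x" for x
  have RC: "?R \<in> C_mu \<mu>" by (intro C_mu_mult C_mu_cay tC \<mu> \<mu>')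
  have SC: "(\<lambda>x. Ln (S1 x)) \<in> C_mu \<mu>" "(\<lambda>x. Ln (S2 x)) \<in> C_mu \<mu>"
  proof -
    show "(\<lambda>x. Ln (S1 x)) \<in> C_mu \<mu>"
      by (rule Ln_C_mu) (use sR in \<open>auto simp: S1_def intro!: C_mu_add C_mu_mult RC \<mu> C_mu_cay tC \<mu>' intro: less_imp_le\<close>)
    show "(\<lambda>x. Ln (S2 x)) \<in> C_mu \<mu>"
      by (rule Ln_C_mu) (use sR in \<open>auto simp: S2_def intro!: C_mu_diff C_mu_mult RC \<mu> C_mu_cay tC \<mu>' intro: less_imp_le\<close>)
  qed
  have aC: "a \<in> C_mu \<mu>"
    using C_mu_mult[OF C_mu_const[of "1/2"] C_mu_add[OF C_mu_diff[OF LC(1) SC(1)] C_mu_diff[OF LC(2) SC(2)]] \<mu>(1)] by (simp add: a_def[abs_def])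
  have rC: "r0_log k0 s \<in> C_mu \<mu>" using r0_log_C_mu[OF k \<mu>(1) \<mu>'] s(1) by simp
  have dC: "d \<in> C_mu \<mu>" unfolding d_def by (rule C_mu_diff[OF d0 rC])
  have "obstruction k0 d = 0" unfolding d_def obstruction_diff[OF k d0 rC \<mu>(1)] s(2) by simp
  then obtain am dm ap dp where E:
    "(\<lambda>x. symb (?t x) (exp (am x + ?t x * dm x)) (exp (am x - ?t x * dm x))) \<in> mat2_units_on Rdot (disc_alg \<mu> 1)"
    "(\<lambda>x. symb (?t x) (exp (ap x + ?t x * dp x)) (exp (ap x - ?t x * dp x))) \<in> mat2_units_on Rdot (disc_alg \<mu> (-1))"
    "\<And>x. x \<in> Rdot \<Longrightarrow> a x = am x + ap x" "\<And>x. x \<in> Rdot \<Longrightarrow> d x = dm x + dp x"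
    by (rule exponential_splitting[OF k \<mu> aC dC]) (rule that; assumption)
  have "bounded_factorization \<mu> G k1 k2"
  proof (rule bounded_factorization_mult[OF fac \<mu> E(1,2)])
    fix x assume x: "x \<in> Rdot"
    have t: "?t x \<noteq> 0" by (rule tn(2)[OF x])
    have td: "?t x * d x = ((L1 x - Ln (S1 x)) - (L2 x - Ln (S2 x))) / 2"
      using t by (simp add: d_def d0_def r0_log_def S1_def S2_def field_simps)
    have g0: "g1 x \<noteq> 0" "g2 x \<noteq> 0" using c(1) c(2)[OF x] by auto
    have "a x + ?t x * d x = L1 x - Ln (S1 x)" "a x - ?t x * d x = L2 x - Ln (S2 x)" unfolding td a_def by (simp_all add: field_simps)
    then have "exp (a x + ?t x * d x) = g1 x / r1 x" "exp (a x - ?t x * d x) = g2 x / r2 x"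
      using g0 hnz[OF x] Snz[OF x] by (simp_all add: exp_diff L1_def L2_def r1_def r2_def)
    then have "exp (am x + ?t x * dm x) * r1 x * exp (ap x + ?t x * dp x) = g1 x" "exp (am x - ?t x * dm x) * r2 x * exp (ap x - ?t x * dp x) = g2 x"
      using hnz[OF x] Snz[OF x] unfolding E(3,4)[OF x]
      by (simp_all add: r1_def r2_def exp_add exp_diff distrib_left field_simps)
    then show "G x = symb (?t x) (exp (am x + ?t x * dm x)) (exp (am x - ?t x * dm x)) ** symb (?t x) (r1 x) (r2 x) ** symb (?t x) (exp (ap x + ?t x * dp x)) (exp (ap x - ?t x * dp x))"
      by (simp add: Gs[OF x] symb_mult[OF t])
  qed
  then show ?thesis by blast
qed


section \<open>Partial indices and the symbol\<close>

text \<open>The function extends to both sides, so it is constant, and its extension to one side vanishes at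
  the centre of the disc.\<close>

lemma disc_alg_winding_zero:
  assumes e: "e \<in> {1, -1}" and \<mu>: "0 < \<mu>" "\<mu> \<le> 1" and V: "V \<in> disc_alg \<mu> e" and U: "U \<in> disc_alg \<mu> (-e)" and n: "n > 0"
    and eq: "\<And>x. x \<in> Rdot \<Longrightarrow> U x = disc_coord e x ^ n * V x" and x: "x \<in> Rdot"
  shows "U x = 0"
proof -
  obtain F where F: "F \<in> disc_functions" "\<And>x. x \<in> Rdot \<Longrightarrow> V x = F (disc_coord e x)" by (rule disc_algE[OF V]) (rule that; assumption)
  have zF: "(\<lambda>z. z ^ n * F z) \<in> disc_functions"
    using F(1) by (auto simp: disc_functions_def intro!: continuous_intros holomorphic_intros)
  have UC: "U \<in> C_mu \<mu>" by (rule disc_alg_C_mu[OF U])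
  have "U \<in> disc_alg \<mu> e" by (rule disc_algI[OF UC zF]) (simp add: eq F(2))
  then have "U \<in> disc_alg \<mu> 1" "U \<in> disc_alg \<mu> (-1)" using e U by auto
  then obtain c where c: "\<And>x. x \<in> Rdot \<Longrightarrow> U x = c" by (rule disc_alg_both_const[OF _ _ \<mu>(1)]) (rule that; assumption)
  have "(0::complex) ^ n * F 0 = c"
  proof (rule disc_functions_eqI[OF zF, where H="\<lambda>_. c"])
    fix w :: complex assume "norm w = 1"
    then obtain y where y: "y \<in> Rdot" "disc_coord e y = w" using disc_coord_onto_circle[OF e] by blast
    show "w ^ n * F w = c" using eq[OF y(1)] F(2)[OF y(1)] c[OF y(1)] y(2) by simp
  qed (auto simp: disc_functions_def)
  moreover have "(0::complex) ^ n = 0" using n by (rule zero_power)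
  ultimately show ?thesis using c[OF x] by simp
qed

lemma None_in_Rdot [simp]: "None \<in> Rdot"
  by (simp add: Rdot_def)

lemma units_onE:
  assumes "f \<in> units_on X A" obtains h where "f \<in> A" "h \<in> A" "\<And>x. x \<in> X \<Longrightarrow> f x * h x = 1"
  using assms by (auto simp: units_on_def)

text \<open>Passing to determinants leaves a scalar question: a power of \<open>cay\<close> that is the product of a left and
  a right unit must be trivial.\<close>

lemma index_sum_zero:
  assumes \<mu>: "0 < \<mu>" "\<mu> < 1" and fac: "bounded_factorization \<mu> G k1 k2"
    and gm: "\<gamma>m \<in> units_on Rdot (disc_alg \<mu> 1)" and gp: "\<gamma>p \<in> units_on Rdot (disc_alg \<mu> (-1))"
    and det: "\<And>x. x \<in> Rdot \<Longrightarrow> det (G x) = \<gamma>m x * \<gamma>p x"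
  shows "k1 + k2 = 0"
proof -
  have \<mu>': "\<mu> \<le> 1" using \<mu> by simp
  obtain Gm Gp where G: "Gm \<in> mat2_units_on Rdot (disc_alg \<mu> 1)" "Gp \<in> mat2_units_on Rdot (disc_alg \<mu> (-1))"
    "\<And>x. x \<in> Rdot \<Longrightarrow> G x = Gm x ** D_mat k1 k2 x ** Gp x" by (rule bounded_factorizationE[OF fac \<mu>]) (rule that; assumption)
  obtain gmi where gmi: "\<gamma>m \<in> disc_alg \<mu> 1" "gmi \<in> disc_alg \<mu> 1" "\<And>x. x \<in> Rdot \<Longrightarrow> \<gamma>m x * gmi x = 1" by (rule units_onE[OF gm]) (rule that; assumption)
  obtain gpi where gpi: "\<gamma>p \<in> disc_alg \<mu> (-1)" "gpi \<in> disc_alg \<mu> (-1)" "\<And>x. x \<in> Rdot \<Longrightarrow> \<gamma>p x * gpi x = 1" by (rule units_onE[OF gp]) (rule that; assumption)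
  obtain dm where dm: "(\<lambda>x. det (Gm x)) \<in> disc_alg \<mu> 1" "dm \<in> disc_alg \<mu> 1" "\<And>x. x \<in> Rdot \<Longrightarrow> det (Gm x) * dm x = 1"
    by (rule units_onE[OF mat2_unit_det[OF G(1) \<mu>(1)]]) (rule that; assumption)
  obtain dp where dp: "(\<lambda>x. det (Gp x)) \<in> disc_alg \<mu> (-1)" "dp \<in> disc_alg \<mu> (-1)" "\<And>x. x \<in> Rdot \<Longrightarrow> det (Gp x) * dp x = 1"
    by (rule units_onE[OF mat2_unit_det[OF G(2) \<mu>(1)]]) (rule that; assumption)
  have rel: "det (Gm x) * cay x powi (k1 + k2) * det (Gp x) = \<gamma>m x * \<gamma>p x" if x: "x \<in> Rdot" for x
    using det[OF x] cay_nonzero[OF x] by (simp add: G(3)[OF x] det_mul D_mat_def mat2_det power_int_add)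
  let ?U = "\<lambda>x. \<gamma>m x * dm x" and ?Ui = "\<lambda>x. gmi x * det (Gm x)"
  let ?V = "\<lambda>x. \<gamma>p x * dp x" and ?Vi = "\<lambda>x. gpi x * det (Gp x)"
  have U: "?U \<in> disc_alg \<mu> 1" "?Ui \<in> disc_alg \<mu> 1" and V: "?V \<in> disc_alg \<mu> (-1)" "?Vi \<in> disc_alg \<mu> (-1)"
    by (intro disc_alg_mult gmi gpi dm dp \<mu>)+
  have UU: "?U x * ?Ui x = 1" and VV: "?V x * ?Vi x = 1" if x: "x \<in> Rdot" for x
  proof -
    have "?U x * ?Ui x = (\<gamma>m x * gmi x) * (det (Gm x) * dm x)" "?V x * ?Vi x = (\<gamma>p x * gpi x) * (det (Gp x) * dp x)" by (simp_all only: ac_simps)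
    then show "?U x * ?Ui x = 1" "?V x * ?Vi x = 1" using gmi(3) gpi(3) dm(3) dp(3) x by simp_all
  qed
  have UV: "cay x powi (k1 + k2) = ?U x * ?V x" if x: "x \<in> Rdot" for x
  proof -
    have "?U x * ?V x = (\<gamma>m x * \<gamma>p x) * dm x * dp x" by (simp only: ac_simps)
    also have "\<dots> = cay x powi (k1 + k2) * (det (Gm x) * dm x) * (det (Gp x) * dp x)" unfolding rel[OF x, symmetric] by (simp only: ac_simps)
    finally show ?thesis using dm(3)[OF x] dp(3)[OF x] by simp
  qed
  show ?thesis
  proof (rule ccontr)
    assume "k1 + k2 \<noteq> 0"
    then consider "k1 + k2 > 0" | "k1 + k2 < 0" by linarith
    then show False
    proof cases
      case 1
      have "?U x = disc_coord (-1) x ^ nat (k1 + k2) * ?Vi x" if x: "x \<in> Rdot" for x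
      proof -
        have "disc_coord (-1) x ^ nat (k1 + k2) = ?U x * ?V x" using UV[OF x] 1 by (simp add: disc_coord_upper power_int_def)
        then have "disc_coord (-1) x ^ nat (k1 + k2) * ?Vi x = ?U x * (?V x * ?Vi x)" by (simp only: mult.assoc)
        then show ?thesis unfolding VV[OF x] by simp
      qed
      then have "?U None = 0" using 1 U(1) by (intro disc_alg_winding_zero[OF _ \<mu>(1) \<mu>' V(2), where n="nat (k1 + k2)"]) auto
      then show False using UU[of None] by auto
    next
      case 2
      have "?V x = disc_coord 1 x ^ nat (- (k1 + k2)) * ?Ui x" if x: "x \<in> Rdot" for x
      proof -
        have "disc_coord 1 x ^ nat (- (k1 + k2)) = ?U x * ?V x" using UV[OF x] 2 by (simp add: disc_coord_lower power_int_def power_one_over inverse_eq_divide)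
        then have "disc_coord 1 x ^ nat (- (k1 + k2)) * ?Ui x = ?V x * (?U x * ?Ui x)" by (simp only: ac_simps)
        then show ?thesis unfolding UU[OF x] by simp
      qed
      then have "?V None = 0" using 2 V(1) by (intro disc_alg_winding_zero[OF _ \<mu>(1) \<mu>' U(2), where n="nat (- (k1 + k2))"]) auto
      then show False using VV[of None] by auto
    qed
  qed
qed

text \<open>Comparing the two factorizations, the second column of the quotient of the left factors times
  \<open>1 / cay\<close> extends to both sides and vanishes at a point, so it is zero.\<close>

lemma not_canonical:
  assumes \<mu>: "0 < \<mu>" "\<mu> < 1" and fac: "bounded_factorization \<mu> G 1 (-1)"
  shows "\<not> bounded_factorization \<mu> G 0 0"
proof
  assume can: "bounded_factorization \<mu> G 0 0"
  have \<mu>': "\<mu> \<le> 1" using \<mu> by simp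
  obtain Gm Gp where G: "Gm \<in> mat2_units_on Rdot (disc_alg \<mu> 1)" "Gp \<in> mat2_units_on Rdot (disc_alg \<mu> (-1))"
    "\<And>x. x \<in> Rdot \<Longrightarrow> G x = Gm x ** D_mat 1 (-1) x ** Gp x" by (rule bounded_factorizationE[OF fac \<mu>]) (rule that; assumption)
  obtain Cm Cp where C: "Cm \<in> mat2_units_on Rdot (disc_alg \<mu> 1)" "Cp \<in> mat2_units_on Rdot (disc_alg \<mu> (-1))"
    "\<And>x. x \<in> Rdot \<Longrightarrow> G x = Cm x ** D_mat 0 0 x ** Cp x" by (rule bounded_factorizationE[OF can \<mu>]) (rule that; assumption)
  obtain Ci where Ci: "Ci \<in> mat2_units_on Rdot (disc_alg \<mu> 1)" "\<And>x. x \<in> Rdot \<Longrightarrow> Ci x ** Cm x = mat 1"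
    by (rule mat2_unitE[OF C(1)]) (rule that; assumption)
  obtain Gi where Gi: "Gi \<in> mat2_units_on Rdot (disc_alg \<mu> (-1))" "\<And>x. x \<in> Rdot \<Longrightarrow> Gp x ** Gi x = mat 1"
    by (rule mat2_unitE[OF G(2)]) (rule that; assumption)
  let ?X = "\<lambda>x. Ci x ** Gm x" and ?Y = "\<lambda>x. Cp x ** Gi x"
  have XU: "?X \<in> mat2_units_on Rdot (disc_alg \<mu> 1)" by (rule mat2_unit_mult[OF Ci(1) G(1) \<mu>(1)])
  have YU: "?Y \<in> mat2_units_on Rdot (disc_alg \<mu> (-1))" by (rule mat2_unit_mult[OF C(2) Gi(1) \<mu>(1)])
  have XY: "?X x ** D_mat 1 (-1) x = ?Y x" if x: "x \<in> Rdot" for x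
  proof -
    have "Cm x ** Cp x = Gm x ** D_mat 1 (-1) x ** Gp x" using G(3)[OF x] C(3)[OF x] by (simp add: D_mat_def flip: mat2_one)
    then have "Ci x ** (Cm x ** Cp x) ** Gi x = Ci x ** (Gm x ** D_mat 1 (-1) x ** Gp x) ** Gi x" by simp
    then have "(Ci x ** Cm x) ** (Cp x ** Gi x) = Ci x ** Gm x ** D_mat 1 (-1) x ** (Gp x ** Gi x)" by (simp only: matrix_mul_assoc)
    then show ?thesis by (simp add: Ci(2)[OF x] Gi(2)[OF x])
  qed
  have "?Y None $ i $ 2 = 0" for i
  proof (rule disc_alg_winding_zero[OF _ \<mu>(1) \<mu>', where n=1 and U="\<lambda>x. ?Y x $ i $ 2"])
    show "(\<lambda>x. ?X x $ i $ 2) \<in> disc_alg \<mu> 1" using XU unfolding mat2_units_on_def mat2_over_def by blast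
    show "(\<lambda>x. ?Y x $ i $ 2) \<in> disc_alg \<mu> (-1)" using YU unfolding mat2_units_on_def mat2_over_def by blast
    fix x assume x: "x \<in> Rdot"
    have "(?X x ** D_mat 1 (-1) x) $ i $ 2 = ?X x $ i $ 2 * (1 / cay x)"
      unfolding matrix_matrix_mult_def[of "?X x"] by (simp add: sum_2 D_mat_def divide_inverse)
    then show "?Y x $ i $ 2 = disc_coord 1 x ^ 1 * ?X x $ i $ 2" unfolding XY[OF x] by (simp add: disc_coord_lower)
  qed auto
  then have "det (?Y None) = 0" by (simp only: det_2) simp
  moreover obtain y where "\<And>x. x \<in> Rdot \<Longrightarrow> det (?Y x) * y x = 1" by (rule units_onE[OF mat2_unit_det[OF YU \<mu>(1)]]) (rule that; assumption)
  then have "det (?Y None) * y None = 1" by simp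
  ultimately show False by simp
qed

lemma Proj_Gam_lift: "x \<in> Rdot \<Longrightarrow> Proj (Gam_lift k0 \<sigma> x) = x"
  by (auto simp: Gam_lift_def Proj_def Rdot_def)

lemma Gam_cases:
  assumes "k0 > 1" "P \<in> Gam k0" obtains x \<sigma> where "x \<in> Rdot" "\<sigma> \<in> {1, -1}" "P = Gam_lift k0 \<sigma> x"
  using assms Gam_lift_image[OF assms(1)] by auto

lemma surface_unit:
  assumes k: "k0 > 1" and e: "e \<in> {1, -1}" and \<mu>: "0 < \<mu>" "\<mu> \<le> 1"
    and u: "u \<in> disc_alg \<mu> e" and v: "v \<in> disc_alg \<mu> e" and y: "y \<in> disc_alg \<mu> e"
    and inv: "\<And>x. x \<in> Rdot \<Longrightarrow> ((u x)\<^sup>2 - (t_line k0 e x)\<^sup>2 * (v x)\<^sup>2) * y x = 1"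
  shows "(\<lambda>P. u (Proj P) + t_coord k0 e P * v (Proj P)) \<in> units_on (Gam k0) (C_mu_Gam_half k0 \<mu> (half e))"
  unfolding units_on_def
proof (intro CollectI conjI bexI ballI)
  show "(\<lambda>P. u (Proj P) + t_coord k0 e P * v (Proj P)) \<in> C_mu_Gam_half k0 \<mu> (half e)"
    by (rule surface_function_from_components[OF k e \<mu> u v])
  show "(\<lambda>P. (u (Proj P) * y (Proj P)) + t_coord k0 e P * (- (v (Proj P) * y (Proj P)))) \<in> C_mu_Gam_half k0 \<mu> (half e)"
    by (rule surface_function_from_components[OF k e \<mu> disc_alg_mult[OF u y \<mu>(1)] disc_alg_uminus[OF disc_alg_mult[OF v y \<mu>(1)]]])
  fix P assume "P \<in> Gam k0"
  then obtain x \<sigma> where x: "x \<in> Rdot" "\<sigma> \<in> {1, -1}" "P = Gam_lift k0 \<sigma> x" by (rule Gam_cases[OF k])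
  have "\<sigma> * \<sigma> = 1" using x(2) by auto
  then show "(u (Proj P) + t_coord k0 e P * v (Proj P)) * (u (Proj P) * y (Proj P) + t_coord k0 e P * - (v (Proj P) * y (Proj P))) = 1"
    using inv[OF x(1)] unfolding x(3) Proj_Gam_lift[OF x(1)] t_coord_lift by algebra
qed

text \<open>A row of the inverse left factor that belongs to a positive index gives a function on the lower
  half surface and one on the upper half surface whose quotient is the symbol. Comparing their
  norms over the line shows that, up to units, they have no other zeros and poles than the powers
  of \<open>cay\<close> and the factor \<open>r\<^sub>0\<close> prescribe, and that the index cannot exceed one.\<close>

lemma positive_index_r0_factorization:
  assumes k: "k0 > 1" and \<mu>: "0 < \<mu>" "\<mu> < 1" and G: "G \<in> C_Q k0 \<mu>"
    and fac: "bounded_factorization \<mu> G k1 k2" and k1: "k1 > 0"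
    and gm: "\<gamma>m \<in> units_on Rdot (disc_alg \<mu> 1)" and gp: "\<gamma>p \<in> units_on Rdot (disc_alg \<mu> (-1))"
    and det: "\<And>x. x \<in> Rdot \<Longrightarrow> det (G x) = \<gamma>m x * \<gamma>p x"
  shows "r0_factorization k0 \<mu> (Sig_symbol k0 G)"
proof -
  have \<mu>': "\<mu> \<le> 1" using \<mu> by simp
  have e1: "(1::real) \<in> {1, -1}" and e2: "(-1::real) \<in> {1, -1}" by auto
  let ?t = "t_line k0 1"
  define \<beta> where "\<beta> = complex_of_real (branch_zero k0)"
  have \<beta>: "norm \<beta> < 1" "\<beta> \<noteq> 0" using branch_zero_bounds[OF k] by (auto simp: \<beta>_def)
  define n where "n = nat k1"
  have n: "n \<ge> 1" "k1 = int n" using k1 by (auto simp: n_def)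
  obtain Gm Gp where Gf: "Gm \<in> mat2_units_on Rdot (disc_alg \<mu> 1)" "Gp \<in> mat2_units_on Rdot (disc_alg \<mu> (-1))"
    "\<And>x. x \<in> Rdot \<Longrightarrow> G x = Gm x ** D_mat k1 k2 x ** Gp x" by (rule bounded_factorizationE[OF fac \<mu>]) (rule that; assumption)
  obtain H where H: "H \<in> mat2_units_on Rdot (disc_alg \<mu> 1)" "\<And>x. x \<in> Rdot \<Longrightarrow> H x ** Gm x = mat 1"
    by (rule mat2_unitE[OF Gf(1)]) (rule that; assumption)
  obtain gmi where gmi: "\<gamma>m \<in> disc_alg \<mu> 1" "gmi \<in> disc_alg \<mu> 1" "\<And>x. x \<in> Rdot \<Longrightarrow> \<gamma>m x * gmi x = 1" by (rule units_onE[OF gm]) (rule that; assumption)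
  obtain gpi where gpi: "\<gamma>p \<in> disc_alg \<mu> (-1)" "gpi \<in> disc_alg \<mu> (-1)" "\<And>x. x \<in> Rdot \<Longrightarrow> \<gamma>p x * gpi x = 1" by (rule units_onE[OF gp]) (rule that; assumption)
  define a b c d where "a x = H x $ 1 $ 1" and "b x = H x $ 1 $ 2" and "c x = Gp x $ 1 $ 1" and "d x = Gp x $ 1 $ 2" for x
  have A: "a \<in> disc_alg \<mu> 1" "b \<in> disc_alg \<mu> 1" "c \<in> disc_alg \<mu> (-1)" "d \<in> disc_alg \<mu> (-1)"
    using H(1) Gf(2) by (auto simp: mat2_units_on_def mat2_over_iff a_def[abs_def] b_def[abs_def] c_def[abs_def] d_def[abs_def])
  define \<alpha> \<delta> where "\<alpha> x = G x $ 1 $ 1" and "\<delta> x = G x $ 1 $ 2" for x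
  have tn: "?t x \<noteq> 0" if "x \<in> Rdot" for x using norm_t_line[OF k e1 that] by auto
  have Gx: "G x = mat2 (\<alpha> x) (\<delta> x) ((?t x)\<^sup>2 * \<delta> x) (\<alpha> x)" if x: "x \<in> Rdot" for x
    using C_Q_form[OF G k x] by (simp add: \<alpha>_def \<delta>_def q_fun_t_line[OF k x])
  have row: "a x * \<alpha> x + b x * ((?t x)\<^sup>2 * \<delta> x) = cay x ^ n * c x" "a x * \<delta> x + b x * \<alpha> x = cay x ^ n * d x" if x: "x \<in> Rdot" for x
  proof -
    have "H x ** G x = (H x ** Gm x) ** D_mat k1 k2 x ** Gp x" unfolding Gf(3)[OF x] by (simp only: matrix_mul_assoc)
    then have "H x ** G x = D_mat k1 k2 x ** Gp x" by (simp add: H(2)[OF x])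
    moreover have "H x = mat2 (a x) (b x) (H x $ 2 $ 1) (H x $ 2 $ 2)" "Gp x = mat2 (c x) (d x) (Gp x $ 2 $ 1) (Gp x $ 2 $ 2)"
      unfolding a_def b_def c_def d_def by (rule mat2_entries)+
    ultimately have eq: "mat2 (a x) (b x) (H x $ 2 $ 1) (H x $ 2 $ 2) ** mat2 (\<alpha> x) (\<delta> x) ((?t x)\<^sup>2 * \<delta> x) (\<alpha> x)
        = mat2 (cay x ^ n) 0 0 (cay x powi k2) ** mat2 (c x) (d x) (Gp x $ 2 $ 1) (Gp x $ 2 $ 2)"
      using Gx[OF x] n(2) by (metis D_mat_def power_int_of_nat)
    show "a x * \<alpha> x + b x * ((?t x)\<^sup>2 * \<delta> x) = cay x ^ n * c x" "a x * \<delta> x + b x * \<alpha> x = cay x ^ n * d x"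
      using eq unfolding mat2_mult mat2_eq_iff by simp_all
  qed
  let ?m = "\<lambda>x. 1 - \<beta> * disc_coord 1 x"
  let ?l = "\<lambda>x. 1 - \<beta> * disc_coord (-1) x"
  have m: "?m \<in> disc_alg \<mu> 1" and l: "?l \<in> disc_alg \<mu> (-1)"
    using \<mu> \<mu>' by (auto intro!: disc_alg_diff disc_alg_mult disc_coord_disc_alg)
  have bnz: "1 - \<beta> * z \<noteq> 0" if "norm z \<le> 1" for z using blaschke_denominator[OF k that] by (simp add: \<beta>_def)
  have mnz: "?m x \<noteq> 0" and lnz: "?l x \<noteq> 0" if "x \<in> Rdot" for x using bnz norm_disc_coord[OF e1 that] norm_disc_coord[OF e2 that] by simp_all
  define N where "N x = (a x)\<^sup>2 - (?t x)\<^sup>2 * (b x)\<^sup>2" for x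
  have N: "N \<in> disc_alg \<mu> 1"
    unfolding N_def power2_eq_square[of "a _"] power2_eq_square[of "b _"]
    by (intro disc_alg_diff disc_alg_mult t_line_square_disc_alg A k e1 \<mu> \<mu>')
  define p where "p x = (cay x * (cay x - \<beta>) * (c x * c x) - ?l x * (d x * d x)) * gpi x" for x
  have cayA: "cay \<in> disc_alg \<mu> (-1)" by (rule disc_alg_cong[OF disc_coord_disc_alg[OF e2 \<mu>(1) \<mu>']]) (simp add: disc_coord_upper)
  have p: "p \<in> disc_alg \<mu> (-1)"
    unfolding p_def by (intro disc_alg_diff disc_alg_mult disc_alg_const cayA A l gpi \<mu>)
  have rel: "N x * \<gamma>m x * ?m x = disc_coord (-1) x ^ (2 * (n - 1)) * p x" if x: "x \<in> Rdot" for x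
  proof -
    let ?w = "cay x"
    have w: "?w \<noteq> 0" "?w - \<beta> \<noteq> 0" using cay_nonzero[OF x] t_line_square_cay(1)[OF k x] by (auto simp: \<beta>_def)
    have t2: "(?t x)\<^sup>2 * (?w * (?w - \<beta>)) = ?l x" unfolding t_line_square_cay(2)[OF k x] using w by (simp add: \<beta>_def disc_coord_upper)
    have m1: "?m x * ?w = ?w - \<beta>" using w by (simp add: disc_coord_lower field_simps)
    have dG: "(\<alpha> x)\<^sup>2 - (?t x)\<^sup>2 * (\<delta> x)\<^sup>2 = \<gamma>m x * \<gamma>p x"
      using det[OF x] unfolding Gx[OF x] mat2_det by (simp add: power2_eq_square ac_simps)
    have "N x * (\<gamma>m x * \<gamma>p x) = (a x * \<alpha> x + b x * ((?t x)\<^sup>2 * \<delta> x))\<^sup>2 - (?t x)\<^sup>2 * (a x * \<delta> x + b x * \<alpha> x)\<^sup>2"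
      unfolding N_def dG[symmetric] by (simp add: power2_eq_square algebra_simps)
    also have "\<dots> = (?w ^ n)\<^sup>2 * ((c x)\<^sup>2 - (?t x)\<^sup>2 * (d x)\<^sup>2)" unfolding row[OF x] by (simp add: power_mult_distrib algebra_simps)
    finally have 1: "N x * (\<gamma>m x * \<gamma>p x) = (?w ^ n)\<^sup>2 * ((c x)\<^sup>2 - (?t x)\<^sup>2 * (d x)\<^sup>2)" .
    have "N x * \<gamma>m x * ?m x * (?w * ?w) = N x * (\<gamma>m x * \<gamma>p x) * gpi x * (?m x * ?w) * ?w"
      using gpi(3)[OF x] by (simp add: ac_simps)
    also have "\<dots> = (?w ^ n)\<^sup>2 * ((c x)\<^sup>2 * (?w * (?w - \<beta>)) - ((?t x)\<^sup>2 * (?w * (?w - \<beta>))) * (d x)\<^sup>2) * gpi x"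
      unfolding 1 m1 by (simp add: algebra_simps)
    also have "\<dots> = (?w ^ n)\<^sup>2 * p x" unfolding t2 p_def by (simp add: power2_eq_square ac_simps)
    also have "(?w ^ n)\<^sup>2 = ?w ^ (2 * (n - 1)) * (?w * ?w)"
    proof -
      have "?w ^ n = ?w ^ (n - 1) * ?w" using n(1) by (simp add: power_eq_if)
      then show ?thesis by (simp add: power2_eq_square mult_2 power_add)
    qed
    finally have "(N x * \<gamma>m x * ?m x) * (?w * ?w) = (?w ^ (2 * (n - 1)) * p x) * (?w * ?w)" by (simp only: ac_simps)
    then show ?thesis using w(1) by (simp add: disc_coord_upper)
  qed
  have NA: "(\<lambda>x. N x * \<gamma>m x * ?m x) \<in> disc_alg \<mu> 1" by (intro disc_alg_mult N gmi m \<mu>)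
  have pows: "(\<lambda>x. disc_coord (-1) x ^ j) \<in> disc_alg \<mu> (-1)" for j
    by (induction j) (auto intro!: disc_alg_mult disc_coord_disc_alg \<mu> \<mu>')
  have "(\<lambda>x. N x * \<gamma>m x * ?m x) \<in> disc_alg \<mu> (-1)"
    by (rule disc_alg_cong[OF disc_alg_mult[OF pows p \<mu>(1)]]) (rule rel)
  then obtain C where C: "\<And>x. x \<in> Rdot \<Longrightarrow> N x * \<gamma>m x * ?m x = C" using disc_alg_both_const[OF NA _ \<mu>(1)] by blast
  have C0: "C \<noteq> 0"
  proof
    \<comment> \<open>Otherwise \<open>a\<^sup>2 = t\<^sup>2 b\<^sup>2\<close>, and as \<open>t\<^sup>2\<close> has a simple zero at the centre of the disc, both \<open>a\<close> and \<open>b\<close>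
      vanish there, in contrast to the invertibility of the matrix they belong to.\<close>
    assume "C = 0"
    have N0: "(a x)\<^sup>2 = (?t x)\<^sup>2 * (b x)\<^sup>2" if x: "x \<in> Rdot" for x
    proof -
      have "\<gamma>m x \<noteq> 0" using gmi(3)[OF x] by auto
      then have "N x = 0" using C[OF x] mnz[OF x] \<open>C = 0\<close> by simp
      then show ?thesis by (simp add: N_def)
    qed
    obtain Fa where Fa: "Fa \<in> disc_functions" "\<And>x. x \<in> Rdot \<Longrightarrow> a x = Fa (disc_coord 1 x)" by (rule disc_algE[OF A(1)]) (rule that; assumption)
    obtain Fb where Fb: "Fb \<in> disc_functions" "\<And>x. x \<in> Rdot \<Longrightarrow> b x = Fb (disc_coord 1 x)" by (rule disc_algE[OF A(2)]) (rule that; assumption)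
    have circ1: "(1 - \<beta> * z) * (Fa z)\<^sup>2 = z * (z - \<beta>) * (Fb z)\<^sup>2" if z: "norm z = 1" for z
    proof -
      obtain x where x: "x \<in> Rdot" "disc_coord 1 x = z" using disc_coord_onto_circle[OF e1 z] by blast
      have "(Fa z)\<^sup>2 = blaschke k0 z * (Fb z)\<^sup>2" using N0[OF x(1)] Fa(2)[OF x(1)] Fb(2)[OF x(1)] t_line_square[OF k e1 x(1)] x(2) by simp
      then show ?thesis using bnz[of z] z by (simp add: blaschke_def \<beta>_def[symmetric])
    qed
    have "(1 - \<beta> * 0) * (Fa 0)\<^sup>2 = 0 * (0 - \<beta>) * (Fb 0)\<^sup>2"
      by (rule disc_functions_eqI[where F="\<lambda>z. (1 - \<beta> * z) * (Fa z)\<^sup>2" and H="\<lambda>z. z * (z - \<beta>) * (Fb z)\<^sup>2"])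
        (use Fa(1) Fb(1) circ1 in \<open>auto simp: disc_functions_def intro!: continuous_intros holomorphic_intros\<close>)
    then have Fa0: "Fa 0 = 0" by simp
    have n0: "norm (0::complex) < 1" by simp
    obtain A1 where A1: "A1 \<in> disc_functions" "\<And>z. norm z \<le> 1 \<Longrightarrow> Fa z = (z - 0) * A1 z"
      by (rule disc_alg_divide_zero[OF e1 \<mu>(1) \<mu>' disc_alg_C_mu[OF A(1)] Fa(1) _ n0 Fa0]) (erule Fa(2), (rule that; assumption))
    have circ2: "z * (1 - \<beta> * z) * (A1 z)\<^sup>2 = (z - \<beta>) * (Fb z)\<^sup>2" if z: "norm z = 1" for z
    proof -
      have "z \<noteq> 0" using z by auto
      moreover have "z * (z * (1 - \<beta> * z) * (A1 z)\<^sup>2) = z * ((z - \<beta>) * (Fb z)\<^sup>2)"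
        using circ1[OF z] A1(2)[of z] z by (simp add: power_mult_distrib power2_eq_square ac_simps)
      ultimately show ?thesis by simp
    qed
    have "0 * (1 - \<beta> * 0) * (A1 0)\<^sup>2 = (0 - \<beta>) * (Fb 0)\<^sup>2"
      by (rule disc_functions_eqI[where F="\<lambda>z. z * (1 - \<beta> * z) * (A1 z)\<^sup>2" and H="\<lambda>z. (z - \<beta>) * (Fb z)\<^sup>2"])
        (use A1(1) Fb(1) circ2 in \<open>auto simp: disc_functions_def intro!: continuous_intros holomorphic_intros\<close>)
    then have Fb0: "Fb 0 = 0" using \<beta>(2) by simp
    have H2: "(\<lambda>x. H x $ 2 $ 1) \<in> disc_alg \<mu> 1" "(\<lambda>x. H x $ 2 $ 2) \<in> disc_alg \<mu> 1" using H(1) by (auto simp: mat2_units_on_def mat2_over_iff)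
    obtain Fc where Fc: "Fc \<in> disc_functions" "\<And>x. x \<in> Rdot \<Longrightarrow> H x $ 2 $ 1 = Fc (disc_coord 1 x)" by (rule disc_algE[OF H2(1)]) (rule that; assumption)
    obtain Fd where Fd: "Fd \<in> disc_functions" "\<And>x. x \<in> Rdot \<Longrightarrow> H x $ 2 $ 2 = Fd (disc_coord 1 x)" by (rule disc_algE[OF H2(2)]) (rule that; assumption)
    have "Fa 0 * Fd 0 - Fb 0 * Fc 0 \<noteq> 0"
    proof (rule disc_alg_units_nonzero[OF e1 mat2_unit_det[OF H(1) \<mu>(1)], where F="\<lambda>z. Fa z * Fd z - Fb z * Fc z"])
      show "(\<lambda>z. Fa z * Fd z - Fb z * Fc z) \<in> disc_functions"
        using Fa(1) Fb(1) Fc(1) Fd(1) by (auto simp: disc_functions_def intro!: continuous_intros holomorphic_intros)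
      show "det (H x) = Fa (disc_coord 1 x) * Fd (disc_coord 1 x) - Fb (disc_coord 1 x) * Fc (disc_coord 1 x)" if x: "x \<in> Rdot" for x
        unfolding det_2 using Fa(2)[OF x] Fb(2)[OF x] Fc(2)[OF x] Fd(2)[OF x] by (simp add: a_def b_def)
    qed simp
    then show False using Fa0 Fb0 by simp
  qed
  have n1: "n = 1"
  proof (rule ccontr)
    assume "n \<noteq> 1"
    then have "2 * (n - 1) > 0" using n(1) by simp
    then have "N None * \<gamma>m None * ?m None = 0"
      by (intro disc_alg_winding_zero[OF e2 \<mu>(1) \<mu>' p, where n="2 * (n - 1)"]) (use NA rel in auto)
    then show False using C[of None] C0 by simp
  qed
  define y where "y x = \<gamma>m x * ?m x * (1 / C)" for x
  have y: "y \<in> disc_alg \<mu> 1" unfolding y_def by (intro disc_alg_mult disc_alg_const gmi m \<mu>)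
  have Ny: "N x * y x = 1" if "x \<in> Rdot" for x using C[OF that] C0 by (simp add: y_def field_simps)
  define gM where "gM P = a (Proj P) * y (Proj P) + t_coord k0 1 P * (- (b (Proj P) * y (Proj P)))" for P
  have gM: "gM \<in> units_on (Gam k0) (C_mu_Gam_half k0 \<mu> (half 1))"
    unfolding gM_def
  proof (rule surface_unit[OF k e1 \<mu>(1) \<mu>' _ _ N, of "\<lambda>x. a x * y x" "\<lambda>x. - (b x * y x)"])
    fix x assume x: "x \<in> Rdot"
    have "(a x * y x)\<^sup>2 - (?t x)\<^sup>2 * (- (b x * y x))\<^sup>2 = N x * y x * y x" by (simp add: N_def power2_eq_square algebra_simps)
    then show "((a x * y x)\<^sup>2 - (?t x)\<^sup>2 * (- (b x * y x))\<^sup>2) * N x = 1" using Ny[OF x] by (simp add: mult.commute)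
  qed (intro disc_alg_mult disc_alg_uminus A y \<mu>)+
  define gP where "gP P = d (Proj P) + t_coord k0 (-1) P * c (Proj P)" for P
  define z where "z x = ?l x * gpi x * (- 1 / C)" for x
  have z: "z \<in> disc_alg \<mu> (-1)" unfolding z_def by (intro disc_alg_mult disc_alg_const gpi l \<mu>)
  have gP: "gP \<in> units_on (Gam k0) (C_mu_Gam_half k0 \<mu> (half (-1)))"
    unfolding gP_def
  proof (rule surface_unit[OF k e2 \<mu>(1) \<mu>' A(4,3) z])
    fix x assume x: "x \<in> Rdot"
    let ?w = "cay x"
    have w: "?w \<noteq> 0" "?w - \<beta> \<noteq> 0" using cay_nonzero[OF x] t_line_square_cay(1)[OF k x] by (auto simp: \<beta>_def)
    have "p x = C" using rel[OF x] C[OF x] n1 by simp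
    then have pC: "(?w * (?w - \<beta>) * (c x)\<^sup>2 - ?l x * (d x)\<^sup>2) * gpi x = C" by (simp add: p_def power2_eq_square)
    have tt: "(t_line k0 (-1) x)\<^sup>2 * ?l x = ?w * (?w - \<beta>)"
      using t_line_square[OF k e2 x] bnz[of ?w] norm_cay[OF x] by (simp add: disc_coord_upper blaschke_def \<beta>_def[symmetric])
    have "((d x)\<^sup>2 - (t_line k0 (-1) x)\<^sup>2 * (c x)\<^sup>2) * z x = ((?l x * (d x)\<^sup>2 - (t_line k0 (-1) x)\<^sup>2 * ?l x * (c x)\<^sup>2) * gpi x) * (- 1 / C)"
      unfolding z_def by (simp only: algebra_simps)
    also have "\<dots> = ((?w * (?w - \<beta>) * (c x)\<^sup>2 - ?l x * (d x)\<^sup>2) * gpi x) * (1 / C)" unfolding tt by (simp add: algebra_simps)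
    also have "\<dots> = 1" unfolding pC using C0 by simp
    finally show "((d x)\<^sup>2 - (t_line k0 (-1) x)\<^sup>2 * (c x)\<^sup>2) * z x = 1" .
  qed
  have "Sig_symbol k0 G P = gM P * r0 k0 P * gP P" if P: "P \<in> Gam k0" for P
  proof -
    obtain x \<sigma> where x: "x \<in> Rdot" "\<sigma> \<in> {1, -1}" "P = Gam_lift k0 \<sigma> x" by (rule Gam_cases[OF k P])
    have \<sigma>: "\<sigma> * \<sigma> = 1" using x(2) by auto
    have ti: "?t x * t_line k0 (-1) x = 1" by (rule t_line_mult[OF k e1 x(1)])
    have S: "Sig_symbol k0 G P = \<alpha> x + \<sigma> * ?t x * \<delta> x"
      unfolding Sig_symbol_def tau_over_p2_t_coord x(3) Proj_Gam_lift[OF x(1)] t_coord_lift by (simp add: \<alpha>_def \<delta>_def)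
    have M: "gM P = (a x - \<sigma> * ?t x * b x) * y x" unfolding gM_def x(3) Proj_Gam_lift[OF x(1)] t_coord_lift by (simp add: algebra_simps)
    have Pp: "gP P = d x + \<sigma> * t_line k0 (-1) x * c x" unfolding gP_def x(3) Proj_Gam_lift[OF x(1)] t_coord_lift by simp
    have "r0 k0 P * gP P = \<sigma> * ?t x * (cay x * d x) + (\<sigma> * \<sigma>) * (?t x * t_line k0 (-1) x) * (cay x * c x)"
      unfolding Pp unfolding x(3) r0_lift[OF k x(1)] by (simp add: algebra_simps)
    also have "\<dots> = (a x * \<alpha> x + b x * ((?t x)\<^sup>2 * \<delta> x)) + \<sigma> * ?t x * (a x * \<delta> x + b x * \<alpha> x)"
      unfolding row[OF x(1)] using \<sigma> ti n1 by simp
    finally have rP: "r0 k0 P * gP P = (a x * \<alpha> x + b x * ((?t x)\<^sup>2 * \<delta> x)) + \<sigma> * ?t x * (a x * \<delta> x + b x * \<alpha> x)" .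
    have "gM P * r0 k0 P * gP P = gM P * (r0 k0 P * gP P)" by (rule mult.assoc)
    also have "\<dots> = ((a x - \<sigma> * ?t x * b x) * y x) * ((a x * \<alpha> x + b x * ((?t x)\<^sup>2 * \<delta> x)) + \<sigma> * ?t x * (a x * \<delta> x + b x * \<alpha> x))"
      unfolding rP M ..
    also have "\<dots> = (N x * y x) * (\<alpha> x + \<sigma> * ?t x * \<delta> x)"
      using \<sigma> unfolding N_def by algebra
    finally show ?thesis unfolding S Ny[OF x(1)] by simp
  qed
  then show ?thesis unfolding r0_factorization_def half_lower[symmetric] half_upper[symmetric] using gM gP by blast
qed

text \<open>Units on a half surface correspond to unit matrices of the class; for \<open>r\<^sub>0\<close> the matrix is a
  permutation of the rows of a diagonal matrix, with entries \<open>cay\<close> and, up to units, \<open>1 / cay\<close>.\<close>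

lemma r0_factorization_indices:
  assumes k: "k0 > 1" and \<mu>: "0 < \<mu>" "\<mu> < 1" and G: "G \<in> C_Q k0 \<mu>"
    and r0: "r0_factorization k0 \<mu> (Sig_symbol k0 G)"
  shows "bounded_factorization \<mu> G 1 (-1)"
proof -
  have \<mu>': "\<mu> \<le> 1" using \<mu> by simp
  have e1: "(1::real) \<in> {1, -1}" and e2: "(-1::real) \<in> {1, -1}" by auto
  let ?t = "t_line k0 1"
  define \<beta> where "\<beta> = complex_of_real (branch_zero k0)"
  have tn: "?t x \<noteq> 0" if "x \<in> Rdot" for x using norm_t_line[OF k e1 that] by auto
  have comps: "\<exists>u v y. u \<in> disc_alg \<mu> e \<and> v \<in> disc_alg \<mu> e \<and> y \<in> disc_alg \<mu> e \<and>
      (\<forall>x\<in>Rdot. ((u x)\<^sup>2 - (t_line k0 e x)\<^sup>2 * (v x)\<^sup>2) * y x = 1 \<and>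
        (\<forall>\<sigma>\<in>{1, -1}. g (Gam_lift k0 \<sigma> x) = u x + \<sigma> * t_line k0 e x * v x))"
    if g: "g \<in> units_on (Gam k0) (C_mu_Gam_half k0 \<mu> (half e))" and e: "e \<in> {1, -1}" for g e
  proof -
    obtain h where gh: "g \<in> C_mu_Gam_half k0 \<mu> (half e)" "h \<in> C_mu_Gam_half k0 \<mu> (half e)" "\<And>P. P \<in> Gam k0 \<Longrightarrow> g P * h P = 1"
      by (rule units_onE[OF g]) (rule that; assumption)
    obtain u v where uv: "u \<in> disc_alg \<mu> e" "v \<in> disc_alg \<mu> e" "\<And>x \<sigma>. x \<in> Rdot \<Longrightarrow> \<sigma> \<in> {1, -1} \<Longrightarrow> g (Gam_lift k0 \<sigma> x) = u x + \<sigma> * t_line k0 e x * v x"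
      by (rule surface_function_components[OF k e \<mu>(1) \<mu>' gh(1)]) (rule that; assumption)
    obtain u' v' where uv': "u' \<in> disc_alg \<mu> e" "v' \<in> disc_alg \<mu> e" "\<And>x \<sigma>. x \<in> Rdot \<Longrightarrow> \<sigma> \<in> {1, -1} \<Longrightarrow> h (Gam_lift k0 \<sigma> x) = u' x + \<sigma> * t_line k0 e x * v' x"
      by (rule surface_function_components[OF k e \<mu>(1) \<mu>' gh(2)]) (rule that; assumption)
    let ?y = "\<lambda>x. u' x * u' x - (t_line k0 e x)\<^sup>2 * (v' x * v' x)"
    have y: "?y \<in> disc_alg \<mu> e" by (intro disc_alg_diff disc_alg_mult t_line_square_disc_alg uv' k e \<mu> \<mu>')
    have "((u x)\<^sup>2 - (t_line k0 e x)\<^sup>2 * (v x)\<^sup>2) * ?y x = 1" if x: "x \<in> Rdot" for x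
    proof -
      have on: "Gam_lift k0 1 x \<in> Gam k0" "Gam_lift k0 (-1) x \<in> Gam k0" using Gam_lift_image[OF k] x by auto
      have "(u x + t_line k0 e x * v x) * (u' x + t_line k0 e x * v' x) = 1" "(u x - t_line k0 e x * v x) * (u' x - t_line k0 e x * v' x) = 1"
        using gh(3)[OF on(1)] gh(3)[OF on(2)] uv(3)[OF x, of 1] uv'(3)[OF x, of 1] uv(3)[OF x, of "-1"] uv'(3)[OF x, of "-1"] by simp_all
      moreover have "((u x)\<^sup>2 - (t_line k0 e x)\<^sup>2 * (v x)\<^sup>2) * ?y x =
          ((u x + t_line k0 e x * v x) * (u' x + t_line k0 e x * v' x)) * ((u x - t_line k0 e x * v x) * (u' x - t_line k0 e x * v' x))"
        by (simp add: power2_eq_square algebra_simps)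
      ultimately show ?thesis by simp
    qed
    with uv y show ?thesis by blast
  qed
  obtain gM gP where g: "gM \<in> units_on (Gam k0) (C_mu_Gam_half k0 \<mu> (half 1))" "gP \<in> units_on (Gam k0) (C_mu_Gam_half k0 \<mu> (half (-1)))"
    "\<And>P. P \<in> Gam k0 \<Longrightarrow> Sig_symbol k0 G P = gM P * r0 k0 P * gP P"
    using r0 unfolding r0_factorization_def half_lower half_upper by blast
  obtain u v y where M: "u \<in> disc_alg \<mu> 1" "v \<in> disc_alg \<mu> 1" "y \<in> disc_alg \<mu> 1"
    "\<And>x. x \<in> Rdot \<Longrightarrow> ((u x)\<^sup>2 - (?t x)\<^sup>2 * (v x)\<^sup>2) * y x = 1"
    "\<And>x \<sigma>. x \<in> Rdot \<Longrightarrow> \<sigma> \<in> {1, -1} \<Longrightarrow> gM (Gam_lift k0 \<sigma> x) = u x + \<sigma> * ?t x * v x" using comps[OF g(1) e1] by blast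
  obtain a b z where P: "a \<in> disc_alg \<mu> (-1)" "b \<in> disc_alg \<mu> (-1)" "z \<in> disc_alg \<mu> (-1)"
    "\<And>x. x \<in> Rdot \<Longrightarrow> ((a x)\<^sup>2 - (t_line k0 (-1) x)\<^sup>2 * (b x)\<^sup>2) * z x = 1"
    "\<And>x \<sigma>. x \<in> Rdot \<Longrightarrow> \<sigma> \<in> {1, -1} \<Longrightarrow> gP (Gam_lift k0 \<sigma> x) = a x + \<sigma> * t_line k0 (-1) x * b x" using comps[OF g(2) e2] by blast
  let ?m = "\<lambda>x. 1 - \<beta> * disc_coord 1 x"
  let ?l = "\<lambda>x. 1 - \<beta> * disc_coord (-1) x"
  have m: "?m \<in> disc_alg \<mu> 1" and l: "?l \<in> disc_alg \<mu> (-1)"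
    using \<mu> \<mu>' by (auto intro!: disc_alg_diff disc_alg_mult disc_coord_disc_alg)
  have bnz: "1 - \<beta> * z \<noteq> 0" if "norm z \<le> 1" for z using blaschke_denominator[OF k that] by (simp add: \<beta>_def)
  have bF: "(\<lambda>z. 1 - \<beta> * z) \<in> disc_functions" by (auto simp: disc_functions_def intro!: continuous_intros holomorphic_intros)
  have mi: "(\<lambda>x. 1 / ?m x) \<in> disc_alg \<mu> 1" by (rule disc_alg_inverse[OF e1 disc_alg_C_mu[OF m] bF]) (use bnz in auto)
  have li: "(\<lambda>x. 1 / ?l x) \<in> disc_alg \<mu> (-1)" by (rule disc_alg_inverse[OF e2 disc_alg_C_mu[OF l] bF]) (use bnz in auto)
  have mnz: "?m x \<noteq> 0" and lnz: "?l x \<noteq> 0" if "x \<in> Rdot" for x using bnz norm_disc_coord[OF e1 that] norm_disc_coord[OF e2 that] by simp_all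
  let ?M = "\<lambda>x. mat2 (u x) (v x) ((?t x)\<^sup>2 * v x) (u x)"
  have MU: "?M \<in> mat2_units_on Rdot (disc_alg \<mu> 1)"
  proof (rule mat2_unitI[OF _ M(3) _ \<mu>(1)])
    show "?M \<in> mat2_over (disc_alg \<mu> 1)" by (intro mat2_overI disc_alg_mult t_line_square_disc_alg M k e1 \<mu> \<mu>')
    show "det (?M x) * y x = 1" if "x \<in> Rdot" for x using M(4)[OF that] by (simp add: mat2_det power2_eq_square ac_simps)
  qed
  let ?P = "\<lambda>x. mat2 (a x) ((t_line k0 (-1) x)\<^sup>2 * b x) (b x) (a x)"
  have PU: "?P \<in> mat2_units_on Rdot (disc_alg \<mu> (-1))"
  proof (rule mat2_unitI[OF _ P(3) _ \<mu>(1)])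
    show "?P \<in> mat2_over (disc_alg \<mu> (-1))" by (intro mat2_overI disc_alg_mult t_line_square_disc_alg P k e2 \<mu> \<mu>')
    show "det (?P x) * z x = 1" if "x \<in> Rdot" for x using P(4)[OF that] by (simp add: mat2_det power2_eq_square ac_simps)
  qed
  have "(\<lambda>x. mat2 1 0 0 (1 / ?m x)) \<in> mat2_units_on Rdot (disc_alg \<mu> 1)"
    by (rule mat2_unitI[OF _ m _ \<mu>(1)]) (use mi mnz in \<open>auto simp: mat2_det intro!: mat2_overI\<close>)
  note LU = mat2_unit_mult[OF MU this \<mu>(1)]
  have "(\<lambda>x. mat2 0 1 (?l x) 0) \<in> mat2_units_on Rdot (disc_alg \<mu> (-1))"
  proof (rule mat2_unitI[OF _ disc_alg_uminus[OF li] _ \<mu>(1)])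
    have "det (mat2 0 1 y 0) * - (1 / y) = 1" if "y \<noteq> 0" for y using that by (simp add: mat2_det)
    then show "det (mat2 0 1 (?l x) 0) * - (1 / ?l x) = 1" if "x \<in> Rdot" for x using lnz[OF that] by blast
  qed (intro mat2_overI disc_alg_const l)
  note RU = mat2_unit_mult[OF this PU \<mu>(1)]
  show ?thesis
  proof (rule bounded_factorizationI[OF \<mu> LU RU])
    fix x assume x: "x \<in> Rdot"
    let ?w = "cay x"
    have t: "?t x \<noteq> 0" by (rule tn[OF x])
    have w: "?w \<noteq> 0" "?w - \<beta> \<noteq> 0" using cay_nonzero[OF x] t_line_square_cay(1)[OF k x] by (auto simp: \<beta>_def)
    have ti: "?t x * t_line k0 (-1) x = 1" by (rule t_line_mult[OF k e1 x])
    have on: "Gam_lift k0 1 x \<in> Gam k0" "Gam_lift k0 (-1) x \<in> Gam k0" using Gam_lift_image[OF k] x by auto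
    have S: "Sig_symbol k0 G (Gam_lift k0 \<sigma> x) = G x $ 1 $ 1 + \<sigma> * ?t x * G x $ 1 $ 2" for \<sigma>
      unfolding Sig_symbol_def tau_over_p2_t_coord Proj_Gam_lift[OF x] t_coord_lift ..
    have s1: "G x $ 1 $ 1 + ?t x * G x $ 1 $ 2 = (u x + ?t x * v x) * (?w * ?t x) * (a x + t_line k0 (-1) x * b x)"
      and s2: "G x $ 1 $ 1 - ?t x * G x $ 1 $ 2 = (u x - ?t x * v x) * (- (?w * ?t x)) * (a x - t_line k0 (-1) x * b x)"
      using g(3)[OF on(1)] g(3)[OF on(2)] S[of 1] S[of "-1"] M(5)[OF x, of 1] M(5)[OF x, of "-1"] P(5)[OF x, of 1] P(5)[OF x, of "-1"]
        r0_lift[OF k x, of 1] r0_lift[OF k x, of "-1"] by simp_all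
    have "G x = symb (?t x) (u x + ?t x * v x) (u x - ?t x * v x) ** symb (?t x) (0 + ?t x * ?w) (0 - ?t x * ?w) ** symb (?t x) (a x + ?t x * ((t_line k0 (-1) x)\<^sup>2 * b x)) (a x - ?t x * ((t_line k0 (-1) x)\<^sup>2 * b x))"
    proof -
      have "?t x * ((t_line k0 (-1) x)\<^sup>2 * b x) = (?t x * t_line k0 (-1) x) * t_line k0 (-1) x * b x" by (simp add: power2_eq_square)
      then have bt: "?t x * ((t_line k0 (-1) x)\<^sup>2 * b x) = t_line k0 (-1) x * b x" using ti by simp
      show ?thesis
        unfolding bt symb_mult[OF t] add_0_left diff_0 s1[symmetric, unfolded mult.commute[of "cay x"]] s2[symmetric, unfolded mult.commute[of "cay x"]]
        by (rule C_Q_symb[OF G k x])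
    qed
    also have "symb (?t x) (u x + ?t x * v x) (u x - ?t x * v x) = ?M x" by (rule symb_components[OF t])
    also have "symb (?t x) (a x + ?t x * ((t_line k0 (-1) x)\<^sup>2 * b x)) (a x - ?t x * ((t_line k0 (-1) x)\<^sup>2 * b x)) = ?P x"
    proof -
      have "(?t x)\<^sup>2 * ((t_line k0 (-1) x)\<^sup>2 * b x) = (?t x * t_line k0 (-1) x)\<^sup>2 * b x" by (simp add: power_mult_distrib)
      then have "(?t x)\<^sup>2 * ((t_line k0 (-1) x)\<^sup>2 * b x) = b x" unfolding ti by simp
      then show ?thesis unfolding symb_components[OF t] by (simp only:)
    qed
    also have "symb (?t x) (0 + ?t x * ?w) (0 - ?t x * ?w) = mat2 1 0 0 (1 / ?m x) ** D_mat 1 (-1) x ** mat2 0 1 (?l x) 0"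
    proof -
      have mw: "?w - \<beta> = ?m x * ?w" using w by (simp add: disc_coord_lower field_simps)
      have q: "q / (?w * (y * ?w)) * ?w = 1 / y * (inverse ?w * q)" for q y using w(1) by (simp add: divide_inverse)
      have "(?t x)\<^sup>2 * ?w = 1 / ?m x * (inverse ?w * ?l x)"
        unfolding t_line_square_cay(2)[OF k x] \<beta>_def[symmetric] mw q by (simp add: disc_coord_upper)
      then show ?thesis unfolding symb_components[OF t] by (simp add: D_mat_def mat2_mult)
    qed
    finally show "G x = (?M x ** mat2 1 0 0 (1 / ?m x)) ** D_mat 1 (-1) x ** (mat2 0 1 (?l x) 0 ** ?P x)"
      by (simp only: matrix_mul_assoc)
  qed
qed

theorem corollary6p5:
  fixes k0 \<mu> :: real and m :: int
    and G :: "complex option \<Rightarrow> complex^2^2"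
    and \<gamma>m \<gamma>p :: "complex option \<Rightarrow> complex"
  assumes "k0 > 1" and "0 < \<mu>" and "\<mu> < 1"
    and "G \<in> C_Q k0 \<mu>"
    and "\<gamma>m \<in> units_on Rdot (C_mu_half \<mu> lower_half)"
    and "\<gamma>p \<in> units_on Rdot (C_mu_half \<mu> upper_half)"
    and "\<forall>x\<in>Rdot. det (G x) = \<gamma>m x * cay x powi m * \<gamma>p x"
    and "m = 0"
  shows "(\<not> r0_factorization k0 \<mu> (Sig_symbol k0 G) \<longrightarrow> bounded_factorization \<mu> G 0 0) \<and>
         (r0_factorization k0 \<mu> (Sig_symbol k0 G) \<longrightarrow>
            bounded_factorization \<mu> G 1 (-1) \<and> \<not> bounded_factorization \<mu> G 0 0)"
proof (intro conjI impI)
  note \<mu> = assms(2,3)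
  have units: "\<gamma>m \<in> units_on Rdot (disc_alg \<mu> 1)" "\<gamma>p \<in> units_on Rdot (disc_alg \<mu> (-1))"
    using assms(5,6) C_mu_half_eq_disc_alg[OF \<mu>, of 1] C_mu_half_eq_disc_alg[OF \<mu>, of "-1"] by (simp_all add: half_lower half_upper)
  have det: "det (G x) = \<gamma>m x * \<gamma>p x" if "x \<in> Rdot" for x using assms(7,8) that by simp
  {
    assume no: "\<not> r0_factorization k0 \<mu> (Sig_symbol k0 G)"
    obtain k1 k2 where fac: "bounded_factorization \<mu> G k1 k2" using C_Q_factorization_exists[OF assms(1) \<mu> assms(4)] by blast
    have sum: "k1 + k2 = 0" by (rule index_sum_zero[OF \<mu> fac units det])
    have "\<not> k1 > 0" using positive_index_r0_factorization[OF assms(1) \<mu> assms(4) fac _ units det] no by blast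
    moreover have "\<not> k2 > 0"
      using positive_index_r0_factorization[OF assms(1) \<mu> assms(4) bounded_factorization_swap[OF fac \<mu>] _ units det] no by blast
    ultimately have "k1 = 0" "k2 = 0" using sum by auto
    then show "bounded_factorization \<mu> G 0 0" using fac by simp
  }
  assume "r0_factorization k0 \<mu> (Sig_symbol k0 G)"
  then show "bounded_factorization \<mu> G 1 (-1)" by (rule r0_factorization_indices[OF assms(1) \<mu> assms(4)])
  then show "\<not> bounded_factorization \<mu> G 0 0" by (rule not_canonical[OF \<mu>])
qed

end
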